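(* Let $\mathcal{M}$ be a preadditive monoidal category with equalizers and denumerable coproducts. Assume that the tensor functors are additive and preserve equalizers and denumerable coproducts. Let $T_{\mathrm{Br}}:\mathrm{Br}_{\mathcal{M}}\to\mathrm{BrAlg}_{\mathcal{M}}$ be the left adjoint of the forgetful functor $\Omega_{\mathrm{Br}}:\mathrm{BrAlg}_{\mathcal{M}}\to\mathrm{Br}_{\mathcal{M}}$. Let $(V,c)\in\mathrm{Br}_{\mathcal{M}}$ and write $T_{\mathrm{Br}}(V,c)=(A,m_A,u_A,c_A)$. Regard $A\otimes A$ as an algebra in $\mathcal{M}$ via $m_{A\otimes A}:=(m_A\otimes m_A)(A\otimes c_A\otimes A)$ and $u_{A\otimes A}:=(u_A\otimes u_A)\Delta_{\mathbf{1}}$. For every $n\in\mathbb{N}$ denote by $\alpha_nV:V^{\otimes n}\to\Omega TV$ the canonical injection. Then there are unique algebra morphisms $\Delta_A:A\to A\otimes A$ and $\varepsilon_A:A\to\mathbf{1}$ such that $$\Delta_A\circ\alpha_1V=\delta_V^l+\delta_V^r,\qquad \varepsilon_A\circ\alpha_1V=0,$$ where $\delta_V^l:=(u_A\otimes\alpha_1V)\circ l_V^{-1}$ and $\delta_V^r:=(\alpha_1V\otimes u_A)\circ r_V^{-1}$. Moreover $$\varepsilon_A\circ\alpha_nV=\delta_{n,0}\mathrm{Id}_{\mathbf{1}}\quad\text{for every }n\in\mathbb{N}$$ (that is, it is $\mathrm{Id}_{\mathbf 1}$ for $n=0$ and $0$ for $n>0$). The datum $(A,m_A,u_A,\Delta_A,\varepsilon_A,c_A)$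 is a braided bialgebra. Moreover $T_{\mathrm{Br}}$ induces a functor $$\overline{T}_{\mathrm{Br}}:\mathrm{Br}_{\mathcal{M}}\to\mathrm{BrBialg}_{\mathcal{M}},\quad (V,c)\mapsto(A,m_A,u_A,\Delta_A,\varepsilon_A,c_A),\quad f\mapsto T_{\mathrm{Br}}(f),$$ so that $\mho_{\mathrm{Br}}\circ\overline{T}_{\mathrm{Br}}=T_{\mathrm{Br}}$, where $\mho_{\mathrm{Br}}:\mathrm{BrBialg}_{\mathcal M}\to\mathrm{BrAlg}_{\mathcal M}$ is the forgetful functor.
   Context: Associativity constraints of $(\mathcal M,\otimes,\mathbf 1,a,l,r)$ are suppressed; $l_X:\mathbf 1\otimes X\to X$, $r_X:X\otimes\mathbf 1\to X$; an object also denotes its identity morphism. The tensor functors are $M\otimes(-)$ and $(-)\otimes M$ for all objects $M$. $V^{\otimes 0}=\mathbf 1$, $V^{\otimes 1}=V$, $V^{\otimes n}=V^{\otimes(n-1)}\otimes V$ for $n\ge 2$. $\Delta_{\mathbf 1}=l_{\mathbf 1}^{-1}=r_{\mathbf 1}^{-1}$, $m_{\mathbf 1}=l_{\mathbf 1}=r_{\mathbf 1}$. A braided object is a pair $(V,c)$ with $c:V\otimes V\to V\otimes V$ invertible and $(c\otimes V)(V\otimes c)(c\otimes V)=(V\otimes c)(c\otimes V)(V\otimes c)$; a morphism $(V,c_V)\to(W,c_W)$ is $f:V\to W$ with $c_W(f\otimes f)=(f\otimes f)c_V$; category $\mathrm{Br}_{\mathcal M}$. A braided algebra is $(A,m,u,c)$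 with $(A,m,u)$ an algebra in $\mathcal M$, $(A,c)$ a braided object, and $c(m\otimes A)=(A\otimes m)(c\otimes A)(A\otimes c)$, $c(A\otimes m)=(m\otimes A)(A\otimes c)(c\otimes A)$, $c(u\otimes A)l_A^{-1}=(A\otimes u)r_A^{-1}$, $c(A\otimes u)r_A^{-1}=(u\otimes A)l_A^{-1}$; morphisms are algebra morphisms that are morphisms of braided objects; category $\mathrm{BrAlg}_{\mathcal M}$. A braided coalgebra is $(C,\Delta,\varepsilon,c)$ with $(C,\Delta,\varepsilon)$ a coalgebra, $(C,c)$ a braided object, and $(\Delta\otimes C)c=(C\otimes c)(c\otimes C)(C\otimes\Delta)$, $(C\otimes\Delta)c=(c\otimes C)(C\otimes c)(\Delta\otimes C)$, $l_C(\varepsilon\otimes C)c=r_C(C\otimes\varepsilon)$, $r_C(C\otimes\varepsilon)c=l_C(\varepsilon\otimes C)$; morphisms are coalgebra morphisms that are morphisms of braided objects. A braided bialgebra is $(B,m,u,\Delta,\varepsilon,c)$ with $(B,m,u,c)$ a braided algebra, $(B,\Delta,\varepsilon,c)$ a braided coalgebra, and $\Delta m=(m\otimes m)(B\otimes c\otimes B)(\Delta\otimes\Delta)$, $\Delta u=(u\otimes u)\Delta_{\mathbf 1}$, $\varepsilon m=m_{\mathbf 1}(\varepsilon\otimes\varepsilon)$, $\varepsilon u=\mathrm{Id}_{\mathbf 1}$; morphisms are morphisms of both braided algebras and braided coalgebras; category $\mathrm{BrBialg}_{\mathcal M}$. Tensor algebra: the forgetful functor $\Omega:\mathrm{Alg}_{\mathcal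 M}\to\mathcal M$ from algebras in $\mathcal M$ has a left adjoint $T$ with $\Omega TV=\oplus_{n\in\mathbb N}V^{\otimes n}$; $\Omega Tf\circ\alpha_nV=\alpha_nW\circ f^{\otimes n}$ for $f:V\to W$; $m_{\Omega TV}\circ(\alpha_mV\otimes\alpha_nV)=\alpha_{m+n}V$, $u_{\Omega TV}=\alpha_0V$; the unit is $\eta V=\alpha_1V$. Braided tensor algebra: $T_{\mathrm{Br}}(V,c)=(TV,c_T)$, where $c_T$ is determined by $c_T\circ(\alpha_mV\otimes\alpha_nV)=(\alpha_nV\otimes\alpha_mV)\circ c_T^{m,n}$, and $T_{\mathrm{Br}}(f)=T(f)$ on morphisms; it is left adjoint to $\Omega_{\mathrm{Br}}$, with unit whose underlying morphism is $\alpha_1V$. Here $c_T^{a,b}:V^{\otimes a}\otimes V^{\otimes b}\to V^{\otimes b}\otimes V^{\otimes a}$ is the unique family such that for all $l,m,n\in\mathbb N$ (identifying $V^{\otimes l}\otimes V^{\otimes m}$ with $V^{\otimes(l+m)}$ via the constraints): $(V^{\otimes n}\otimes c_T^{l,m})(c_T^{l,n}\otimes V^{\otimes m})(V^{\otimes l}\otimes c_T^{m,n})=(c_T^{m,n}\otimes V^{\otimes l})(V^{\otimes m}\otimes c_T^{l,n})(c_T^{l,m}\otimes V^{\otimes n})$; $(c_T^{l,n}\otimes V^{\otimes m})(V^{\otimes l}\otimes c_T^{m,n})=c_T^{l+m,n}$ for $l,m\ne0$; $(V^{\otimes m}\otimes c_T^{l,n})(c_T^{l,m}\otimes V^{\otimes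 n})=c_T^{l,m+n}$ for $m,n\ne0$; $c_T^{0,n}l_{V^{\otimes n}}^{-1}=r_{V^{\otimes n}}^{-1}$; $c_T^{n,0}r_{V^{\otimes n}}^{-1}=l_{V^{\otimes n}}^{-1}$; $c_T^{1,1}=c$. *)

theory Defs
  imports "HOL-Algebra.Group"
begin

(* Hom-sets of different pairs of objects need not be disjoint: this is why the arrow part of a
   functor, the zero morphism and the inverse of an arrow take the relevant objects as arguments,
   and it allows a morphism of structured objects to be represented by its underlying arrow. *)

record ('o, 'm) cat =
  Ob :: "'o set"
  Hom :: "'o \<Rightarrow> 'o \<Rightarrow> 'm set"
  Ide :: "'o \<Rightarrow> 'm" ("\<langle>_\<rangle>\<index>")
  Comp :: "'m \<Rightarrow> 'm \<Rightarrow> 'm" (infixr "\<cdot>\<index>" 55)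

locale category =
  fixes C :: "('o, 'm, 'z) cat_scheme" (structure)
  assumes Ide_in_Hom: "X \<in> Ob C \<Longrightarrow> \<langle>X\<rangle> \<in> Hom C X X"
    and Comp_in_Hom: "\<lbrakk>X \<in> Ob C; Y \<in> Ob C; Z \<in> Ob C; f \<in> Hom C X Y; g \<in> Hom C Y Z\<rbrakk>
      \<Longrightarrow> g \<cdot> f \<in> Hom C X Z"
    and Comp_assoc: "\<lbrakk>W \<in> Ob C; X \<in> Ob C; Y \<in> Ob C; Z \<in> Ob C;
      f \<in> Hom C W X; g \<in> Hom C X Y; h \<in> Hom C Y Z\<rbrakk> \<Longrightarrow> (h \<cdot> g) \<cdot> f = h \<cdot> (g \<cdot> f)"
    and Comp_Ide: "\<lbrakk>X \<in> Ob C; Y \<in> Ob C; f \<in> Hom C X Y\<rbrakk> \<Longrightarrow> f \<cdot> \<langle>X\<rangle> = f"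
    and Ide_Comp: "\<lbrakk>X \<in> Ob C; Y \<in> Ob C; f \<in> Hom C X Y\<rbrakk> \<Longrightarrow> \<langle>Y\<rangle> \<cdot> f = f"

definition is_inverse :: "('o, 'm, 'z) cat_scheme \<Rightarrow> 'o \<Rightarrow> 'o \<Rightarrow> 'm \<Rightarrow> 'm \<Rightarrow> bool" where
  "is_inverse C X Y f g \<longleftrightarrow> f \<in> Hom C X Y \<and> g \<in> Hom C Y X \<and> g \<cdot> f = \<langle>X\<rangle> \<and> f \<cdot> g = \<langle>Y\<rangle>"
  for C (structure)

definition invertible_arr :: "('o, 'm, 'z) cat_scheme \<Rightarrow> 'o \<Rightarrow> 'o \<Rightarrow> 'm \<Rightarrow> bool" where
  "invertible_arr C X Y f \<longleftrightarrow> (\<exists>g. is_inverse C X Y f g)"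

definition inverse_arr :: "('o, 'm, 'z) cat_scheme \<Rightarrow> 'o \<Rightarrow> 'o \<Rightarrow> 'm \<Rightarrow> 'm" where
  "inverse_arr C X Y f = (THE g. is_inverse C X Y f g)"


subsection \<open>Equalizers and denumerable coproducts\<close>

definition is_equalizer ::
  "('o, 'm, 'z) cat_scheme \<Rightarrow> 'o \<Rightarrow> 'o \<Rightarrow> 'm \<Rightarrow> 'm \<Rightarrow> 'o \<Rightarrow> 'm \<Rightarrow> bool" where
  "is_equalizer C X Y f g E k \<longleftrightarrow> E \<in> Ob C \<and> k \<in> Hom C E X \<and> f \<cdot> k = g \<cdot> k \<and>
     (\<forall>Z\<in>Ob C. \<forall>h\<in>Hom C Z X. f \<cdot> h = g \<cdot> h \<longrightarrow> (\<exists>!h'. h' \<in> Hom C Z E \<and> k \<cdot> h' = h))"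
  for C (structure)

definition has_equalizers :: "('o, 'm, 'z) cat_scheme \<Rightarrow> bool" where
  "has_equalizers C \<longleftrightarrow> (\<forall>X\<in>Ob C. \<forall>Y\<in>Ob C. \<forall>f\<in>Hom C X Y. \<forall>g\<in>Hom C X Y.
     \<exists>E k. is_equalizer C X Y f g E k)"

(* denumerable families are indexed by nat *)
definition is_coproduct ::
  "('o, 'm, 'z) cat_scheme \<Rightarrow> (nat \<Rightarrow> 'o) \<Rightarrow> 'o \<Rightarrow> (nat \<Rightarrow> 'm) \<Rightarrow> bool" where
  "is_coproduct C X S i \<longleftrightarrow> S \<in> Ob C \<and> (\<forall>n. i n \<in> Hom C (X n) S) \<and>
     (\<forall>Z\<in>Ob C. \<forall>g. (\<forall>n. g n \<in> Hom C (X n) Z) \<longrightarrow>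
        (\<exists>!h. h \<in> Hom C S Z \<and> (\<forall>n. h \<cdot> i n = g n)))"
  for C (structure)

definition has_denumerable_coproducts :: "('o, 'm, 'z) cat_scheme \<Rightarrow> bool" where
  "has_denumerable_coproducts C \<longleftrightarrow>
     (\<forall>X. (\<forall>n. X n \<in> Ob C) \<longrightarrow> (\<exists>S i. is_coproduct C X S i))"


subsection \<open>Functors and adjunctions\<close>

record ('o, 'm, 'p, 'n) functr =
  FOb :: "'o \<Rightarrow> 'p"
  FArr :: "'o \<Rightarrow> 'o \<Rightarrow> 'm \<Rightarrow> 'n"

definition is_functor ::
  "('o, 'm, 'y) cat_scheme \<Rightarrow> ('p, 'n, 'z) cat_scheme \<Rightarrow> ('o, 'm, 'p, 'n) functr \<Rightarrow> bool" where
  "is_functor C D F \<longleftrightarrow>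
     (\<forall>X\<in>Ob C. FOb F X \<in> Ob D) \<and>
     (\<forall>X\<in>Ob C. \<forall>Y\<in>Ob C. \<forall>f\<in>Hom C X Y. FArr F X Y f \<in> Hom D (FOb F X) (FOb F Y)) \<and>
     (\<forall>X\<in>Ob C. FArr F X X \<langle>X\<rangle>\<^bsub>C\<^esub> = \<langle>FOb F X\<rangle>\<^bsub>D\<^esub>) \<and>
     (\<forall>X\<in>Ob C. \<forall>Y\<in>Ob C. \<forall>Z\<in>Ob C. \<forall>f\<in>Hom C X Y. \<forall>g\<in>Hom C Y Z.
        FArr F X Z (g \<cdot>\<^bsub>C\<^esub> f) = FArr F Y Z g \<cdot>\<^bsub>D\<^esub> FArr F X Y f)"

definition functor_comp ::
  "('p, 'n, 'q, 'k) functr \<Rightarrow> ('o, 'm, 'p, 'n) functr \<Rightarrow> ('o, 'm, 'q, 'k) functr" where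
  "functor_comp G F =
     \<lparr>FOb = \<lambda>X. FOb G (FOb F X), FArr = \<lambda>X Y f. FArr G (FOb F X) (FOb F Y) (FArr F X Y f)\<rparr>"

(* equality of functors with source C; values outside C are irrelevant *)
definition functor_eq ::
  "('o, 'm, 'z) cat_scheme \<Rightarrow> ('o, 'm, 'p, 'n) functr \<Rightarrow> ('o, 'm, 'p, 'n) functr \<Rightarrow> bool" where
  "functor_eq C F G \<longleftrightarrow> (\<forall>X\<in>Ob C. FOb F X = FOb G X) \<and>
     (\<forall>X\<in>Ob C. \<forall>Y\<in>Ob C. \<forall>f\<in>Hom C X Y. FArr F X Y f = FArr G X Y f)"

definition preserves_equalizers ::
  "('o, 'm, 'y) cat_scheme \<Rightarrow> ('p, 'n, 'z) cat_scheme \<Rightarrow> ('o, 'm, 'p, 'n) functr \<Rightarrow> bool" where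
  "preserves_equalizers C D F \<longleftrightarrow>
     (\<forall>X\<in>Ob C. \<forall>Y\<in>Ob C. \<forall>f\<in>Hom C X Y. \<forall>g\<in>Hom C X Y. \<forall>E k. is_equalizer C X Y f g E k \<longrightarrow>
        is_equalizer D (FOb F X) (FOb F Y) (FArr F X Y f) (FArr F X Y g) (FOb F E) (FArr F E X k))"

definition preserves_denumerable_coproducts ::
  "('o, 'm, 'y) cat_scheme \<Rightarrow> ('p, 'n, 'z) cat_scheme \<Rightarrow> ('o, 'm, 'p, 'n) functr \<Rightarrow> bool" where
  "preserves_denumerable_coproducts C D F \<longleftrightarrow>
     (\<forall>X S i. (\<forall>n. X n \<in> Ob C) \<and> is_coproduct C X S i \<longrightarrow>
        is_coproduct D (\<lambda>n. FOb F (X n)) (FOb F S) (\<lambda>n. FArr F (X n) S (i n)))"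

(* F is left adjoint to G with unit eta *)
definition adjunction ::
  "('o, 'm, 'y) cat_scheme \<Rightarrow> ('p, 'n, 'z) cat_scheme \<Rightarrow>
   ('o, 'm, 'p, 'n) functr \<Rightarrow> ('p, 'n, 'o, 'm) functr \<Rightarrow> ('o \<Rightarrow> 'm) \<Rightarrow> bool" where
  "adjunction C D F G \<eta> \<longleftrightarrow>
     is_functor C D F \<and> is_functor D C G \<and>
     (\<forall>X\<in>Ob C. \<eta> X \<in> Hom C X (FOb G (FOb F X))) \<and>
     (\<forall>X\<in>Ob C. \<forall>Y\<in>Ob C. \<forall>f\<in>Hom C X Y.
        FArr G (FOb F X) (FOb F Y) (FArr F X Y f) \<cdot>\<^bsub>C\<^esub> \<eta> X = \<eta> Y \<cdot>\<^bsub>C\<^esub> f) \<and>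
     (\<forall>X\<in>Ob C. \<forall>Y\<in>Ob D. \<forall>f\<in>Hom C X (FOb G Y).
        \<exists>!g. g \<in> Hom D (FOb F X) Y \<and> FArr G (FOb F X) Y g \<cdot>\<^bsub>C\<^esub> \<eta> X = f)"


subsection \<open>Preadditive monoidal categories\<close>

record ('o, 'm) moncat = "('o, 'm) cat" +
  TOb :: "'o \<Rightarrow> 'o \<Rightarrow> 'o" (infixl "\<odot>\<index>" 70)
  TArr :: "'m \<Rightarrow> 'm \<Rightarrow> 'm" (infixl "\<boxtimes>\<index>" 70)
  UnitOb :: 'o ("\<I>\<index>")
  Assoc :: "'o \<Rightarrow> 'o \<Rightarrow> 'o \<Rightarrow> 'm" ("\<a>\<index>")
  LUnit :: "'o \<Rightarrow> 'm" ("\<l>\<index>")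
  RUnit :: "'o \<Rightarrow> 'm" ("\<r>\<index>")

definition Assoc_inv :: "('o, 'm, 'z) moncat_scheme \<Rightarrow> 'o \<Rightarrow> 'o \<Rightarrow> 'o \<Rightarrow> 'm" ("\<a>\<inverse>\<index>") where
  "\<a>\<inverse>\<^bsub>M\<^esub> X Y Z = inverse_arr M ((X \<odot> Y) \<odot> Z) (X \<odot> (Y \<odot> Z)) (\<a> X Y Z)" for M (structure)

definition LUnit_inv :: "('o, 'm, 'z) moncat_scheme \<Rightarrow> 'o \<Rightarrow> 'm" ("\<l>\<inverse>\<index>") where
  "\<l>\<inverse>\<^bsub>M\<^esub> X = inverse_arr M (\<I> \<odot> X) X (\<l> X)" for M (structure)

definition RUnit_inv :: "('o, 'm, 'z) moncat_scheme \<Rightarrow> 'o \<Rightarrow> 'm" ("\<r>\<inverse>\<index>") where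
  "\<r>\<inverse>\<^bsub>M\<^esub> X = inverse_arr M (X \<odot> \<I>) X (\<r> X)" for M (structure)

locale monoidal_category = category M
  for M :: "('o, 'm, 'z) moncat_scheme" (structure) +
  assumes Unit_in_Ob: "\<I> \<in> Ob M"
    and TOb_in_Ob: "\<lbrakk>X \<in> Ob M; Y \<in> Ob M\<rbrakk> \<Longrightarrow> X \<odot> Y \<in> Ob M"
    and TArr_in_Hom: "\<lbrakk>X \<in> Ob M; X' \<in> Ob M; Y \<in> Ob M; Y' \<in> Ob M; f \<in> Hom M X X'; g \<in> Hom M Y Y'\<rbrakk>
      \<Longrightarrow> f \<boxtimes> g \<in> Hom M (X \<odot> Y) (X' \<odot> Y')"
    and TArr_Ide: "\<lbrakk>X \<in> Ob M; Y \<in> Ob M\<rbrakk> \<Longrightarrow> \<langle>X\<rangle> \<boxtimes> \<langle>Y\<rangle> = \<langle>X \<odot> Y\<rangle>"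
    and TArr_Comp: "\<lbrakk>X \<in> Ob M; X' \<in> Ob M; X'' \<in> Ob M; Y \<in> Ob M; Y' \<in> Ob M; Y'' \<in> Ob M;
      f \<in> Hom M X X'; f' \<in> Hom M X' X''; g \<in> Hom M Y Y'; g' \<in> Hom M Y' Y''\<rbrakk>
      \<Longrightarrow> (f' \<cdot> f) \<boxtimes> (g' \<cdot> g) = (f' \<boxtimes> g') \<cdot> (f \<boxtimes> g)"
    and Assoc_invertible: "\<lbrakk>X \<in> Ob M; Y \<in> Ob M; Z \<in> Ob M\<rbrakk>
      \<Longrightarrow> invertible_arr M ((X \<odot> Y) \<odot> Z) (X \<odot> (Y \<odot> Z)) (\<a> X Y Z)"
    and LUnit_invertible: "X \<in> Ob M \<Longrightarrow> invertible_arr M (\<I> \<odot> X) X (\<l> X)"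
    and RUnit_invertible: "X \<in> Ob M \<Longrightarrow> invertible_arr M (X \<odot> \<I>) X (\<r> X)"
    and Assoc_natural: "\<lbrakk>X \<in> Ob M; X' \<in> Ob M; Y \<in> Ob M; Y' \<in> Ob M; Z \<in> Ob M; Z' \<in> Ob M;
      f \<in> Hom M X X'; g \<in> Hom M Y Y'; h \<in> Hom M Z Z'\<rbrakk>
      \<Longrightarrow> \<a> X' Y' Z' \<cdot> ((f \<boxtimes> g) \<boxtimes> h) = (f \<boxtimes> (g \<boxtimes> h)) \<cdot> \<a> X Y Z"
    and LUnit_natural: "\<lbrakk>X \<in> Ob M; X' \<in> Ob M; f \<in> Hom M X X'\<rbrakk> \<Longrightarrow> \<l> X' \<cdot> (\<langle>\<I>\<rangle> \<boxtimes> f) = f \<cdot> \<l> X"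
    and RUnit_natural: "\<lbrakk>X \<in> Ob M; X' \<in> Ob M; f \<in> Hom M X X'\<rbrakk> \<Longrightarrow> \<r> X' \<cdot> (f \<boxtimes> \<langle>\<I>\<rangle>) = f \<cdot> \<r> X"
    and pentagon: "\<lbrakk>W \<in> Ob M; X \<in> Ob M; Y \<in> Ob M; Z \<in> Ob M\<rbrakk>
      \<Longrightarrow> (\<langle>W\<rangle> \<boxtimes> \<a> X Y Z) \<cdot> \<a> W (X \<odot> Y) Z \<cdot> (\<a> W X Y \<boxtimes> \<langle>Z\<rangle>) = \<a> W X (Y \<odot> Z) \<cdot> \<a> (W \<odot> X) Y Z"
    and triangle: "\<lbrakk>X \<in> Ob M; Y \<in> Ob M\<rbrakk> \<Longrightarrow> (\<langle>X\<rangle> \<boxtimes> \<l> Y) \<cdot> \<a> X \<I> Y = \<r> X \<boxtimes> \<langle>Y\<rangle>"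

record ('o, 'm) premoncat = "('o, 'm) moncat" +
  Add :: "'m \<Rightarrow> 'm \<Rightarrow> 'm" (infixl "\<^bold>+\<index>" 54)
  Zero :: "'o \<Rightarrow> 'o \<Rightarrow> 'm" ("\<^bold>0\<index>")

locale preadditive_monoidal_category = monoidal_category M
  for M :: "('o, 'm, 'z) premoncat_scheme" (structure) +
  assumes Hom_comm_group: "\<lbrakk>X \<in> Ob M; Y \<in> Ob M\<rbrakk>
      \<Longrightarrow> comm_group \<lparr>carrier = Hom M X Y, monoid.mult = (\<^bold>+), one = \<^bold>0 X Y\<rparr>"
    and Comp_Add: "\<lbrakk>X \<in> Ob M; Y \<in> Ob M; Z \<in> Ob M; f \<in> Hom M X Y; f' \<in> Hom M X Y; g \<in> Hom M Y Z\<rbrakk>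
      \<Longrightarrow> g \<cdot> (f \<^bold>+ f') = (g \<cdot> f) \<^bold>+ (g \<cdot> f')"
    and Add_Comp: "\<lbrakk>X \<in> Ob M; Y \<in> Ob M; Z \<in> Ob M; f \<in> Hom M X Y; g \<in> Hom M Y Z; g' \<in> Hom M Y Z\<rbrakk>
      \<Longrightarrow> (g \<^bold>+ g') \<cdot> f = (g \<cdot> f) \<^bold>+ (g' \<cdot> f)"

definition additive_functor ::
  "('o, 'm, 'y) premoncat_scheme \<Rightarrow> ('p, 'n, 'z) premoncat_scheme \<Rightarrow> ('o, 'm, 'p, 'n) functr \<Rightarrow> bool" where
  "additive_functor C D F \<longleftrightarrow> is_functor C D F \<and>
     (\<forall>X\<in>Ob C. \<forall>Y\<in>Ob C. \<forall>f\<in>Hom C X Y. \<forall>g\<in>Hom C X Y.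
        FArr F X Y (f \<^bold>+\<^bsub>C\<^esub> g) = FArr F X Y f \<^bold>+\<^bsub>D\<^esub> FArr F X Y g)"

definition left_tensor_functor :: "('o, 'm, 'z) moncat_scheme \<Rightarrow> 'o \<Rightarrow> ('o, 'm, 'o, 'm) functr" where
  "left_tensor_functor M X = \<lparr>FOb = \<lambda>Y. X \<odot> Y, FArr = \<lambda>Y Z f. \<langle>X\<rangle> \<boxtimes> f\<rparr>" for M (structure)

definition right_tensor_functor :: "('o, 'm, 'z) moncat_scheme \<Rightarrow> 'o \<Rightarrow> ('o, 'm, 'o, 'm) functr" where
  "right_tensor_functor M X = \<lparr>FOb = \<lambda>Y. Y \<odot> X, FArr = \<lambda>Y Z f. f \<boxtimes> \<langle>X\<rangle>\<rparr>" for M (structure)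


subsection \<open>Braided objects, algebras, coalgebras and bialgebras\<close>

definition Unit_mult :: "('o, 'm, 'z) moncat_scheme \<Rightarrow> 'm" where
  "Unit_mult M = \<l> \<I>" for M (structure)

definition Unit_comult :: "('o, 'm, 'z) moncat_scheme \<Rightarrow> 'm" where
  "Unit_comult M = \<l>\<inverse> \<I>" for M (structure)

definition braided_object :: "('o, 'm, 'z) moncat_scheme \<Rightarrow> 'o \<Rightarrow> 'm \<Rightarrow> bool" where
  "braided_object M V c \<longleftrightarrow>
     V \<in> Ob M \<and> invertible_arr M (V \<odot> V) (V \<odot> V) c \<and>
     (c \<boxtimes> \<langle>V\<rangle>) \<cdot> \<a>\<inverse> V V V \<cdot> (\<langle>V\<rangle> \<boxtimes> c) \<cdot> \<a> V V V \<cdot> (c \<boxtimes> \<langle>V\<rangle>) =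
     \<a>\<inverse> V V V \<cdot> (\<langle>V\<rangle> \<boxtimes> c) \<cdot> \<a> V V V \<cdot> (c \<boxtimes> \<langle>V\<rangle>) \<cdot> \<a>\<inverse> V V V \<cdot> (\<langle>V\<rangle> \<boxtimes> c) \<cdot> \<a> V V V"
  for M (structure)

definition braided_mor ::
  "('o, 'm, 'z) moncat_scheme \<Rightarrow> 'o \<Rightarrow> 'm \<Rightarrow> 'o \<Rightarrow> 'm \<Rightarrow> 'm \<Rightarrow> bool" where
  "braided_mor M V c W d f \<longleftrightarrow> f \<in> Hom M V W \<and> d \<cdot> (f \<boxtimes> f) = (f \<boxtimes> f) \<cdot> c" for M (structure)

definition algebra :: "('o, 'm, 'z) moncat_scheme \<Rightarrow> 'o \<Rightarrow> 'm \<Rightarrow> 'm \<Rightarrow> bool" where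
  "algebra M A m u \<longleftrightarrow>
     A \<in> Ob M \<and> m \<in> Hom M (A \<odot> A) A \<and> u \<in> Hom M \<I> A \<and>
     m \<cdot> (m \<boxtimes> \<langle>A\<rangle>) = m \<cdot> (\<langle>A\<rangle> \<boxtimes> m) \<cdot> \<a> A A A \<and>
     m \<cdot> (u \<boxtimes> \<langle>A\<rangle>) = \<l> A \<and>
     m \<cdot> (\<langle>A\<rangle> \<boxtimes> u) = \<r> A"
  for M (structure)

definition algebra_mor ::
  "('o, 'm, 'z) moncat_scheme \<Rightarrow> 'o \<Rightarrow> 'm \<Rightarrow> 'm \<Rightarrow> 'o \<Rightarrow> 'm \<Rightarrow> 'm \<Rightarrow> 'm \<Rightarrow> bool" where
  "algebra_mor M A m u A' m' u' f \<longleftrightarrow>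
     f \<in> Hom M A A' \<and> f \<cdot> m = m' \<cdot> (f \<boxtimes> f) \<and> f \<cdot> u = u'"
  for M (structure)

definition coalgebra :: "('o, 'm, 'z) moncat_scheme \<Rightarrow> 'o \<Rightarrow> 'm \<Rightarrow> 'm \<Rightarrow> bool" where
  "coalgebra M C \<Delta> \<epsilon> \<longleftrightarrow>
     C \<in> Ob M \<and> \<Delta> \<in> Hom M C (C \<odot> C) \<and> \<epsilon> \<in> Hom M C \<I> \<and>
     \<a> C C C \<cdot> (\<Delta> \<boxtimes> \<langle>C\<rangle>) \<cdot> \<Delta> = (\<langle>C\<rangle> \<boxtimes> \<Delta>) \<cdot> \<Delta> \<and>
     \<l> C \<cdot> (\<epsilon> \<boxtimes> \<langle>C\<rangle>) \<cdot> \<Delta> = \<langle>C\<rangle> \<and>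
     \<r> C \<cdot> (\<langle>C\<rangle> \<boxtimes> \<epsilon>) \<cdot> \<Delta> = \<langle>C\<rangle>"
  for M (structure)

definition coalgebra_mor ::
  "('o, 'm, 'z) moncat_scheme \<Rightarrow> 'o \<Rightarrow> 'm \<Rightarrow> 'm \<Rightarrow> 'o \<Rightarrow> 'm \<Rightarrow> 'm \<Rightarrow> 'm \<Rightarrow> bool" where
  "coalgebra_mor M C \<Delta> \<epsilon> C' \<Delta>' \<epsilon>' f \<longleftrightarrow>
     f \<in> Hom M C C' \<and> \<Delta>' \<cdot> f = (f \<boxtimes> f) \<cdot> \<Delta> \<and> \<epsilon>' \<cdot> f = \<epsilon>"
  for M (structure)

definition braided_algebra :: "('o, 'm, 'z) moncat_scheme \<Rightarrow> 'o \<Rightarrow> 'm \<Rightarrow> 'm \<Rightarrow> 'm \<Rightarrow> bool" where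
  "braided_algebra M A m u c \<longleftrightarrow>
     algebra M A m u \<and> braided_object M A c \<and>
     c \<cdot> (m \<boxtimes> \<langle>A\<rangle>) =
       (\<langle>A\<rangle> \<boxtimes> m) \<cdot> \<a> A A A \<cdot> (c \<boxtimes> \<langle>A\<rangle>) \<cdot> \<a>\<inverse> A A A \<cdot> (\<langle>A\<rangle> \<boxtimes> c) \<cdot> \<a> A A A \<and>
     c \<cdot> (\<langle>A\<rangle> \<boxtimes> m) =
       (m \<boxtimes> \<langle>A\<rangle>) \<cdot> \<a>\<inverse> A A A \<cdot> (\<langle>A\<rangle> \<boxtimes> c) \<cdot> \<a> A A A \<cdot> (c \<boxtimes> \<langle>A\<rangle>) \<cdot> \<a>\<inverse> A A A \<and>
     c \<cdot> (u \<boxtimes> \<langle>A\<rangle>) \<cdot> \<l>\<inverse> A = (\<langle>A\<rangle> \<boxtimes> u) \<cdot> \<r>\<inverse> A \<and>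
     c \<cdot> (\<langle>A\<rangle> \<boxtimes> u) \<cdot> \<r>\<inverse> A = (u \<boxtimes> \<langle>A\<rangle>) \<cdot> \<l>\<inverse> A"
  for M (structure)

definition braided_coalgebra :: "('o, 'm, 'z) moncat_scheme \<Rightarrow> 'o \<Rightarrow> 'm \<Rightarrow> 'm \<Rightarrow> 'm \<Rightarrow> bool" where
  "braided_coalgebra M C \<Delta> \<epsilon> c \<longleftrightarrow>
     coalgebra M C \<Delta> \<epsilon> \<and> braided_object M C c \<and>
     (\<Delta> \<boxtimes> \<langle>C\<rangle>) \<cdot> c =
       \<a>\<inverse> C C C \<cdot> (\<langle>C\<rangle> \<boxtimes> c) \<cdot> \<a> C C C \<cdot> (c \<boxtimes> \<langle>C\<rangle>) \<cdot> \<a>\<inverse> C C C \<cdot> (\<langle>C\<rangle> \<boxtimes> \<Delta>) \<and>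
     (\<langle>C\<rangle> \<boxtimes> \<Delta>) \<cdot> c =
       \<a> C C C \<cdot> (c \<boxtimes> \<langle>C\<rangle>) \<cdot> \<a>\<inverse> C C C \<cdot> (\<langle>C\<rangle> \<boxtimes> c) \<cdot> \<a> C C C \<cdot> (\<Delta> \<boxtimes> \<langle>C\<rangle>) \<and>
     \<l> C \<cdot> (\<epsilon> \<boxtimes> \<langle>C\<rangle>) \<cdot> c = \<r> C \<cdot> (\<langle>C\<rangle> \<boxtimes> \<epsilon>) \<and>
     \<r> C \<cdot> (\<langle>C\<rangle> \<boxtimes> \<epsilon>) \<cdot> c = \<l> C \<cdot> (\<epsilon> \<boxtimes> \<langle>C\<rangle>)"
  for M (structure)

(* the endomorphism usually written B c B, here on (B B) (B B) with its associativity constraints *)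
definition mid_braiding :: "('o, 'm, 'z) moncat_scheme \<Rightarrow> 'o \<Rightarrow> 'm \<Rightarrow> 'm" where
  "mid_braiding M B c =
     \<a>\<inverse> B B (B \<odot> B) \<cdot> (\<langle>B\<rangle> \<boxtimes> \<a> B B B) \<cdot> (\<langle>B\<rangle> \<boxtimes> (c \<boxtimes> \<langle>B\<rangle>)) \<cdot> (\<langle>B\<rangle> \<boxtimes> \<a>\<inverse> B B B) \<cdot> \<a> B B (B \<odot> B)"
  for M (structure)

definition braided_bialgebra ::
  "('o, 'm, 'z) moncat_scheme \<Rightarrow> 'o \<Rightarrow> 'm \<Rightarrow> 'm \<Rightarrow> 'm \<Rightarrow> 'm \<Rightarrow> 'm \<Rightarrow> bool" where
  "braided_bialgebra M B m u \<Delta> \<epsilon> c \<longleftrightarrow>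
     braided_algebra M B m u c \<and> braided_coalgebra M B \<Delta> \<epsilon> c \<and>
     \<Delta> \<cdot> m = (m \<boxtimes> m) \<cdot> mid_braiding M B c \<cdot> (\<Delta> \<boxtimes> \<Delta>) \<and>
     \<Delta> \<cdot> u = (u \<boxtimes> u) \<cdot> Unit_comult M \<and>
     \<epsilon> \<cdot> m = Unit_mult M \<cdot> (\<epsilon> \<boxtimes> \<epsilon>) \<and>
     \<epsilon> \<cdot> u = \<langle>\<I>\<rangle>"
  for M (structure)


subsection \<open>The categories of algebras and of braided objects, and forgetful functors\<close>

definition Alg :: "('o, 'm, 'z) moncat_scheme \<Rightarrow> ('o \<times> 'm \<times> 'm, 'm) cat" where
  "Alg M = \<lparr>
     Ob = {(A, m, u). algebra M A m u},
     Hom = \<lambda>(A, m, u) (A', m', u'). {f. algebra_mor M A m u A' m' u' f},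
     Ide = \<lambda>(A, m, u). \<langle>A\<rangle>,
     Comp = (\<cdot>)\<rparr>"
  for M (structure)

definition Br :: "('o, 'm, 'z) moncat_scheme \<Rightarrow> ('o \<times> 'm, 'm) cat" where
  "Br M = \<lparr>
     Ob = {(V, c). braided_object M V c},
     Hom = \<lambda>(V, c) (W, d). {f. braided_mor M V c W d f},
     Ide = \<lambda>(V, c). \<langle>V\<rangle>,
     Comp = (\<cdot>)\<rparr>"
  for M (structure)

definition BrAlg :: "('o, 'm, 'z) moncat_scheme \<Rightarrow> ('o \<times> 'm \<times> 'm \<times> 'm, 'm) cat" where
  "BrAlg M = \<lparr>
     Ob = {(A, m, u, c). braided_algebra M A m u c},
     Hom = \<lambda>(A, m, u, c) (A', m', u', c').
       {f. algebra_mor M A m u A' m' u' f \<and> braided_mor M A c A' c' f},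
     Ide = \<lambda>(A, m, u, c). \<langle>A\<rangle>,
     Comp = (\<cdot>)\<rparr>"
  for M (structure)

definition BrBialg :: "('o, 'm, 'z) moncat_scheme \<Rightarrow> ('o \<times> 'm \<times> 'm \<times> 'm \<times> 'm \<times> 'm, 'm) cat" where
  "BrBialg M = \<lparr>
     Ob = {(B, m, u, \<Delta>, \<epsilon>, c). braided_bialgebra M B m u \<Delta> \<epsilon> c},
     Hom = \<lambda>(B, m, u, \<Delta>, \<epsilon>, c) (B', m', u', \<Delta>', \<epsilon>', c').
       {f. algebra_mor M B m u B' m' u' f \<and> coalgebra_mor M B \<Delta> \<epsilon> B' \<Delta>' \<epsilon>' f \<and>
           braided_mor M B c B' c' f},
     Ide = \<lambda>(B, m, u, \<Delta>, \<epsilon>, c). \<langle>B\<rangle>,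
     Comp = (\<cdot>)\<rparr>"
  for M (structure)

definition Omega :: "('o \<times> 'm \<times> 'm, 'm, 'o, 'm) functr" where
  "Omega = \<lparr>FOb = \<lambda>(A, m, u). A, FArr = \<lambda>X Y f. f\<rparr>"

definition Omega_Br :: "('o \<times> 'm \<times> 'm \<times> 'm, 'm, 'o \<times> 'm, 'm) functr" where
  "Omega_Br = \<lparr>FOb = \<lambda>(A, m, u, c). (A, c), FArr = \<lambda>X Y f. f\<rparr>"

definition Mho_Br :: "('o \<times> 'm \<times> 'm \<times> 'm \<times> 'm \<times> 'm, 'm, 'o \<times> 'm \<times> 'm \<times> 'm, 'm) functr" where
  "Mho_Br = \<lparr>FOb = \<lambda>(B, m, u, \<Delta>, \<epsilon>, c). (B, m, u, c), FArr = \<lambda>X Y f. f\<rparr>"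


subsection \<open>The (braided) tensor algebra\<close>

fun tpow :: "('o, 'm, 'z) moncat_scheme \<Rightarrow> 'o \<Rightarrow> nat \<Rightarrow> 'o" where
  "tpow M V 0 = \<I>\<^bsub>M\<^esub>"
| "tpow M V (Suc 0) = V"
| "tpow M V (Suc (Suc n)) = tpow M V (Suc n) \<odot>\<^bsub>M\<^esub> V"

fun tpow_arr :: "('o, 'm, 'z) moncat_scheme \<Rightarrow> 'm \<Rightarrow> nat \<Rightarrow> 'm" where
  "tpow_arr M f 0 = \<langle>\<I>\<^bsub>M\<^esub>\<rangle>\<^bsub>M\<^esub>"
| "tpow_arr M f (Suc 0) = f"
| "tpow_arr M f (Suc (Suc n)) = tpow_arr M f (Suc n) \<boxtimes>\<^bsub>M\<^esub> f"

(* the canonical isomorphism from (tpow V m) (tpow V n) to tpow V (m + n) *)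
fun tpow_add :: "('o, 'm, 'z) moncat_scheme \<Rightarrow> 'o \<Rightarrow> nat \<Rightarrow> nat \<Rightarrow> 'm" where
  "tpow_add M V 0 n = \<l>\<^bsub>M\<^esub> (tpow M V n)"
| "tpow_add M V (Suc m) 0 = \<r>\<^bsub>M\<^esub> (tpow M V (Suc m))"
| "tpow_add M V (Suc m) (Suc 0) = \<langle>tpow M V (Suc (Suc m))\<rangle>\<^bsub>M\<^esub>"
| "tpow_add M V (Suc m) (Suc (Suc n)) =
     (tpow_add M V (Suc m) (Suc n) \<boxtimes>\<^bsub>M\<^esub> \<langle>V\<rangle>\<^bsub>M\<^esub>) \<cdot>\<^bsub>M\<^esub> \<a>\<inverse>\<^bsub>M\<^esub> (tpow M V (Suc m)) (tpow M V (Suc n)) V"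

(* Coproducts are unique only up to isomorphism, so T and its canonical injections alpha are
   parameters, ranging over all possible choices. *)
definition tensor_algebra_functor ::
  "('o, 'm, 'z) moncat_scheme \<Rightarrow> ('o, 'm, 'o \<times> 'm \<times> 'm, 'm) functr \<Rightarrow> (nat \<Rightarrow> 'o \<Rightarrow> 'm) \<Rightarrow> bool" where
  "tensor_algebra_functor M T \<alpha> \<longleftrightarrow>
     adjunction M (Alg M) T Omega (\<alpha> 1) \<and>
     (\<forall>V\<in>Ob M. is_coproduct M (tpow M V) (FOb Omega (FOb T V)) (\<lambda>n. \<alpha> n V)) \<and>
     (\<forall>V\<in>Ob M. \<forall>W\<in>Ob M. \<forall>f\<in>Hom M V W. \<forall>n.
        FArr (functor_comp Omega T) V W f \<cdot> \<alpha> n V = \<alpha> n W \<cdot> tpow_arr M f n) \<and>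
     (\<forall>V\<in>Ob M. case FOb T V of (A, mA, uA) \<Rightarrow>
        (\<forall>m n. mA \<cdot> (\<alpha> m V \<boxtimes> \<alpha> n V) = \<alpha> (m + n) V \<cdot> tpow_add M V m n) \<and>
        uA = \<alpha> 0 V)"
  for M (structure)

(* The conditions determine cT m n by recursion on m and n, starting from cT 1 1 = c; hence the
   existentially quantified cT in braided_tensor_algebra_functor is the unique such family. *)
definition braiding_family ::
  "('o, 'm, 'z) moncat_scheme \<Rightarrow> 'o \<Rightarrow> 'm \<Rightarrow> (nat \<Rightarrow> nat \<Rightarrow> 'm) \<Rightarrow> bool" where
  "braiding_family M V c cT \<longleftrightarrow> (let P = tpow M V in
     (\<forall>m n. cT m n \<in> Hom M (P m \<odot> P n) (P n \<odot> P m)) \<and>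
     (\<forall>l m n.
        \<a> (P n) (P m) (P l) \<cdot> (cT m n \<boxtimes> \<langle>P l\<rangle>) \<cdot> \<a>\<inverse> (P m) (P n) (P l) \<cdot> (\<langle>P m\<rangle> \<boxtimes> cT l n) \<cdot>
          \<a> (P m) (P l) (P n) \<cdot> (cT l m \<boxtimes> \<langle>P n\<rangle>) =
        (\<langle>P n\<rangle> \<boxtimes> cT l m) \<cdot> \<a> (P n) (P l) (P m) \<cdot> (cT l n \<boxtimes> \<langle>P m\<rangle>) \<cdot> \<a>\<inverse> (P l) (P n) (P m) \<cdot>
          (\<langle>P l\<rangle> \<boxtimes> cT m n) \<cdot> \<a> (P l) (P m) (P n)) \<and>
     (\<forall>l m n. l \<noteq> 0 \<and> m \<noteq> 0 \<longrightarrow>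
        (\<langle>P n\<rangle> \<boxtimes> tpow_add M V l m) \<cdot> \<a> (P n) (P l) (P m) \<cdot> (cT l n \<boxtimes> \<langle>P m\<rangle>) \<cdot>
          \<a>\<inverse> (P l) (P n) (P m) \<cdot> (\<langle>P l\<rangle> \<boxtimes> cT m n) \<cdot> \<a> (P l) (P m) (P n) =
        cT (l + m) n \<cdot> (tpow_add M V l m \<boxtimes> \<langle>P n\<rangle>)) \<and>
     (\<forall>l m n. m \<noteq> 0 \<and> n \<noteq> 0 \<longrightarrow>
        (tpow_add M V m n \<boxtimes> \<langle>P l\<rangle>) \<cdot> \<a>\<inverse> (P m) (P n) (P l) \<cdot> (\<langle>P m\<rangle> \<boxtimes> cT l n) \<cdot>
          \<a> (P m) (P l) (P n) \<cdot> (cT l m \<boxtimes> \<langle>P n\<rangle>) \<cdot> \<a>\<inverse> (P l) (P m) (P n) =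
        cT l (m + n) \<cdot> (\<langle>P l\<rangle> \<boxtimes> tpow_add M V m n)) \<and>
     (\<forall>n. cT 0 n \<cdot> \<l>\<inverse> (P n) = \<r>\<inverse> (P n)) \<and>
     (\<forall>n. cT n 0 \<cdot> \<r>\<inverse> (P n) = \<l>\<inverse> (P n)) \<and>
     cT 1 1 = c)"
  for M (structure)

definition braided_tensor_algebra_functor ::
  "('o, 'm, 'z) moncat_scheme \<Rightarrow> ('o, 'm, 'o \<times> 'm \<times> 'm, 'm) functr \<Rightarrow> (nat \<Rightarrow> 'o \<Rightarrow> 'm) \<Rightarrow>
   ('o \<times> 'm, 'm, 'o \<times> 'm \<times> 'm \<times> 'm, 'm) functr \<Rightarrow> bool" where
  "braided_tensor_algebra_functor M T \<alpha> T\<^sub>B\<^sub>r \<longleftrightarrow>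
     adjunction (Br M) (BrAlg M) T\<^sub>B\<^sub>r Omega_Br (\<lambda>(V, c). \<alpha> 1 V) \<and>
     (\<forall>(V, c)\<in>Ob (Br M). \<exists>A mA uA cA cT.
        FOb T V = (A, mA, uA) \<and> FOb T\<^sub>B\<^sub>r (V, c) = (A, mA, uA, cA) \<and> braiding_family M V c cT \<and>
        (\<forall>m n. cA \<cdot> (\<alpha> m V \<boxtimes> \<alpha> n V) = (\<alpha> n V \<boxtimes> \<alpha> m V) \<cdot> cT m n)) \<and>
     (\<forall>(V, c)\<in>Ob (Br M). \<forall>(W, d)\<in>Ob (Br M). \<forall>f\<in>Hom (Br M) (V, c) (W, d).
        FArr T\<^sub>B\<^sub>r (V, c) (W, d) f = FArr T V W f)"
  for M (structure)


subsection \<open>The bialgebra structure\<close>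

definition unit_algebra :: "('o, 'm, 'z) moncat_scheme \<Rightarrow> 'o \<times> 'm \<times> 'm" where
  "unit_algebra M = (\<I>, Unit_mult M, \<langle>\<I>\<rangle>)" for M (structure)

definition tensor_square_algebra ::
  "('o, 'm, 'z) moncat_scheme \<Rightarrow> 'o \<times> 'm \<times> 'm \<times> 'm \<Rightarrow> 'o \<times> 'm \<times> 'm" where
  "tensor_square_algebra M = (\<lambda>(A, mA, uA, cA).
     (A \<odot> A, (mA \<boxtimes> mA) \<cdot> mid_braiding M A cA, (uA \<boxtimes> uA) \<cdot> Unit_comult M))"
  for M (structure)

(* u is the unit of T V and i the injection of V *)
definition delta_l :: "('o, 'm, 'z) moncat_scheme \<Rightarrow> 'o \<Rightarrow> 'm \<Rightarrow> 'm \<Rightarrow> 'm" where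
  "delta_l M V u i = (u \<boxtimes> i) \<cdot> \<l>\<inverse> V" for M (structure)

definition delta_r :: "('o, 'm, 'z) moncat_scheme \<Rightarrow> 'o \<Rightarrow> 'm \<Rightarrow> 'm \<Rightarrow> 'm" where
  "delta_r M V u i = (i \<boxtimes> u) \<cdot> \<r>\<inverse> V" for M (structure)

definition is_comult ::
  "('o, 'm, 'z) premoncat_scheme \<Rightarrow> (nat \<Rightarrow> 'o \<Rightarrow> 'm) \<Rightarrow> 'o \<Rightarrow> 'o \<times> 'm \<times> 'm \<times> 'm \<Rightarrow> 'm \<Rightarrow> bool" where
  "is_comult M \<alpha> V = (\<lambda>(A, mA, uA, cA) \<Delta>.
     \<Delta> \<in> Hom (Alg M) (A, mA, uA) (tensor_square_algebra M (A, mA, uA, cA)) \<and>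
     \<Delta> \<cdot> \<alpha> 1 V = delta_l M V uA (\<alpha> 1 V) \<^bold>+ delta_r M V uA (\<alpha> 1 V))"
  for M (structure)

definition is_counit ::
  "('o, 'm, 'z) premoncat_scheme \<Rightarrow> (nat \<Rightarrow> 'o \<Rightarrow> 'm) \<Rightarrow> 'o \<Rightarrow> 'o \<times> 'm \<times> 'm \<times> 'm \<Rightarrow> 'm \<Rightarrow> bool" where
  "is_counit M \<alpha> V = (\<lambda>(A, mA, uA, cA) \<epsilon>.
     \<epsilon> \<in> Hom (Alg M) (A, mA, uA) (unit_algebra M) \<and> \<epsilon> \<cdot> \<alpha> 1 V = \<^bold>0 V \<I>)"
  for M (structure)

(* Only meaningful where the comultiplication and counit exist uniquely. *)
definition Tbar_Br ::
  "('o, 'm, 'z) premoncat_scheme \<Rightarrow> (nat \<Rightarrow> 'o \<Rightarrow> 'm) \<Rightarrow>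
   ('o \<times> 'm, 'm, 'o \<times> 'm \<times> 'm \<times> 'm, 'm) functr \<Rightarrow>
   ('o \<times> 'm, 'm, 'o \<times> 'm \<times> 'm \<times> 'm \<times> 'm \<times> 'm, 'm) functr" where
  "Tbar_Br M \<alpha> T\<^sub>B\<^sub>r = \<lparr>
     FOb = \<lambda>(V, c). case FOb T\<^sub>B\<^sub>r (V, c) of (A, mA, uA, cA) \<Rightarrow>
       (A, mA, uA,
        THE \<Delta>. is_comult M \<alpha> V (A, mA, uA, cA) \<Delta>,
        THE \<epsilon>. is_counit M \<alpha> V (A, mA, uA, cA) \<epsilon>,
        cA),
     FArr = FArr T\<^sub>B\<^sub>r\<rparr>"

end

theory Submission
  imports Defs
begin

text \<open>Algebra morphisms out of \<open>T V\<close> are determined by their restriction to \<open>V\<close>; this gives \<open>\<Delta>\<close>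
  and \<open>\<epsilon>\<close> once \<open>A \<otimes> A\<close> is known to be an algebra. The remaining axioms compare two morphisms that
  are multiplicative in the same, possibly twisted, sense, so by induction along
  \<open>\<alpha>\<^sub>n\<^sub>+\<^sub>1 = m (\<alpha>\<^sub>n \<otimes> \<alpha>\<^sub>1)\<close> it suffices to compare them on the unit and on \<open>V\<close>. For \<open>\<Delta>\<close> the
  compatibility with the braiding comes first: it makes \<open>\<Delta> \<otimes> A\<close> and \<open>A \<otimes> \<Delta>\<close> multiplicative,
  which coassociativity then uses.

  The constraints of the monoidal category are eliminated by strictification. A word of objects
  stands for the right-nested tensor product of its letters followed by the unit, and an arrow
  \<open>f\<close> acts on every word by tensoring with the identity of the remaining letters; the resulting
  families, natural in the remaining word, form a strict calculus of string diagrams.\<close>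

subsection \<open>Words of objects and their arrows\<close>

text \<open>With constraints written out, associativity of A tensor A or coassociativity drowns in
  reassociations. Among words every constraint becomes an identity diagram, and interchange is
  naturality of a family in the word to its right, so an axiom can be proved by rewriting both sides
  to one normal form. \<open>srep\<close> is the bridge: its rules compute the diagram of an arrow
  from its shape, and \<open>srep_eq\<close> shows that nothing is lost.

  Comparing two arrows on the components alpha_n is enough even beside further tensor factors,
  because the tensor functors preserve the coproduct.

  One difficulty is not formal. Delta and epsilon are known on V, but in the compatibility with the
  braiding they are also applied after a crossing. This works because c_A carries A tensor V to V
  tensor A and V tensor A to A tensor V, through the components c_T n 1 and c_T 1 n: the strand V is
  still V after the crossing. Sums and zeros enter through V alone, where Delta is a sum of two unit
  insertions and epsilon is zero.\<close>

text \<open>\<open>Null\<close> is the value of every ill-typed operation. This makes composition associative, and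
  left whiskering functorial, without side conditions.\<close>

datatype ('o, 'm) sarr = Null | Arr "'o list" 'm "'o list"

fun sdom :: "('o, 'm) sarr \<Rightarrow> 'o list" where
  "sdom Null = []"
| "sdom (Arr xs f ys) = xs"

fun scod :: "('o, 'm) sarr \<Rightarrow> 'o list" where
  "scod Null = []"
| "scod (Arr xs f ys) = ys"

fun sval :: "('o, 'm) sarr \<Rightarrow> 'm" where
  "sval Null = undefined"
| "sval (Arr xs f ys) = f"

context category
begin

lemma is_inverse_unique:
  assumes "X \<in> Ob C" "Y \<in> Ob C" "is_inverse C X Y f g" "is_inverse C X Y f h"
  shows "g = h"
proof -
  have h: "f \<in> Hom C X Y" "g \<in> Hom C Y X" "h \<in> Hom C Y X"
    and eq: "g \<cdot> f = \<langle>X\<rangle>" "f \<cdot> h = \<langle>Y\<rangle>"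
    using assms by (simp_all add: is_inverse_def)
  have "(g \<cdot> f) \<cdot> h = g \<cdot> (f \<cdot> h)"
    using assms(1,2) h by (intro Comp_assoc)
  then show ?thesis using eq h assms(1,2) by (simp add: Ide_Comp Comp_Ide)
qed

lemma is_inverse_inverse_arr:
  assumes "X \<in> Ob C" "Y \<in> Ob C" "invertible_arr C X Y f"
  shows "is_inverse C X Y f (inverse_arr C X Y f)"
  unfolding inverse_arr_def
  by (rule theI') (use assms is_inverse_unique in \<open>auto simp: invertible_arr_def\<close>)

lemma coproduct_factor:
  assumes "is_coproduct C X S i" "Z \<in> Ob C" "\<And>n. g n \<in> Hom C (X n) Z"
  obtains h where "h \<in> Hom C S Z" "\<And>n. h \<cdot> i n = g n"
proof -
  have "\<exists>!h. h \<in> Hom C S Z \<and> (\<forall>n. h \<cdot> i n = g n)" using assms unfolding is_coproduct_def by simp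
  with that show thesis by blast
qed

end

context monoidal_category
begin

primrec ev :: "'o list \<Rightarrow> 'o" where
  "ev [] = \<I>"
| "ev (X # xs) = X \<odot> ev xs"

abbreviation obs :: "'o list \<Rightarrow> bool" where
  "obs xs \<equiv> set xs \<subseteq> Ob M"

lemma ev_Ob [simp]: "obs xs \<Longrightarrow> ev xs \<in> Ob M"
  by (induction xs) (auto intro: Unit_in_Ob TOb_in_Ob)

declare Unit_in_Ob [simp] TOb_in_Ob [simp]

fun sarr :: "('o, 'm) sarr \<Rightarrow> bool" where
  "sarr Null = False"
| "sarr (Arr xs f ys) = (obs xs \<and> obs ys \<and> f \<in> Hom M (ev xs) (ev ys))"

lemma sarrD: "sarr t \<Longrightarrow> obs (sdom t) \<and> obs (scod t) \<and> sval t \<in> Hom M (ev (sdom t)) (ev (scod t))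
    \<and> t = Arr (sdom t) (sval t) (scod t)"
  by (cases t) auto

definition scomp :: "('o, 'm) sarr \<Rightarrow> ('o, 'm) sarr \<Rightarrow> ('o, 'm) sarr"  (infixr "\<odot>\<odot>" 55) where
  "t \<odot>\<odot> s = (if sarr t \<and> sarr s \<and> scod s = sdom t then Arr (sdom s) (sval t \<cdot> sval s) (scod t) else Null)"

definition sid :: "'o list \<Rightarrow> ('o, 'm) sarr" where
  "sid xs = (if obs xs then Arr xs \<langle>ev xs\<rangle> xs else Null)"

definition lw :: "'o \<Rightarrow> ('o, 'm) sarr \<Rightarrow> ('o, 'm) sarr" where
  "lw X t = (if X \<in> Ob M \<and> sarr t then Arr (X # sdom t) (\<langle>X\<rangle> \<boxtimes> sval t) (X # scod t) else Null)"

abbreviation lws :: "'o list \<Rightarrow> ('o, 'm) sarr \<Rightarrow> ('o, 'm) sarr" where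
  "lws ws t \<equiv> foldr lw ws t"

text \<open>Right whiskering is implicit: an arrow is embedded as a family indexed by the word \<open>xs\<close>
  standing to its right.\<close>

definition emb :: "'o \<Rightarrow> 'm \<Rightarrow> 'o \<Rightarrow> 'o list \<Rightarrow> ('o, 'm) sarr" where
  "emb X f Y xs = (if X \<in> Ob M \<and> Y \<in> Ob M \<and> f \<in> Hom M X Y \<and> obs xs
     then Arr (X # xs) (f \<boxtimes> \<langle>ev xs\<rangle>) (Y # xs) else Null)"

definition split :: "'o \<Rightarrow> 'o \<Rightarrow> 'o list \<Rightarrow> ('o, 'm) sarr" where
  "split X Y xs = (if X \<in> Ob M \<and> Y \<in> Ob M \<and> obs xs
     then Arr ((X \<odot> Y) # xs) (\<a> X Y (ev xs)) (X # Y # xs) else Null)"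

definition join :: "'o \<Rightarrow> 'o \<Rightarrow> 'o list \<Rightarrow> ('o, 'm) sarr" where
  "join X Y xs = (if X \<in> Ob M \<and> Y \<in> Ob M \<and> obs xs
     then Arr (X # Y # xs) (\<a>\<inverse> X Y (ev xs)) ((X \<odot> Y) # xs) else Null)"

definition del :: "'o list \<Rightarrow> ('o, 'm) sarr" where
  "del xs = (if obs xs then Arr (\<I> # xs) (\<l> (ev xs)) xs else Null)"

definition ins :: "'o list \<Rightarrow> ('o, 'm) sarr" where
  "ins xs = (if obs xs then Arr xs (\<l>\<inverse> (ev xs)) (\<I> # xs) else Null)"

definition hom :: "('o, 'm) sarr \<Rightarrow> 'o list \<Rightarrow> 'o list \<Rightarrow> bool" where
  "hom t xs ys \<longleftrightarrow> sarr t \<and> sdom t = xs \<and> scod t = ys"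

lemma a_inv: "\<lbrakk>X \<in> Ob M; Y \<in> Ob M; Z \<in> Ob M\<rbrakk> \<Longrightarrow>
    is_inverse M ((X \<odot> Y) \<odot> Z) (X \<odot> (Y \<odot> Z)) (\<a> X Y Z) (\<a>\<inverse> X Y Z)"
  unfolding Assoc_inv_def by (intro is_inverse_inverse_arr Assoc_invertible) auto

lemma l_inv: "X \<in> Ob M \<Longrightarrow> is_inverse M (\<I> \<odot> X) X (\<l> X) (\<l>\<inverse> X)"
  unfolding LUnit_inv_def by (intro is_inverse_inverse_arr LUnit_invertible) auto

lemma r_inv: "X \<in> Ob M \<Longrightarrow> is_inverse M (X \<odot> \<I>) X (\<r> X) (\<r>\<inverse> X)"
  unfolding RUnit_inv_def by (intro is_inverse_inverse_arr RUnit_invertible) auto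

lemma struct_Hom:
  "\<lbrakk>X \<in> Ob M; Y \<in> Ob M; Z \<in> Ob M\<rbrakk> \<Longrightarrow> \<a> X Y Z \<in> Hom M ((X \<odot> Y) \<odot> Z) (X \<odot> (Y \<odot> Z))"
  "\<lbrakk>X \<in> Ob M; Y \<in> Ob M; Z \<in> Ob M\<rbrakk> \<Longrightarrow> \<a>\<inverse> X Y Z \<in> Hom M (X \<odot> (Y \<odot> Z)) ((X \<odot> Y) \<odot> Z)"
  "X \<in> Ob M \<Longrightarrow> \<l> X \<in> Hom M (\<I> \<odot> X) X"
  "X \<in> Ob M \<Longrightarrow> \<l>\<inverse> X \<in> Hom M X (\<I> \<odot> X)"
  "X \<in> Ob M \<Longrightarrow> \<r> X \<in> Hom M (X \<odot> \<I>) X"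
  "X \<in> Ob M \<Longrightarrow> \<r>\<inverse> X \<in> Hom M X (X \<odot> \<I>)"
  using a_inv l_inv r_inv unfolding is_inverse_def by auto

lemma hom_intros:
  "obs xs \<Longrightarrow> hom (sid xs) xs xs"
  "\<lbrakk>hom t ys zs; hom s xs ys\<rbrakk> \<Longrightarrow> hom (t \<odot>\<odot> s) xs zs"
  "\<lbrakk>X \<in> Ob M; hom t xs ys\<rbrakk> \<Longrightarrow> hom (lw X t) (X # xs) (X # ys)"
  "\<lbrakk>X \<in> Ob M; Y \<in> Ob M; f \<in> Hom M X Y; obs xs\<rbrakk> \<Longrightarrow> hom (emb X f Y xs) (X # xs) (Y # xs)"
  "\<lbrakk>X \<in> Ob M; Y \<in> Ob M; obs xs\<rbrakk> \<Longrightarrow> hom (split X Y xs) ((X \<odot> Y) # xs) (X # Y # xs)"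
  "\<lbrakk>X \<in> Ob M; Y \<in> Ob M; obs xs\<rbrakk> \<Longrightarrow> hom (join X Y xs) (X # Y # xs) ((X \<odot> Y) # xs)"
  "obs xs \<Longrightarrow> hom (del xs) (\<I> # xs) xs"
  "obs xs \<Longrightarrow> hom (ins xs) xs (\<I> # xs)"
  by (auto simp: hom_def sid_def scomp_def lw_def emb_def split_def join_def del_def ins_def Ide_in_Hom
      struct_Hom TArr_in_Hom dest!: sarrD intro: Comp_in_Hom[OF ev_Ob ev_Ob ev_Ob])

lemma homD: "hom t xs ys \<Longrightarrow> sarr t" "hom t xs ys \<Longrightarrow> sdom t = xs" "hom t xs ys \<Longrightarrow> scod t = ys"
  "hom t xs ys \<Longrightarrow> obs xs"  "hom t xs ys \<Longrightarrow> obs ys"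
  unfolding hom_def using sarrD by auto

lemma hom_lws: "\<lbrakk>obs ws; hom t xs ys\<rbrakk> \<Longrightarrow> hom (lws ws t) (ws @ xs) (ws @ ys)"
  by (induction ws) (auto intro: hom_intros)

lemma sarr_scomp: "sarr (t \<odot>\<odot> s) \<longleftrightarrow> sarr t \<and> sarr s \<and> scod s = sdom t"
  by (auto simp: scomp_def dest!: sarrD intro: Comp_in_Hom[OF ev_Ob ev_Ob ev_Ob])

lemma scomp_assoc: "(t \<odot>\<odot> s) \<odot>\<odot> r = t \<odot>\<odot> s \<odot>\<odot> r"
proof (cases "sarr t \<and> sarr s \<and> sarr r \<and> scod s = sdom t \<and> scod r = sdom s")
  case True
  then have "sarr (t \<odot>\<odot> s)" "sarr (s \<odot>\<odot> r)" by (auto simp: sarr_scomp)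
  with True show ?thesis
    by (auto simp: scomp_def dest!: sarrD intro: Comp_assoc[OF ev_Ob ev_Ob ev_Ob ev_Ob])
next
  case False
  have *: "sarr (t \<odot>\<odot> s) \<Longrightarrow> sdom (t \<odot>\<odot> s) = sdom s" "sarr (s \<odot>\<odot> r) \<Longrightarrow> scod (s \<odot>\<odot> r) = scod s"
    by (auto simp: scomp_def split: if_splits)
  have "t \<odot>\<odot> s \<odot>\<odot> r = Null" "(t \<odot>\<odot> s) \<odot>\<odot> r = Null"
    unfolding scomp_def[of t "s \<odot>\<odot> r"] scomp_def[of "t \<odot>\<odot> s" r]
    using False * by (auto simp: sarr_scomp)
  then show ?thesis by simp
qed

text \<open>Composites are bracketed to the right, so inside a long diagram the two factors of a
  rule form no subterm of their own. The version with an arbitrary tail \<open>x\<close> is what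
  rewrites there; it needs no typing because \<open>scomp_assoc\<close> has none.\<close>

lemma scomp_ext: "t \<odot>\<odot> s = r \<Longrightarrow> t \<odot>\<odot> s \<odot>\<odot> x = r \<odot>\<odot> x"
  by (metis scomp_assoc)

lemma sid_left: "hom t xs ys \<Longrightarrow> sid ys \<odot>\<odot> t = t"
  by (auto simp: hom_def sid_def scomp_def Ide_in_Hom Ide_Comp ev_Ob dest!: sarrD)
     (metis Ide_Comp ev_Ob)

lemma sid_right: "hom t xs ys \<Longrightarrow> t \<odot>\<odot> sid xs = t"
  by (auto simp: hom_def sid_def scomp_def Ide_in_Hom Ide_Comp ev_Ob dest!: sarrD)
     (metis Comp_Ide ev_Ob)

lemma lw_Null [simp]: "lw X Null = Null" "t \<odot>\<odot> Null = Null" "Null \<odot>\<odot> t = Null"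
  by (auto simp: lw_def scomp_def)

lemma sarr_lw:
  "sarr (lw X t) \<longleftrightarrow> X \<in> Ob M \<and> sarr t"
  "X \<in> Ob M \<Longrightarrow> sarr t \<Longrightarrow> sdom (lw X t) = X # sdom t"
  "X \<in> Ob M \<Longrightarrow> sarr t \<Longrightarrow> scod (lw X t) = X # scod t"
proof -
  show *: "sdom (lw X t) = X # sdom t" "scod (lw X t) = X # scod t" if "X \<in> Ob M" "sarr t"
    using hom_intros(3)[of X t "sdom t" "scod t"] that by (auto simp: hom_def)
  show "sarr (lw X t) \<longleftrightarrow> X \<in> Ob M \<and> sarr t"
    using hom_intros(3)[of X t "sdom t" "scod t"] by (auto simp: hom_def) (auto simp: lw_def split: if_splits)
qed

lemma lw_scomp: "lw X (t \<odot>\<odot> s) = lw X t \<odot>\<odot> lw X s"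
proof (cases "X \<in> Ob M \<and> sarr t \<and> sarr s \<and> scod s = sdom t")
  case True
  then show ?thesis
    using hom_intros(3)[of X t] hom_intros(3)[of X s] sarr_scomp[of t s]
      TArr_Comp[of X X X "ev (sdom s)" "ev (scod s)" "ev (scod t)" "\<langle>X\<rangle>" "\<langle>X\<rangle>" "sval s" "sval t"]
    by (auto simp: hom_def lw_def scomp_def Ide_in_Hom Ide_Comp dest!: sarrD)
next
  case False
  then have "lw X t \<odot>\<odot> lw X s = Null"
    by (subst scomp_def) (auto simp: sarr_lw)
  moreover have "lw X (t \<odot>\<odot> s) = Null"
    using False by (auto simp: lw_def sarr_scomp)
  ultimately show ?thesis by simp
qed

lemma lws_scomp: "lws ws (t \<odot>\<odot> s) = lws ws t \<odot>\<odot> lws ws s"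
  by (induction ws) (auto simp: lw_scomp)

lemma lw_sid: "X \<in> Ob M \<Longrightarrow> obs xs \<Longrightarrow> lw X (sid xs) = sid (X # xs)"
  by (auto simp: lw_def sid_def TArr_Ide Ide_in_Hom)

lemma split_join: "\<lbrakk>X \<in> Ob M; Y \<in> Ob M; obs xs\<rbrakk> \<Longrightarrow> split X Y xs \<odot>\<odot> join X Y xs = sid (X # Y # xs)"
  using a_inv[of X Y "ev xs"]
  by (auto simp: split_def join_def sid_def scomp_def is_inverse_def)

lemma join_split: "\<lbrakk>X \<in> Ob M; Y \<in> Ob M; obs xs\<rbrakk> \<Longrightarrow> join X Y xs \<odot>\<odot> split X Y xs = sid ((X \<odot> Y) # xs)"
  using a_inv[of X Y "ev xs"]
  by (auto simp: split_def join_def sid_def scomp_def is_inverse_def)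

lemma ins_del: "obs xs \<Longrightarrow> ins xs \<odot>\<odot> del xs = sid (\<I> # xs)"
  using l_inv[of "ev xs"] by (auto simp: del_def ins_def sid_def scomp_def is_inverse_def)

lemma del_ins: "obs xs \<Longrightarrow> del xs \<odot>\<odot> ins xs = sid xs"
  using l_inv[of "ev xs"] by (auto simp: del_def ins_def sid_def scomp_def is_inverse_def)

subsection \<open>Natural families\<close>

text \<open>\<open>natural F us vs\<close>: the family \<open>F\<close> is a string diagram from \<open>us\<close> to \<open>vs\<close>; naturality in the
  word on the right is the interchange law.\<close>

definition natural :: "('o list \<Rightarrow> ('o, 'm) sarr) \<Rightarrow> 'o list \<Rightarrow> 'o list \<Rightarrow> bool" where
  "natural F us vs \<longleftrightarrow> obs us \<and> obs vs \<and> (\<forall>xs. obs xs \<longrightarrow> hom (F xs) (us @ xs) (vs @ xs)) \<and>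
     (\<forall>t. sarr t \<longrightarrow> F (scod t) \<odot>\<odot> lws us t = lws vs t \<odot>\<odot> F (sdom t))"

lemma natural_hom: "natural F us vs \<Longrightarrow> obs xs \<Longrightarrow> hom (F xs) (us @ xs) (vs @ xs)"
  by (auto simp: natural_def)

lemma natural_obs: "natural F us vs \<Longrightarrow> obs us" "natural F us vs \<Longrightarrow> obs vs"
  by (auto simp: natural_def)

lemma naturalD: "natural F us vs \<Longrightarrow> hom t xs ys \<Longrightarrow> F ys \<odot>\<odot> lws us t = lws vs t \<odot>\<odot> F xs"
  by (auto simp: natural_def hom_def)

lemma natural_sid: "obs us \<Longrightarrow> natural (\<lambda>xs. sid (us @ xs)) us us"
  unfolding natural_def by (metis hom_intros(1) hom_lws sid_left sid_right hom_def Un_least set_append sarrD)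

lemma natural_scomp:
  assumes "natural F us vs" "natural G vs ws" shows "natural (\<lambda>xs. G xs \<odot>\<odot> F xs) us ws"
proof -
  have "(G (scod t) \<odot>\<odot> F (scod t)) \<odot>\<odot> lws us t = lws ws t \<odot>\<odot> G (sdom t) \<odot>\<odot> F (sdom t)" if "sarr t" for t
  proof -
    have "hom t (sdom t) (scod t)" using that by (simp add: hom_def)
    then show ?thesis using naturalD[OF assms(1)] naturalD[OF assms(2)] by (metis scomp_assoc)
  qed
  moreover have "hom (G xs \<odot>\<odot> F xs) (us @ xs) (ws @ xs)" if "obs xs" for xs
    using natural_hom[OF assms(2) that] natural_hom[OF assms(1) that] by (rule hom_intros(2))
  ultimately show ?thesis using assms by (auto simp: natural_def)
qed

lemma natural_lw: "X \<in> Ob M \<Longrightarrow> natural F us vs \<Longrightarrow> natural (\<lambda>xs. lw X (F xs)) (X # us) (X # vs)"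
  by (auto simp: natural_def lw_scomp[symmetric] intro: hom_intros)

lemma natural_lws: "obs ws \<Longrightarrow> natural F us vs \<Longrightarrow> natural (\<lambda>xs. lws ws (F xs)) (ws @ us) (ws @ vs)"
  by (induction ws) (auto simp: natural_lw)

text \<open>Feeding \<open>F\<close> only words that begin with \<open>zs\<close> is whiskering on
  the right: the letters \<open>zs\<close> become idle strands of the diagram.\<close>

lemma natural_app:
  assumes "obs zs" "natural F us vs" shows "natural (\<lambda>xs. F (zs @ xs)) (us @ zs) (vs @ zs)"
proof -
  have "F (zs @ scod t) \<odot>\<odot> lws us (lws zs t) = lws vs (lws zs t) \<odot>\<odot> F (zs @ sdom t)" if "sarr t" for t
    using that assms by (intro naturalD hom_lws) (auto simp: hom_def)
  with assms show ?thesis by (auto simp: natural_def)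
qed

lemma natural_Cons:
  assumes "Z \<in> Ob M" "natural F us vs" shows "natural (\<lambda>xs. F (Z # xs)) (us @ [Z]) (vs @ [Z])"
  using natural_app[of "[Z]" F us vs] assms by simp

lemma natural_emb:
  assumes "X \<in> Ob M" "Y \<in> Ob M" "f \<in> Hom M X Y" shows "natural (emb X f Y) [X] [Y]"
proof -
  have "emb X f Y (scod t) \<odot>\<odot> lw X t = lw Y t \<odot>\<odot> emb X f Y (sdom t)" if "sarr t" for t
  proof -
    have t: "hom t (sdom t) (scod t)" "obs (sdom t)" "obs (scod t)" "sval t \<in> Hom M (ev (sdom t)) (ev (scod t))"
      using that by (auto simp: hom_def dest: sarrD)
    have "hom (emb X f Y (scod t)) (X # scod t) (Y # scod t)" "hom (emb X f Y (sdom t)) (X # sdom t) (Y # sdom t)"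
      "hom (lw X t) (X # sdom t) (X # scod t)" "hom (lw Y t) (Y # sdom t) (Y # scod t)"
      using assms t by (auto intro!: hom_intros)
    moreover have "(f \<boxtimes> \<langle>ev (scod t)\<rangle>) \<cdot> (\<langle>X\<rangle> \<boxtimes> sval t) = (\<langle>Y\<rangle> \<boxtimes> sval t) \<cdot> (f \<boxtimes> \<langle>ev (sdom t)\<rangle>)"
      using assms t
        TArr_Comp[of X X Y "ev (sdom t)" "ev (scod t)" "ev (scod t)" "\<langle>X\<rangle>" f "sval t" "\<langle>ev (scod t)\<rangle>"]
        TArr_Comp[of X Y Y "ev (sdom t)" "ev (sdom t)" "ev (scod t)" f "\<langle>Y\<rangle>"  "\<langle>ev (sdom t)\<rangle>" "sval t"]
        Ide_Comp[of "ev (sdom t)" "ev (scod t)" "sval t"] Comp_Ide[of "ev (sdom t)" "ev (scod t)" "sval t"]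
        Ide_Comp[of X Y f] Comp_Ide[of X Y f]
      by (auto simp: Ide_in_Hom)
    ultimately show ?thesis
      using assms t that by (auto simp: scomp_def hom_def emb_def lw_def)
  qed
  with assms show ?thesis by (auto simp: natural_def intro: hom_intros)
qed

lemma natural_split:
  assumes "X \<in> Ob M" "Y \<in> Ob M" shows "natural (split X Y) [X \<odot> Y] [X, Y]"
proof -
  have "split X Y (scod t) \<odot>\<odot> lw (X \<odot> Y) t = lw X (lw Y t) \<odot>\<odot> split X Y (sdom t)" if "sarr t" for t
  proof -
    have t: "hom t (sdom t) (scod t)" "obs (sdom t)" "obs (scod t)" "sval t \<in> Hom M (ev (sdom t)) (ev (scod t))"
      using that by (auto simp: hom_def dest: sarrD)
    have h: "hom (lw Y t) (Y # sdom t) (Y # scod t)" using assms t by (auto intro!: hom_intros)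
    have "hom (split X Y (scod t)) ((X \<odot> Y) # scod t) (X # Y # scod t)"
      "hom (split X Y (sdom t)) ((X \<odot> Y) # sdom t) (X # Y # sdom t)"
      "hom (lw (X \<odot> Y) t) ((X \<odot> Y) # sdom t) ((X \<odot> Y) # scod t)"
      "hom (lw X (lw Y t)) (X # Y # sdom t) (X # Y # scod t)"
      using assms t h by (auto intro!: hom_intros)
    then show ?thesis
      using assms t that h Assoc_natural[of X X Y Y "ev (sdom t)" "ev (scod t)" "\<langle>X\<rangle>" "\<langle>Y\<rangle>" "sval t"]
      by (auto simp: scomp_def hom_def split_def lw_def TArr_Ide Ide_in_Hom)
  qed
  with assms show ?thesis by (auto simp: natural_def intro: hom_intros)
qed

lemma natural_del: "natural del [\<I>] []"
proof -
  have "del (scod t) \<odot>\<odot> lw \<I> t = t \<odot>\<odot> del (sdom t)" if "sarr t" for t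
  proof -
    have t: "hom t (sdom t) (scod t)" "obs (sdom t)" "obs (scod t)" "sval t \<in> Hom M (ev (sdom t)) (ev (scod t))"
      using that by (auto simp: hom_def dest: sarrD)
    have "hom (del (scod t)) (\<I> # scod t) (scod t)"
      "hom (del (sdom t)) (\<I> # sdom t) (sdom t)"
      "hom (lw \<I> t) (\<I> # sdom t) (\<I> # scod t)"
      using t by (auto intro!: hom_intros)
    then show ?thesis
      using t that LUnit_natural[of "ev (sdom t)" "ev (scod t)" "sval t"]
      by (auto simp: scomp_def hom_def del_def lw_def TArr_Ide Ide_in_Hom)
  qed
  then show ?thesis by (auto simp: natural_def intro: hom_intros)
qed

text \<open>Transfers naturality from \<open>split\<close> to \<open>join\<close> and from
  \<open>del\<close> to \<open>ins\<close>.\<close>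

lemma natural_inverse:
  assumes "natural F us vs" "\<And>xs. obs xs \<Longrightarrow> hom (G xs) (vs @ xs) (us @ xs)"
    "\<And>xs. obs xs \<Longrightarrow> G xs \<odot>\<odot> F xs = sid (us @ xs)" "\<And>xs. obs xs \<Longrightarrow> F xs \<odot>\<odot> G xs = sid (vs @ xs)"
  shows "natural G vs us"
proof -
  have "G (scod t) \<odot>\<odot> lws vs t = lws us t \<odot>\<odot> G (sdom t)" if "sarr t" for t
  proof -
    have t: "hom t (sdom t) (scod t)" "obs (sdom t)" "obs (scod t)" using that by (auto simp: hom_def dest: sarrD)
    have vt: "hom (lws vs t) (vs @ sdom t) (vs @ scod t)" "hom (lws us t) (us @ sdom t) (us @ scod t)"
      using assms(1) t by (auto intro!: hom_lws simp: natural_def)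
    have "G (scod t) \<odot>\<odot> lws vs t = G (scod t) \<odot>\<odot> lws vs t \<odot>\<odot> F (sdom t) \<odot>\<odot> G (sdom t)"
      using t assms(4) vt by (simp add: sid_right)
    also have "\<dots> = (G (scod t) \<odot>\<odot> F (scod t)) \<odot>\<odot> lws us t \<odot>\<odot> G (sdom t)"
      using naturalD[OF assms(1) t(1)] by (metis scomp_assoc)
    also have "\<dots> = lws us t \<odot>\<odot> G (sdom t)"
      using t assms(3) vt hom_intros(2)[OF vt(2) assms(2)] by (simp add: sid_left)
    finally show ?thesis .
  qed
  with assms show ?thesis by (auto simp: natural_def)
qed

lemma natural_join: "X \<in> Ob M \<Longrightarrow> Y \<in> Ob M \<Longrightarrow> natural (join X Y) [X, Y] [X \<odot> Y]"
  by (rule natural_inverse[OF natural_split]) (auto intro: hom_intros simp: join_split split_join)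

lemma natural_ins: "natural ins [] [\<I>]"
  by (rule natural_inverse[OF natural_del]) (auto intro: hom_intros simp: ins_del del_ins)

subsection \<open>Constraints as arrows between words\<close>

lemma sid_scomp_ext: "hom t xs ys \<Longrightarrow> sid ys \<odot>\<odot> t \<odot>\<odot> s = t \<odot>\<odot> s"
  by (metis scomp_assoc sid_left)

lemma iso_cancel_right:
  assumes "i \<odot>\<odot> j = sid xs" "hom t xs ys" "hom s xs ys" "t \<odot>\<odot> i = s \<odot>\<odot> i"
  shows "t = s"
  using assms by (metis scomp_assoc sid_right)

lemma sarr_eqI: "\<lbrakk>hom t xs ys; hom s xs ys; sval t = sval s\<rbrakk> \<Longrightarrow> t = s"
  by (cases t; cases s) (auto simp: hom_def)

lemma sval_scomp: "\<lbrakk>hom t ys zs; hom s xs ys\<rbrakk> \<Longrightarrow> sval (t \<odot>\<odot> s) = sval t \<cdot> sval s"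
  by (auto simp: scomp_def hom_def)

lemma sval_lw: "\<lbrakk>X \<in> Ob M; hom t xs ys\<rbrakk> \<Longrightarrow> sval (lw X t) = \<langle>X\<rangle> \<boxtimes> sval t"
  by (auto simp: lw_def hom_def)

lemma emb_scomp:
  assumes "X \<in> Ob M" "Y \<in> Ob M" "Z \<in> Ob M" "f \<in> Hom M X Y" "g \<in> Hom M Y Z"
  shows "emb X (g \<cdot> f) Z xs = emb Y g Z xs \<odot>\<odot> emb X f Y xs"
proof (cases "obs xs")
  case True
  have *: "g \<cdot> f \<in> Hom M X Z" using Comp_in_Hom assms by blast
  note h = hom_intros(4)[OF assms(1,2,4) True] hom_intros(4)[OF assms(2,3,5) True]
     hom_intros(4)[OF assms(1,3) * True]
  show ?thesis
    by (rule sarr_eqI[OF h(3) hom_intros(2)[OF h(2,1)]])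
       (use assms * True TArr_Comp[of X Y Z "ev xs" "ev xs" "ev xs" f g "\<langle>ev xs\<rangle>" "\<langle>ev xs\<rangle>"] in
        \<open>simp add: sval_scomp[OF h(2,1)] Ide_Comp[OF ev_Ob ev_Ob] Ide_in_Hom, simp add: emb_def\<close>)
qed (auto simp: emb_def)

text \<open>By naturality of the associator, a tensor product of arrows on one composite letter is a
  pair of arrows on two separate letters. Interchange leaves a choice of order; \<open>g\<close>
  acts first.\<close>

lemma emb_tensor:
  assumes "X \<in> Ob M" "X' \<in> Ob M" "Y \<in> Ob M" "Y' \<in> Ob M" "f \<in> Hom M X X'" "g \<in> Hom M Y Y'" "obs xs"
  shows "emb (X \<odot> Y) (f \<boxtimes> g) (X' \<odot> Y') xs =
    join X' Y' xs \<odot>\<odot> emb X f X' (Y' # xs) \<odot>\<odot> lw X (emb Y g Y' xs) \<odot>\<odot> split X Y xs"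
proof -
  have fg: "f \<boxtimes> g \<in> Hom M (X \<odot> Y) (X' \<odot> Y')" using assms TArr_in_Hom by blast
  note h1 = hom_intros(4)[OF assms(3,4,6,7)]
  have h2: "hom (emb X f X' (Y' # xs)) (X # Y' # xs) (X' # Y' # xs)" using assms by (intro hom_intros) auto
  have h3: "hom (split X Y xs) ((X \<odot> Y) # xs) (X # Y # xs)" using assms by (intro hom_intros) auto
  have h4: "hom (split X' Y' xs) ((X' \<odot> Y') # xs) (X' # Y' # xs)" using assms by (intro hom_intros) auto
  have h5: "hom (emb (X \<odot> Y) (f \<boxtimes> g) (X' \<odot> Y') xs) ((X \<odot> Y) # xs) ((X' \<odot> Y') # xs)"
    using assms fg by (intro hom_intros) auto
  note h6 = hom_intros(3)[OF assms(1) h1]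
  note h7 = hom_intros(2)[OF h6 h3]
  note h8 = hom_intros(2)[OF h2 h7]
  \<comment> \<open>Compared after splitting the target, the claim is naturality of the associator;
    \<open>join\<close> then undoes the split.\<close>
  have "split X' Y' xs \<odot>\<odot> emb (X \<odot> Y) (f \<boxtimes> g) (X' \<odot> Y') xs =
    emb X f X' (Y' # xs) \<odot>\<odot> lw X (emb Y g Y' xs) \<odot>\<odot> split X Y xs"
  proof (rule sarr_eqI[OF hom_intros(2)[OF h4 h5] h8])
    have "(f \<boxtimes> \<langle>Y' \<odot> ev xs\<rangle>) \<cdot> (\<langle>X\<rangle> \<boxtimes> (g \<boxtimes> \<langle>ev xs\<rangle>)) = f \<boxtimes> (g \<boxtimes> \<langle>ev xs\<rangle>)"
      using assms TArr_in_Hom[of Y Y' "ev xs" "ev xs" g "\<langle>ev xs\<rangle>"]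
       TArr_Comp[of X X X' "Y \<odot> ev xs" "Y' \<odot> ev xs" "Y' \<odot> ev xs" "\<langle>X\<rangle>" f "g \<boxtimes> \<langle>ev xs\<rangle>" "\<langle>Y' \<odot> ev xs\<rangle>"]
       Comp_Ide[of X X' f] Ide_Comp[of "Y \<odot> ev xs" "Y' \<odot> ev xs" "g \<boxtimes> \<langle>ev xs\<rangle>"]
      by (simp add: Ide_in_Hom)
    then have "((f \<boxtimes> \<langle>Y' \<odot> ev xs\<rangle>) \<cdot> (\<langle>X\<rangle> \<boxtimes> (g \<boxtimes> \<langle>ev xs\<rangle>))) \<cdot> \<a> X Y (ev xs) = \<a> X' Y' (ev xs) \<cdot> ((f \<boxtimes> g) \<boxtimes> \<langle>ev xs\<rangle>)"
      using assms Assoc_natural[of X X' Y Y' "ev xs" "ev xs" f g "\<langle>ev xs\<rangle>"] by (simp add: Ide_in_Hom)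
    then show "sval (split X' Y' xs \<odot>\<odot> emb (X \<odot> Y) (f \<boxtimes> g) (X' \<odot> Y') xs) =
        sval (emb X f X' (Y' # xs) \<odot>\<odot> lw X (emb Y g Y' xs) \<odot>\<odot> split X Y xs)"
      unfolding scomp_assoc[symmetric] sval_scomp[OF h4 h5]
        sval_scomp[OF hom_intros(2)[OF h2 h6] h3]  sval_scomp[OF h2 h6] sval_lw[OF assms(1) h1]
      using assms fg by (simp add: split_def emb_def)
  qed
  then have "join X' Y' xs \<odot>\<odot> split X' Y' xs \<odot>\<odot> emb (X \<odot> Y) (f \<boxtimes> g) (X' \<odot> Y') xs =
    join X' Y' xs \<odot>\<odot> emb X f X' (Y' # xs) \<odot>\<odot> lw X (emb Y g Y' xs) \<odot>\<odot> split X Y xs" by simp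
  then show ?thesis
    using scomp_ext[OF join_split] sid_left[OF h5] assms by metis
qed

lemma emb_id: "X \<in> Ob M \<Longrightarrow> obs xs \<Longrightarrow> emb X \<langle>X\<rangle> X xs = sid (X # xs)"
  by (auto simp: emb_def sid_def TArr_Ide Ide_in_Hom)

text \<open>This is the pentagon with \<open>ev xs\<close> as fourth object, solved for the arrow in
  which the associator is an ordinary morphism. Only regrouping of letters is left.\<close>

lemma emb_Assoc:
  assumes "X \<in> Ob M" "Y \<in> Ob M" "Z \<in> Ob M" "obs xs"
  shows "emb ((X \<odot> Y) \<odot> Z) (\<a> X Y Z) (X \<odot> (Y \<odot> Z)) xs =
    join X (Y \<odot> Z) xs \<odot>\<odot> lw X (join Y Z xs) \<odot>\<odot> split X Y (Z # xs) \<odot>\<odot> split (X \<odot> Y) Z xs"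
proof -
  have h1: "hom (emb ((X \<odot> Y) \<odot> Z) (\<a> X Y Z) (X \<odot> (Y \<odot> Z)) xs) (((X \<odot> Y) \<odot> Z) # xs) ((X \<odot> (Y \<odot> Z)) # xs)"
    using assms by (intro hom_intros struct_Hom) auto
  have h2: "hom (split X (Y \<odot> Z) xs) ((X \<odot> (Y \<odot> Z)) # xs) (X # (Y \<odot> Z) # xs)" using assms by (intro hom_intros) auto
  have h3: "hom (split Y Z xs) ((Y \<odot> Z) # xs) (Y # Z # xs)" using assms by (intro hom_intros) auto
  have h4: "hom (lw X (split Y Z xs)) (X # (Y \<odot> Z) # xs) (X # Y # Z # xs)" using assms by (intro hom_intros) auto
  have h5: "hom (split X Y (Z # xs)) ((X \<odot> Y) # Z # xs) (X # Y # Z # xs)" using assms by (intro hom_intros) auto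
  have h6: "hom (split (X \<odot> Y) Z xs) (((X \<odot> Y) \<odot> Z) # xs) ((X \<odot> Y) # Z # xs)" using assms by (intro hom_intros) auto
  have "lw X (split Y Z xs) \<odot>\<odot> split X (Y \<odot> Z) xs \<odot>\<odot> emb ((X \<odot> Y) \<odot> Z) (\<a> X Y Z) (X \<odot> (Y \<odot> Z)) xs =
     split X Y (Z # xs) \<odot>\<odot> split (X \<odot> Y) Z xs"
    by (rule sarr_eqI[OF hom_intros(2)[OF h4 hom_intros(2)[OF h2 h1]] hom_intros(2)[OF h5 h6]])
      (use pentagon[of X Y Z "ev xs"] assms in
      \<open>simp add: sval_scomp[OF h4 hom_intros(2)[OF h2 h1]] sval_scomp[OF h2 h1] sval_scomp[OF h5 h6] sval_lw[OF _ h3],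
       simp add: split_def emb_def struct_Hom\<close>)
  then have "join X (Y \<odot> Z) xs \<odot>\<odot> lw X (join Y Z xs) \<odot>\<odot> lw X (split Y Z xs) \<odot>\<odot> split X (Y \<odot> Z) xs \<odot>\<odot> emb ((X \<odot> Y) \<odot> Z) (\<a> X Y Z) (X \<odot> (Y \<odot> Z)) xs =
     join X (Y \<odot> Z) xs \<odot>\<odot> lw X (join Y Z xs) \<odot>\<odot> split X Y (Z # xs) \<odot>\<odot> split (X \<odot> Y) Z xs"
    by simp
  moreover have "join X (Y \<odot> Z) xs \<odot>\<odot> lw X (join Y Z xs) \<odot>\<odot> lw X (split Y Z xs) \<odot>\<odot> split X (Y \<odot> Z) xs \<odot>\<odot> t = t"
    if "hom t ys ((X \<odot> (Y \<odot> Z)) # xs)" for t ys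
  proof -
    have "lw X (join Y Z xs) \<odot>\<odot> lw X (split Y Z xs) = sid (X # (Y \<odot> Z) # xs)"
      using assms by (simp add: lw_scomp[symmetric] join_split lw_sid)
    then have "lw X (join Y Z xs) \<odot>\<odot> lw X (split Y Z xs) \<odot>\<odot> split X (Y \<odot> Z) xs \<odot>\<odot> t = split X (Y \<odot> Z) xs \<odot>\<odot> t"
      using sid_scomp_ext[OF h2] by (metis scomp_assoc)
    then show ?thesis using scomp_ext[OF join_split] sid_left[OF that] assms by (metis TOb_in_Ob)
  qed
  ultimately show ?thesis using h1 by metis
qed

text \<open>This is the triangle with \<open>ev xs\<close> as second object.\<close>

lemma emb_RUnit:
  assumes "X \<in> Ob M" "obs xs"
  shows "emb (X \<odot> \<I>) (\<r> X) X xs = lw X (del xs) \<odot>\<odot> split X \<I> xs"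
proof -
  have 1: "hom (emb (X \<odot> \<I>) (\<r> X) X xs) ((X \<odot> \<I>) # xs) (X # xs)"
     and 2: "hom (split X \<I> xs) ((X \<odot> \<I>) # xs) (X # \<I> # xs)"
     and 3: "hom (del xs) (\<I> # xs) xs"
    using assms by (auto intro!: hom_intros struct_Hom)
  note 4 = hom_intros(3)[OF assms(1) 3]
  show ?thesis
    by (rule sarr_eqI[OF 1 hom_intros(2)[OF 4 2]])
      (use assms triangle[of X "ev xs"] in \<open>simp add: sval_scomp[OF 4 2] sval_lw[OF _ 3], simp add: emb_def split_def del_def struct_Hom\<close>)
qed

text \<open>On the empty word the arrow is tensored with the unit object, and naturality of the
  invertible right unit constraint recovers it. Equations between diagrams therefore come back to
  \<open>M\<close>.\<close>

lemma emb_inj: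
  assumes "X \<in> Ob M" "Y \<in> Ob M" "f \<in> Hom M X Y" "g \<in> Hom M X Y" "emb X f Y [] = emb X g Y []"
  shows "f = g"
proof -
  have "f \<cdot> \<r> X = g \<cdot> \<r> X"
    using assms RUnit_natural[of X Y f] RUnit_natural[of X Y g] by (simp add: emb_def)
  then have "(f \<cdot> \<r> X) \<cdot> \<r>\<inverse> X = (g \<cdot> \<r> X) \<cdot> \<r>\<inverse> X" by simp
  then show ?thesis
    using Comp_assoc[of X "X \<odot> \<I>" X Y "\<r>\<inverse> X" "\<r> X" f] Comp_assoc[of X "X \<odot> \<I>" X Y "\<r>\<inverse> X" "\<r> X" g]
      r_inv[of X] assms Comp_Ide by (simp add: is_inverse_def)
qed

text \<open>The left unit constraint is natural and invertible, so tensoring with the unit object is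
  faithful. This is the cancellation at the end of Kelly's argument.\<close>

lemma lw_Unit_inj:
  assumes "hom t xs ys" "hom s xs ys" "lw \<I> t = lw \<I> s"
  shows "t = s"
proof -
  have "t \<odot>\<odot> del xs = s \<odot>\<odot> del xs"
    using assms naturalD[OF natural_del assms(1)] naturalD[OF natural_del assms(2)] by simp
  then show ?thesis using iso_cancel_right[OF del_ins] assms homD by metis
qed

text \<open>Kelly's lemma: \<open>l (X \<otimes> Y) \<circ> a I X Y = l X \<otimes> Y\<close> follows from pentagon and triangle.\<close>

lemma emb_LUnit:
  assumes "X \<in> Ob M" "obs xs"
  shows "emb (\<I> \<odot> X) (\<l> X) X xs = del (X # xs) \<odot>\<odot> split \<I> X xs"
proof -
  let ?s1 = "split \<I> X xs" and ?s2 = "split \<I> (\<I> \<odot> X) xs" and ?s3 = "split \<I> \<I> (X # xs)" and ?s4 = "split (\<I> \<odot> \<I>) X xs"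
  let ?L = "emb (\<I> \<odot> X) (\<l> X) X xs"
  have h: "hom ?L ((\<I> \<odot> X) # xs) (X # xs)"
    "hom (lw \<I> ?L) (\<I> # (\<I> \<odot> X) # xs) (\<I> # X # xs)"
    "hom ?s1 ((\<I> \<odot> X) # xs) (\<I> # X # xs)"
    "hom (lw \<I> ?s1) (\<I> # (\<I> \<odot> X) # xs) (\<I> # \<I> # X # xs)"
    "hom (join \<I> X xs) (\<I> # X # xs) ((\<I> \<odot> X) # xs) "
    "hom ?s2 ((\<I> \<odot> (\<I> \<odot> X)) # xs) (\<I> # (\<I> \<odot> X) # xs)"
    "hom ?s3 ((\<I> \<odot> \<I>) # X # xs) (\<I> # \<I> # X # xs)"
    "hom ?s4 (((\<I> \<odot> \<I>) \<odot> X) # xs) ((\<I> \<odot> \<I>) # X # xs)"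
    "hom (del (X # xs)) (\<I> # X # xs) (X # xs)"
    "hom (lw \<I> (del (X # xs))) (\<I> # \<I> # X # xs) (\<I> # X # xs)"
    "hom (lw \<I> (join \<I> X xs)) (\<I> # \<I> # X # xs) (\<I> # (\<I> \<odot> X) # xs)"
    using assms by (auto intro!: hom_intros struct_Hom)
  have "(\<langle>\<I>\<rangle> \<boxtimes> \<l> X) \<in> Hom M (\<I> \<odot> (\<I> \<odot> X)) (\<I> \<odot> X)" "\<r> \<I> \<boxtimes> \<langle>X\<rangle> \<in> Hom M ((\<I> \<odot> \<I>) \<odot> X) (\<I> \<odot> X)"
    using assms by (auto intro!: TArr_in_Hom struct_Hom Ide_in_Hom)
  \<comment> \<open>The triangle for the unit object and \<open>X\<close>. Expanded into words, it
    contains the wanted equation whiskered by the unit object, up to invertible regroupings.\<close>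
  then have "emb (\<I> \<odot> (\<I> \<odot> X)) (\<langle>\<I>\<rangle> \<boxtimes> \<l> X) (\<I> \<odot> X) xs \<odot>\<odot> emb ((\<I> \<odot> \<I>) \<odot> X) (\<a> \<I> \<I> X) (\<I> \<odot> (\<I> \<odot> X)) xs
      = emb ((\<I> \<odot> \<I>) \<odot> X) (\<r> \<I> \<boxtimes> \<langle>X\<rangle>) (\<I> \<odot> X) xs"
    using assms by (simp add: emb_scomp[symmetric] struct_Hom triangle)
  then have "(join \<I> X xs \<odot>\<odot> lw \<I> ?L \<odot>\<odot> ?s2) \<odot>\<odot> join \<I> (\<I> \<odot> X) xs \<odot>\<odot> lw \<I> (join \<I> X xs) \<odot>\<odot> ?s3 \<odot>\<odot> ?s4
     = join \<I> X xs \<odot>\<odot> lw \<I> (del (X # xs)) \<odot>\<odot> ?s3 \<odot>\<odot> ?s4"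
    using assms
    by (simp add: emb_tensor emb_Assoc emb_RUnit emb_id Ide_in_Hom struct_Hom sid_scomp_ext[OF h(2)] scomp_assoc
        lw_sid sid_left[OF h(8)])
  then have "join \<I> X xs \<odot>\<odot> lw \<I> ?L \<odot>\<odot> lw \<I> (join \<I> X xs) \<odot>\<odot> ?s3 \<odot>\<odot> ?s4
     = join \<I> X xs \<odot>\<odot> lw \<I> (del (X # xs)) \<odot>\<odot> ?s3 \<odot>\<odot> ?s4"
    using assms by (simp add: scomp_assoc scomp_ext[OF split_join] sid_scomp_ext[OF h(11)])
  then have "split \<I> X xs \<odot>\<odot> join \<I> X xs \<odot>\<odot> (lw \<I> ?L \<odot>\<odot> lw \<I> (join \<I> X xs) \<odot>\<odot> ?s3 \<odot>\<odot> ?s4) \<odot>\<odot>  join (\<I> \<odot> \<I>) X xs \<odot>\<odot> join \<I> \<I> (X # xs)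
     = split \<I> X xs \<odot>\<odot> join \<I> X xs \<odot>\<odot> (lw \<I> (del (X # xs)) \<odot>\<odot> ?s3 \<odot>\<odot> ?s4) \<odot>\<odot>  join (\<I> \<odot> \<I>) X xs \<odot>\<odot> join \<I> \<I> (X # xs)"
    by (metis scomp_assoc)
  moreover have hj: "hom (join \<I> \<I> (X # xs)) (\<I> # \<I> # X # xs) ((\<I> \<odot> \<I>) # X # xs)"
    using assms by (auto intro!: hom_intros)
  ultimately have "lw \<I> ?L \<odot>\<odot> lw \<I> (join \<I> X xs) = lw \<I> (del (X # xs))"
    using assms
    by (simp add: scomp_assoc scomp_ext[OF split_join] sid_scomp_ext[OF h(2)] sid_scomp_ext[OF h(10)]
        split_join sid_right[OF h(10)] sid_right[OF h(11)] sid_left[OF h(10)] sid_left[OF hj])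
  then have "lw \<I> (?L \<odot>\<odot> join \<I> X xs) = lw \<I> (del (X # xs))" by (simp add: lw_scomp)
  then have "?L \<odot>\<odot> join \<I> X xs = del (X # xs)"
    using lw_Unit_inj hom_intros(2)[OF h(1,5)] h(9) by blast
  then show ?thesis using join_split[of \<I> X xs] sid_right[OF h(1)] assms by (metis scomp_assoc Unit_in_Ob)
qed

lemma sid_simps:
  "\<lbrakk>sarr t; scod t = ys\<rbrakk> \<Longrightarrow> sid ys \<odot>\<odot> t = t"
  "\<lbrakk>sarr t; scod t = ys\<rbrakk> \<Longrightarrow> sid ys \<odot>\<odot> t \<odot>\<odot> s = t \<odot>\<odot> s"
  "\<lbrakk>sarr t; sdom t = xs\<rbrakk> \<Longrightarrow> t \<odot>\<odot> sid xs = t"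
  by (metis hom_def sid_left, metis hom_def sid_scomp_ext, metis hom_def sid_right)

lemma lws_sid: "obs ws \<Longrightarrow> obs xs \<Longrightarrow> lws ws (sid xs) = sid (ws @ xs)"
  by (induction ws) (auto simp: lw_sid)

subsection \<open>Transfer to the strict calculus\<close>

text \<open>A packing of an object says which of its tensor factors are separate letters:
  \<open>A \<odot> A\<close>, say, may be read as one letter or as \<open>[A, A]\<close>.\<close>

type_synonym ('p, 'n) pack =
  "'p list \<times> ('p list \<Rightarrow> ('p, 'n) sarr) \<times> ('p list \<Rightarrow> ('p, 'n) sarr)"

definition packs :: "'o \<Rightarrow> ('o, 'm) pack \<Rightarrow> bool" where
  "packs X p \<longleftrightarrow> X \<in> Ob M \<and> (case p of (us, U, V) \<Rightarrow>
     natural U us [X] \<and> natural V [X] us \<and>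
     (\<forall>xs. obs xs \<longrightarrow> U xs \<odot>\<odot> V xs = sid (X # xs) \<and> V xs \<odot>\<odot> U xs = sid (us @ xs)))"

definition tip :: "'o \<Rightarrow> ('o, 'm) pack" where
  "tip X = ([X], \<lambda>xs. sid (X # xs), \<lambda>xs. sid (X # xs))"

text \<open>The unit object is packed as no letter at all, so that a unit becomes a diagram without
  input and a counit a diagram without output.\<close>

definition unitp :: "('o, 'm) pack" where
  "unitp = ([], ins, del)"

definition prodp :: "'o \<Rightarrow> ('o, 'm) pack \<Rightarrow> 'o \<Rightarrow> ('o, 'm) pack \<Rightarrow> ('o, 'm) pack" where
  "prodp X p Y q = (case p of (us, U, V) \<Rightarrow> case q of (us', U', V') \<Rightarrow>
     (us @ us', \<lambda>xs. join X Y xs \<odot>\<odot> U (Y # xs) \<odot>\<odot> lws us (U' xs),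
      \<lambda>xs. lws us (V' xs) \<odot>\<odot> V (Y # xs) \<odot>\<odot> split X Y xs))"

lemma packs_tip: "X \<in> Ob M \<Longrightarrow> packs X (tip X)"
  using natural_sid[of "[X]"] by (auto simp: packs_def tip_def sid_left[OF hom_intros(1)])

lemma packs_unitp: "packs \<I> unitp"
  by (auto simp: packs_def unitp_def natural_del natural_ins ins_del del_ins)

lemma packs_prodp:
  assumes "packs X p" "packs Y q" shows "packs (X \<odot> Y) (prodp X p Y q)"
proof -
  obtain us U V us' U' V' where pq: "p = (us, U, V)" "q = (us', U', V')" by (metis prod_cases3)
  have X: "X \<in> Ob M" "Y \<in> Ob M" "natural U us [X]" "natural V [X] us"  "natural U' us' [Y]" "natural V' [Y] us'"
    "\<And>xs. obs xs \<Longrightarrow> U xs \<odot>\<odot> V xs = sid (X # xs)" "\<And>xs. obs xs \<Longrightarrow> V xs \<odot>\<odot> U xs = sid (us @ xs)"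
    "\<And>xs. obs xs \<Longrightarrow> U' xs \<odot>\<odot> V' xs = sid (Y # xs)" "\<And>xs. obs xs \<Longrightarrow> V' xs \<odot>\<odot> U' xs = sid (us' @ xs)"
    using assms by (auto simp: packs_def pq)
  have us: "obs us" "obs us'" using X natural_obs by blast+
  have n1: "natural (\<lambda>xs. lws us (U' xs)) (us @ us') (us @ [Y])" "natural (\<lambda>xs. lws us (V' xs)) (us @ [Y]) (us @ us')"
    using natural_lws[OF us(1) X(5)] natural_lws[OF us(1) X(6)] .
  have n2: "natural (\<lambda>xs. U (Y # xs)) (us @ [Y]) [X, Y]" "natural (\<lambda>xs. V (Y # xs)) [X, Y] (us @ [Y])"
    using natural_Cons[OF X(2) X(3)] natural_Cons[OF X(2) X(4)] by simp_all
  have n3: "natural (\<lambda>xs. join X Y xs \<odot>\<odot> U (Y # xs) \<odot>\<odot> lws us (U' xs)) (us @ us') [X \<odot> Y]"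
     "natural (\<lambda>xs. lws us (V' xs) \<odot>\<odot> V (Y # xs) \<odot>\<odot> split X Y xs) [X \<odot> Y] (us @ us')"
    using natural_scomp[OF natural_scomp[OF n1(1) n2(1)] natural_join[OF X(1,2)]]
      natural_scomp[OF natural_scomp[OF natural_split[OF X(1,2)] n2(2)] n1(2)] by (simp_all add: scomp_assoc)
  have "join X Y xs \<odot>\<odot> U (Y # xs) \<odot>\<odot> lws us (U' xs) \<odot>\<odot> lws us (V' xs) \<odot>\<odot> V (Y # xs) \<odot>\<odot> split X Y xs = sid ((X \<odot> Y) # xs)"
    if "obs xs" for xs
  proof -
    have h: "hom (V (Y # xs)) ([X] @ Y # xs) (us @ Y # xs)" "hom (split X Y xs) ((X \<odot> Y) # xs) (X # Y # xs)"
      using X that by (auto intro!: natural_hom hom_intros simp del: append.simps)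
    have e: "lws us (U' xs) \<odot>\<odot> lws us (V' xs) = sid (us @ Y # xs)"
      using us that X by (simp add: lws_scomp[symmetric] lws_sid)
    have e': "U (Y # xs) \<odot>\<odot> V (Y # xs) = sid (X # Y # xs)" using X that by simp
    show ?thesis using X that
      by (simp add: scomp_ext[OF e] scomp_ext[OF e'] sid_scomp_ext[OF h(1)] sid_left[OF h(2)] join_split)
  qed
  moreover have "lws us (V' xs) \<odot>\<odot> V (Y # xs) \<odot>\<odot> split X Y xs \<odot>\<odot> join X Y xs \<odot>\<odot> U (Y # xs) \<odot>\<odot> lws us (U' xs) = sid (us @ us' @ xs)"
    if "obs xs" for xs
  proof -
    have h: "hom (U (Y # xs)) (us @ Y # xs) ([X] @ Y # xs)" "hom (lws us (U' xs)) (us @ us' @ xs) (us @ [Y] @ xs)"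
      using X that us by (auto intro!: natural_hom hom_lws hom_intros simp del: append.simps)
    have e: "lws us (V' xs) \<odot>\<odot> lws us (U' xs) = sid (us @ us' @ xs)"
      using us that X by (simp add: lws_scomp[symmetric] lws_sid)
    have e': "V (Y # xs) \<odot>\<odot> U (Y # xs) = sid (us @ Y # xs)" using X that by simp
    show ?thesis using X that
      by (simp add: scomp_ext[OF split_join] scomp_ext[OF e'] e sid_scomp_ext[OF h(1)[simplified]] sid_left[OF h(2)[simplified]])
  qed
  ultimately show ?thesis using n3 X us by (simp add: packs_def pq prodp_def scomp_assoc)
qed

definition strict :: "'o \<Rightarrow> ('o, 'm) pack \<Rightarrow> 'm \<Rightarrow> 'o \<Rightarrow> ('o, 'm) pack \<Rightarrow> 'o list \<Rightarrow> ('o, 'm) sarr" where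
  "strict X p f Y q xs = snd (snd q) xs \<odot>\<odot> emb X f Y xs \<odot>\<odot> fst (snd p) xs"

text \<open>A relation rather than an equation for \<open>F\<close>, so that \<open>F\<close> can
  stay schematic: applying the rules backwards computes the diagram from the shape of the arrow. The
  packings fix how source and target are read, and must match when arrows are composed.\<close>

definition srep :: "'m \<Rightarrow> 'o \<Rightarrow> ('o, 'm) pack \<Rightarrow> 'o \<Rightarrow> ('o, 'm) pack \<Rightarrow> ('o list \<Rightarrow> ('o, 'm) sarr) \<Rightarrow> bool" where
  "srep f X p Y q F \<longleftrightarrow> packs X p \<and> packs Y q \<and> f \<in> Hom M X Y \<and> (\<forall>xs. obs xs \<longrightarrow> strict X p f Y q xs = F xs)"

lemma natural_strict:
  assumes "packs X p" "packs Y q" "f \<in> Hom M X Y"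
  shows "natural (strict X p f Y q) (fst p) (fst q)"
proof -
  obtain us U V us' U' V' where pq: "p = (us, U, V)" "q = (us', U', V')" by (metis prod_cases3)
  have "natural U us [X]" "natural V' [Y] us'" "X \<in> Ob M" "Y \<in> Ob M" using assms by (auto simp: packs_def pq)
  then show ?thesis
    using natural_scomp[OF natural_scomp[OF _ natural_emb] , of U us X Y f V' us'] assms(3)
    by (simp add: pq strict_def[abs_def])
qed

lemma natural_cong: "\<lbrakk>natural F us vs; \<And>xs. obs xs \<Longrightarrow> F xs = G xs\<rbrakk> \<Longrightarrow> natural G us vs"
  by (auto simp: natural_def dest: sarrD) (metis sarrD)

lemma srep_natural: "srep f X p Y q F \<Longrightarrow> natural F (fst p) (fst q)"
  using natural_strict natural_cong unfolding srep_def by blast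

lemma srep_strict: "\<lbrakk>packs X p; packs Y q; f \<in> Hom M X Y\<rbrakk> \<Longrightarrow> srep f X p Y q (strict X p f Y q)"
  by (simp add: srep_def)

lemma srep_Comp:
  assumes "srep f X p Y q F" "srep g Y q Z r G" shows "srep (g \<cdot> f) X p Z r (\<lambda>xs. G xs \<odot>\<odot> F xs)"
proof -
  obtain us U V where q: "q = (us, U, V)" by (metis prod_cases3)
  have *: "packs Y q" "X \<in> Ob M" "Y \<in> Ob M" "Z \<in> Ob M" "f \<in> Hom M X Y" "g \<in> Hom M Y Z"
    using assms by (auto simp: srep_def packs_def)
  have "(snd (snd r) xs \<odot>\<odot> emb Y g Z xs \<odot>\<odot> U xs) \<odot>\<odot> V xs \<odot>\<odot> emb X f Y xs \<odot>\<odot> fst (snd p) xs =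
     snd (snd r) xs \<odot>\<odot> emb X (g \<cdot> f) Z xs \<odot>\<odot> fst (snd p) xs" if "obs xs" for xs
  proof -
    have uv: "U xs \<odot>\<odot> V xs = sid (Y # xs)" using * that by (auto simp: q packs_def)
    have h: "hom (emb X f Y xs) (X # xs) (Y # xs)" using * that by (auto intro!: hom_intros)
    show ?thesis by (simp add: emb_scomp[OF *(2-)] scomp_assoc scomp_ext[OF uv] sid_scomp_ext[OF h])
  qed
  then show ?thesis using assms *(2-) Comp_in_Hom[OF *(2-)] by (auto simp: srep_def strict_def q)
qed

text \<open>The order chosen for interchange: \<open>g\<close> acts first, with the source letters
  of \<open>f\<close> on its left; then \<open>f\<close> acts, with the target letters of
  \<open>g\<close> on its right.\<close>

lemma srep_TArr:
  assumes "srep f X p X' p' F" "srep g Y q Y' q' G"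
  shows "srep (f \<boxtimes> g) (X \<odot> Y) (prodp X p Y q) (X' \<odot> Y') (prodp X' p' Y' q')
    (\<lambda>xs. F (fst q' @ xs) \<odot>\<odot> lws (fst p) (G xs))"
proof -
  obtain us U V us' U' V' where p: "p = (us, U, V)" "p' = (us', U', V')" by (metis prod_cases3)
  obtain vs P Q vs' P' Q' where q: "q = (vs, P, Q)" "q' = (vs', P', Q')" by (metis prod_cases3)
  have *: "packs X p" "packs X' p'" "packs Y q" "packs Y' q'"  "X \<in> Ob M" "Y \<in> Ob M" "X' \<in> Ob M" "Y' \<in> Ob M"
    "f \<in> Hom M X X'" "g \<in> Hom M Y Y'"
    using assms by (auto simp: srep_def packs_def)
  have "strict (X \<odot> Y) (prodp X p Y q) (f \<boxtimes> g) (X' \<odot> Y') (prodp X' p' Y' q') xs = F (vs' @ xs) \<odot>\<odot> lws us (G xs)"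
    if xs: "obs xs" for xs
  proof -
    have F: "F (Y' # xs) = V' (Y' # xs) \<odot>\<odot> emb X f X' (Y' # xs) \<odot>\<odot> U (Y' # xs)"
      and G: "G xs = Q' xs \<odot>\<odot> emb Y g Y' xs \<odot>\<odot> P xs" using assms * xs by (auto simp: srep_def strict_def p q)
    have hg: "hom (emb Y g Y' xs) (Y # xs) (Y' # xs)" using * xs by (auto intro!: hom_intros)
    have hx: "hom (emb X f X' (Y' # xs)) (X # Y' # xs) (X' # Y' # xs)" using * xs by (auto intro!: hom_intros)
    have hlg: "hom (lw X (emb Y g Y' xs)) (X # Y # xs) (X # Y' # xs)" using * hg by (auto intro!: hom_intros)
    have n: "natural U us [X]" "natural Q' [Y'] vs'" using * by (auto simp: packs_def p q)
    have hQ: "hom (Q' xs) (Y' # xs) (vs' @ xs)" using natural_hom[OF n(2) xs] by simp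
    have hU: "hom (U (Y # xs)) (us @ Y # xs) (X # Y # xs)" using natural_hom[OF n(1), of "Y # xs"] * xs by simp
    \<comment> \<open>The packing of the first factor is natural, so \<open>g\<close> slides past
      it.\<close>
    have e1: "lw X (emb Y g Y' xs) \<odot>\<odot> U (Y # xs) \<odot>\<odot> t = U (Y' # xs) \<odot>\<odot> lws us (emb Y g Y' xs) \<odot>\<odot> t" for t
      using naturalD[OF n(1) hg] by (metis scomp_assoc foldr_Cons foldr_Nil comp_def id_def)
    have e2: "lws us' (Q' xs) \<odot>\<odot> F (Y' # xs) = F (vs' @ xs) \<odot>\<odot> lws us (Q' xs)"
      using naturalD[OF srep_natural[OF assms(1)] hQ] by (simp add: p)
    show ?thesis using * xs
      by (simp add: strict_def p q prodp_def emb_tensor scomp_assoc scomp_ext[OF split_join] sid_scomp_ext[OF hx]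
          sid_scomp_ext[OF hU] e1) (simp add: e2 scomp_assoc scomp_ext[OF e2] G lws_scomp F[symmetric] scomp_ext[OF F[symmetric], unfolded scomp_assoc])
  qed
  then show ?thesis using * by (auto simp: srep_def packs_prodp TArr_in_Hom p q)
qed

lemma srep_Ide: "packs X p \<Longrightarrow> srep \<langle>X\<rangle> X p X p (\<lambda>xs. sid (fst p @ xs))"
proof -
  assume p: "packs X p"
  obtain us U V where q: "p = (us, U, V)" by (metis prod_cases3)
  have "V xs \<odot>\<odot> emb X \<langle>X\<rangle> X xs \<odot>\<odot> U xs = sid (us @ xs)" if "obs xs" for xs
  proof -
    have "hom (U xs) (us @ xs) ([X] @ xs)" using p that by (auto simp: packs_def q intro!: natural_hom simp del: append.simps)
    then show ?thesis using p that by (auto simp: packs_def q emb_id sid_left)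
  qed
  then show ?thesis using p by (auto simp: srep_def packs_def q strict_def Ide_in_Hom)
qed

text \<open>Turns the statements on the associator and the unit constraints into those on their
  inverses.\<close>

lemma srep_inverse:
  assumes "srep f X p Y q (\<lambda>xs. sid (fst p @ xs))" "is_inverse M X Y f g"
  shows "srep g Y q X p (\<lambda>xs. sid (fst p @ xs))"
proof -
  obtain us U V us' U' V' where pq: "p = (us, U, V)" "q = (us', U', V')" by (metis prod_cases3)
  have *: "packs X p" "packs Y q" "X \<in> Ob M" "Y \<in> Ob M" "f \<in> Hom M X Y" "g \<in> Hom M Y X"
    using assms by (auto simp: srep_def packs_def is_inverse_def)
  note n = natural_hom[OF natural_strict[OF *(1,2,5)]] natural_hom[OF natural_strict[OF *(2,1,6)]]
  have "strict Y q g X p xs = sid (us @ xs)" if xs: "obs xs" for xs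
  proof -
    have f: "strict X p f Y q xs = sid (us @ xs)" using assms xs by (auto simp: srep_def pq)
    have us: "obs (us @ xs)" using n(1)[OF xs] homD by (metis pq fst_conv)
    \<comment> \<open>An identity diagram has equal source and target, so both packings use the same
      letters.\<close>
    have us': "us' @ xs = us @ xs"
      using n(1)[OF xs] homD(3)[OF hom_intros(1)[OF us]] homD(3) by (metis pq f fst_conv)
    have "strict Y q g X p xs \<odot>\<odot> strict X p f Y q xs = sid (us @ xs)"
    proof -
      have "srep (g \<cdot> f) X p X p (\<lambda>xs. strict Y q g X p xs \<odot>\<odot> strict X p f Y q xs)"
        by (rule srep_Comp[OF srep_strict[OF *(1,2,5)] srep_strict[OF *(2,1,6)]])
      then have "strict Y q g X p xs \<odot>\<odot> strict X p f Y q xs = strict X p (g \<cdot> f) X p xs" using xs by (simp add: srep_def)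
      also have "\<dots> = sid (us @ xs)"
        using srep_Ide[OF *(1)] assms(2) xs by (simp add: srep_def is_inverse_def pq)
      finally show ?thesis .
    qed
    then show ?thesis using f n(2)[OF xs] us' sid_right[of "strict Y q g X p xs"] by (simp add: pq)
  qed
  then show ?thesis using * by (auto simp: srep_def pq)
qed

text \<open>Both bracketings unpack to the same word, and \<open>emb_Assoc\<close> says that the
  associator merely regroups. With the lemmas on the unit constraints this is coherence in the form
  used below: constraints disappear from diagrams.\<close>

lemma srep_Assoc:
  assumes "packs X p" "packs Y q" "packs Z r"
  shows "srep (\<a> X Y Z) ((X \<odot> Y) \<odot> Z) (prodp (X \<odot> Y) (prodp X p Y q) Z r)
     (X \<odot> (Y \<odot> Z)) (prodp X p (Y \<odot> Z) (prodp Y q Z r)) (\<lambda>xs. sid (fst p @ fst q @ fst r @ xs))"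
proof -
  obtain us U V us' U' V' where pq: "p = (us, U, V)" "q = (us', U', V')" by (metis prod_cases3)
  obtain us'' U'' V'' where r: "r = (us'', U'', V'')" by (metis prod_cases3)
  let ?r = "prodp X p (Y \<odot> Z) (prodp Y q Z r)"
  have O: "X \<in> Ob M" "Y \<in> Ob M" "Z \<in> Ob M" using assms by (auto simp: packs_def)
  have R: "packs (X \<odot> (Y \<odot> Z)) ?r" using assms by (intro packs_prodp)
  have "emb ((X \<odot> Y) \<odot> Z) (\<a> X Y Z) (X \<odot> (Y \<odot> Z)) xs \<odot>\<odot>
    fst (snd (prodp (X \<odot> Y) (prodp X p Y q) Z r)) xs = fst (snd ?r) xs" if xs: "obs xs" for xs
  proof -
    have n: "natural U us [X]" "natural U' us' [Y]" using assms by (auto simp: packs_def pq)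
    have h: "hom (U (Y # Z # xs)) (us @ Y # Z # xs) ([X] @ Y # Z # xs)"
      "hom (join X Y (Z # xs)) (X # Y # Z # xs) ((X \<odot> Y) # Z # xs)"
      "hom (join Y Z xs) (Y # Z # xs) ((Y \<odot> Z) # xs)"
      using O xs n by (auto intro!: natural_hom hom_intros simp del: append.simps)
    have e: "lw X (join Y Z xs) \<odot>\<odot> U (Y # Z # xs) \<odot>\<odot> t = U ((Y \<odot> Z) # xs) \<odot>\<odot> lws us (join Y Z xs) \<odot>\<odot> t" for t
      using naturalD[OF n(1) h(3)] by (metis scomp_assoc foldr_Cons foldr_Nil comp_def id_def)
    show ?thesis using O xs
      by (simp add: prodp_def pq r emb_Assoc scomp_assoc scomp_ext[OF split_join]
          sid_scomp_ext[OF h(1)[simplified]] sid_scomp_ext[OF h(2)] e lws_scomp)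
  qed
  moreover have "snd (snd ?r) xs \<odot>\<odot> fst (snd ?r) xs = sid (us @ us' @ us'' @ xs)" if "obs xs" for xs
    using R that by (auto simp: packs_def prodp_def pq r)
  ultimately show ?thesis using assms O R
    by (simp add: srep_def strict_def packs_prodp struct_Hom pq r)
qed

lemma srep_LUnit: "packs X p \<Longrightarrow> srep (\<l> X) (\<I> \<odot> X) (prodp \<I> unitp X p) X p (\<lambda>xs. sid (fst p @ xs))"
proof -
  assume p: "packs X p"
  obtain us U V where q: "p = (us, U, V)" by (metis prod_cases3)
  have O: "X \<in> Ob M" using p by (auto simp: packs_def)
  have "V xs \<odot>\<odot> emb (\<I> \<odot> X) (\<l> X) X xs \<odot>\<odot> fst (snd (prodp \<I> unitp X p)) xs = sid (us @ xs)" if "obs xs" for xs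
  proof -
    have h: "hom (U xs) (us @ xs) ([X] @ xs)" "hom (ins (X # xs)) (X # xs) (\<I> # X # xs)"
      using p that O by (auto simp: packs_def q intro!: natural_hom hom_intros simp del: append.simps)
    then show ?thesis using p that O
      by (simp add: packs_def q prodp_def unitp_def emb_LUnit scomp_assoc scomp_ext[OF split_join] scomp_ext[OF del_ins]
       sid_scomp_ext[OF h(2)] sid_left[OF h(1)[simplified]])
  qed
  then show ?thesis using p O by (auto simp: srep_def packs_prodp packs_unitp q strict_def struct_Hom)
qed

lemma srep_RUnit: "packs X p \<Longrightarrow> srep (\<r> X) (X \<odot> \<I>) (prodp X p \<I> unitp) X p (\<lambda>xs. sid (fst p @ xs))"
proof -
  assume p: "packs X p"
  obtain us U V where q: "p = (us, U, V)" by (metis prod_cases3)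
  have O: "X \<in> Ob M" using p by (auto simp: packs_def)
  have "V xs \<odot>\<odot> emb (X \<odot> \<I>) (\<r> X) X xs \<odot>\<odot> fst (snd (prodp X p \<I> unitp)) xs = sid (us @ xs)" if xs: "obs xs" for xs
  proof -
    have n: "natural U us [X]" "obs us" using p natural_obs by (auto simp: packs_def q)
    have h: "hom (U (\<I> # xs)) (us @ \<I> # xs) ([X] @ \<I> # xs)" "hom (del xs) (\<I> # xs) xs" "hom (U xs) (us @ xs) ([X] @ xs)"
      using n that O by (auto intro!: natural_hom hom_intros simp del: append.simps)
    have e: "lw X (del xs) \<odot>\<odot> U (\<I> # xs) \<odot>\<odot> t = U xs \<odot>\<odot> lws us (del xs) \<odot>\<odot> t" for t
      using naturalD[OF n(1) h(2)] by (metis scomp_assoc foldr_Cons foldr_Nil comp_def id_def)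
    have d: "lws us (del xs) \<odot>\<odot> lws us (ins xs) = sid (us @ xs)"
      using n xs by (simp add: lws_scomp[symmetric] del_ins lws_sid)
    show ?thesis using p that O
      by (simp add: packs_def q prodp_def unitp_def emb_RUnit scomp_assoc scomp_ext[OF split_join]
       sid_scomp_ext[OF h(1)[simplified]] e d sid_right[OF h(3)])
  qed
  then show ?thesis using p O by (auto simp: srep_def packs_prodp packs_unitp q strict_def struct_Hom)
qed

lemma srep_Assoc_inv: "\<lbrakk>packs X p; packs Y q; packs Z r\<rbrakk> \<Longrightarrow>
    srep (\<a>\<inverse> X Y Z) (X \<odot> (Y \<odot> Z)) (prodp X p (Y \<odot> Z) (prodp Y q Z r))
      ((X \<odot> Y) \<odot> Z) (prodp (X \<odot> Y) (prodp X p Y q) Z r) (\<lambda>xs. sid (fst p @ fst q @ fst r @ xs))"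
  using srep_inverse[of "\<a> X Y Z" "(X \<odot> Y) \<odot> Z" "prodp (X \<odot> Y) (prodp X p Y q) Z r"
      "X \<odot> (Y \<odot> Z)" "prodp X p (Y \<odot> Z) (prodp Y q Z r)" "\<a>\<inverse> X Y Z"] srep_Assoc[of X p Y q Z r] a_inv[of X Y Z]
  by (simp add: packs_def prodp_def split_beta)

lemma srep_LUnit_inv: "packs X p \<Longrightarrow> srep (\<l>\<inverse> X) X p (\<I> \<odot> X) (prodp \<I> unitp X p) (\<lambda>xs. sid (fst p @ xs))"
  using srep_inverse[of "\<l> X" "\<I> \<odot> X" "prodp \<I> unitp X p" X p "\<l>\<inverse> X"] srep_LUnit[of X p] l_inv[of X]
  by (simp add: packs_def prodp_def unitp_def split_beta)

lemma srep_RUnit_inv: "packs X p \<Longrightarrow> srep (\<r>\<inverse> X) X p (X \<odot> \<I>) (prodp X p \<I> unitp) (\<lambda>xs. sid (fst p @ xs))"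
  using srep_inverse[of "\<r> X" "X \<odot> \<I>" "prodp X p \<I> unitp" X p "\<r>\<inverse> X"] srep_RUnit[of X p] r_inv[of X]
  by (simp add: packs_def prodp_def unitp_def split_beta)

lemma emb_strict:
  assumes "packs X p" "packs Y q" "f \<in> Hom M X Y" "obs xs"
  shows "emb X f Y xs = fst (snd q) xs \<odot>\<odot> strict X p f Y q xs \<odot>\<odot> snd (snd p) xs"
proof -
  obtain us U V us' U' V' where pq: "p = (us, U, V)" "q = (us', U', V')" by (metis prod_cases3)
  have h: "hom (emb X f Y xs) (X # xs) (Y # xs)" using assms by (auto intro: hom_intros simp: packs_def)
  have uv: "U xs \<odot>\<odot> V xs = sid (X # xs)" "U' xs \<odot>\<odot> V' xs = sid (Y # xs)"
    using assms by (auto simp: packs_def pq)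
  show ?thesis
    by (simp add: pq strict_def scomp_assoc scomp_ext[OF uv(2)] sid_scomp_ext[OF h] uv(1) sid_left[OF h] sid_right[OF h])
qed

text \<open>An arrow is its diagram conjugated by invertible packings, so the two determine each
  other. All axioms pass through this equivalence, hypotheses from left to right and conclusions
  from right to left.\<close>

lemma srep_eq:
  assumes "srep f X p Y q F" "srep g X p Y q G"
  shows "f = g \<longleftrightarrow> (\<forall>xs. obs xs \<longrightarrow> F xs = G xs)"
proof
  assume *: "\<forall>xs. obs xs \<longrightarrow> F xs = G xs"
  show "f = g"
    by (rule emb_inj[of X Y])
      (use assms * emb_strict[of X p Y q f "[]"] emb_strict[of X p Y q g "[]"] in \<open>auto simp: srep_def packs_def\<close>)
qed (use assms in \<open>auto simp: srep_def\<close>)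

lemma srep_cong: "srep f X p Y q F \<Longrightarrow> (\<And>xs. obs xs \<Longrightarrow> F xs = G xs) \<Longrightarrow> srep f X p Y q G"
  by (simp add: srep_def)

lemma srep_Hom: "srep f X p Y q F \<Longrightarrow> f \<in> Hom M X Y"
  by (simp add: srep_def)

lemmas packs_intros = packs_unitp packs_prodp packs_tip

lemmas srep_intros = srep_Comp srep_TArr srep_Ide srep_Assoc srep_Assoc_inv srep_LUnit srep_RUnit
  srep_LUnit_inv srep_RUnit_inv

lemma natural_simps:
  "\<lbrakk>natural F us vs; obs xs\<rbrakk> \<Longrightarrow> sarr (F xs)"
  "\<lbrakk>natural F us vs; obs xs\<rbrakk> \<Longrightarrow> sdom (F xs) = us @ xs"
  "\<lbrakk>natural F us vs; obs xs\<rbrakk> \<Longrightarrow> scod (F xs) = vs @ xs"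
  using natural_hom homD by blast+

text \<open>\<open>lw_scomp\<close> pushes whiskering inwards onto single factors, so a rule about a
  composite has to be restated for the whiskered factors.\<close>

lemma lw_cong_scomp: "t \<odot>\<odot> s = r \<Longrightarrow> lw X t \<odot>\<odot> lw X s = lw X r"
  by (metis lw_scomp)

lemma naturalD': "\<lbrakk>natural F us vs; sarr t; scod t = ys\<rbrakk> \<Longrightarrow> F ys \<odot>\<odot> lws us t = lws vs t \<odot>\<odot> F (sdom t)"
  using naturalD hom_def by blast

lemma sid_sarr: "obs xs \<Longrightarrow> sarr (sid xs)" "obs xs \<Longrightarrow> sdom (sid xs) = xs" "obs xs \<Longrightarrow> scod (sid xs) = xs"
  using hom_intros(1) homD by blast+

lemmas str_simps = scomp_assoc sarr_lw sid_simps sid_sarr lw_scomp lw_sid sarr_scomp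

lemma fst_pack [simp]: "fst (tip X) = [X]" "fst unitp = []" "fst (prodp X p Y q) = fst p @ fst q"
  by (auto simp: tip_def unitp_def prodp_def split_beta)

text \<open>All constraints are identity diagrams; in particular the two unit constraints agree at
  the unit object.\<close>

lemma unit_algebra: "algebra M \<I> (Unit_mult M) \<langle>\<I>\<rangle>"
proof -
  have 1: "\<l> \<I> \<cdot> (\<l> \<I> \<boxtimes> \<langle>\<I>\<rangle>) = \<l> \<I> \<cdot> (\<langle>\<I>\<rangle> \<boxtimes> \<l> \<I>) \<cdot> \<a> \<I> \<I> \<I>"
    by (subst srep_eq, (rule srep_intros packs_intros)+, simp add: str_simps cong: conj_cong)
  have 2: "\<l> \<I> \<cdot> (\<langle>\<I>\<rangle> \<boxtimes> \<langle>\<I>\<rangle>) = \<l> \<I>"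
    by (subst srep_eq, (rule srep_intros packs_intros)+, simp add: str_simps cong: conj_cong)
  have 3: "\<l> \<I> \<cdot> (\<langle>\<I>\<rangle> \<boxtimes> \<langle>\<I>\<rangle>) = \<r> \<I>"
    by (subst srep_eq, (rule srep_intros packs_intros)+, simp add: str_simps cong: conj_cong)
  show ?thesis using 1 2 3 by (simp add: algebra_def Unit_mult_def Ide_in_Hom struct_Hom)
qed

end

subsection \<open>Braided algebras\<close>

locale braided_alg = monoidal_category M for M :: "('o, 'm, 'z) moncat_scheme" (structure) +
  fixes A :: 'o and m u c :: 'm
  assumes braided_alg: "braided_algebra M A m u c"
begin

abbreviation "pA \<equiv> tip A"
abbreviation "pAA \<equiv> prodp A (tip A) A (tip A)"

section \<open>The axioms of a braided algebra as equations of diagrams\<close>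

definition "ms = strict (A \<odot> A) pAA m A pA"
definition "us = strict \<I> unitp u A pA"
definition "cs = strict (A \<odot> A) pAA c (A \<odot> A) pAA"

lemma A_Ob [simp]: "A \<in> Ob M"
  and m_Hom: "m \<in> Hom M (A \<odot> A) A" and u_Hom: "u \<in> Hom M \<I> A" and c_Hom: "c \<in> Hom M (A \<odot> A) (A \<odot> A)"
  using braided_alg
  by (auto simp: braided_algebra_def algebra_def braided_object_def invertible_arr_def is_inverse_def)

lemma srep_m: "srep m (A \<odot> A) pAA A pA ms"
  and srep_u: "srep u \<I> unitp A pA us"
  and srep_c: "srep c (A \<odot> A) pAA (A \<odot> A) pAA cs"
  unfolding ms_def us_def cs_def by (auto intro!: srep_strict packs_intros m_Hom u_Hom c_Hom)

lemma natural_ms: "natural ms [A, A] [A]"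
  and natural_us: "natural us [] [A]"
  and natural_cs: "natural cs [A, A] [A, A]"
  using srep_natural[OF srep_m] srep_natural[OF srep_u] srep_natural[OF srep_c] by simp_all

lemmas nsimps = natural_simps[OF natural_ms, simplified] natural_simps[OF natural_us, simplified]
   natural_simps[OF natural_cs, simplified]
lemmas ssimps = nsimps str_simps

lemmas sreps = srep_m srep_u srep_c

lemma ms_assoc: "obs xs \<Longrightarrow> ms xs \<odot>\<odot> ms (A # xs) = ms xs \<odot>\<odot> lw A (ms xs)"
proof -
  have "m \<cdot> (m \<boxtimes> \<langle>A\<rangle>) = m \<cdot> (\<langle>A\<rangle> \<boxtimes> m) \<cdot> \<a> A A A \<longleftrightarrow>
     (\<forall>xs. obs xs \<longrightarrow> ms xs \<odot>\<odot> ms (A # xs) = ms xs \<odot>\<odot> lw A (ms xs))"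
    \<comment> \<open>The rules build the diagrams of both sides from the shape of the arrows,
      leaving one identity for each constraint; the simplifier deletes these.\<close>
    by (rule trans[OF srep_eq], (rule sreps srep_intros packs_intros A_Ob)+, simp add: ssimps cong: conj_cong)
  then show "obs xs \<Longrightarrow> ?thesis" using braided_alg by (auto simp: braided_algebra_def algebra_def)
qed

lemma ms_us_left: "obs xs \<Longrightarrow> ms xs \<odot>\<odot> us (A # xs) = sid (A # xs)"
proof -
  have "m \<cdot> (u \<boxtimes> \<langle>A\<rangle>) = \<l> A \<longleftrightarrow> (\<forall>xs. obs xs \<longrightarrow> ms xs \<odot>\<odot> us (A # xs) = sid (A # xs))"
    by (rule trans[OF srep_eq], (rule sreps srep_intros packs_intros A_Ob)+, simp add: ssimps cong: conj_cong)
  then show "obs xs \<Longrightarrow> ?thesis" using braided_alg by (auto simp: braided_algebra_def algebra_def)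
qed

lemma ms_us_right: "obs xs \<Longrightarrow> ms xs \<odot>\<odot> lw A (us xs) = sid (A # xs)"
proof -
  have "m \<cdot> (\<langle>A\<rangle> \<boxtimes> u) = \<r> A \<longleftrightarrow> (\<forall>xs. obs xs \<longrightarrow> ms xs \<odot>\<odot> lw A (us xs) = sid (A # xs))"
    by (rule trans[OF srep_eq], (rule sreps srep_intros packs_intros A_Ob)+, simp add: ssimps cong: conj_cong)
  then show "obs xs \<Longrightarrow> ?thesis" using braided_alg by (auto simp: braided_algebra_def algebra_def)
qed

lemma cs_YB: "obs xs \<Longrightarrow> cs (A # xs) \<odot>\<odot> lw A (cs xs) \<odot>\<odot> cs (A # xs) = lw A (cs xs) \<odot>\<odot> cs (A # xs) \<odot>\<odot> lw A (cs xs)"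
proof -
  have "(c \<boxtimes> \<langle>A\<rangle>) \<cdot> \<a>\<inverse> A A A \<cdot> (\<langle>A\<rangle> \<boxtimes> c) \<cdot> \<a> A A A \<cdot> (c \<boxtimes> \<langle>A\<rangle>) = \<a>\<inverse> A A A \<cdot> (\<langle>A\<rangle> \<boxtimes> c) \<cdot> \<a> A A A \<cdot> (c \<boxtimes> \<langle>A\<rangle>) \<cdot> \<a>\<inverse> A A A \<cdot> (\<langle>A\<rangle> \<boxtimes> c) \<cdot> \<a> A A A \<longleftrightarrow> (\<forall>xs. obs xs \<longrightarrow> cs (A # xs) \<odot>\<odot> lw A (cs xs) \<odot>\<odot> cs (A # xs) = lw A (cs xs) \<odot>\<odot> cs (A # xs) \<odot>\<odot> lw A (cs xs))"
    by (rule trans[OF srep_eq], (rule sreps srep_intros packs_intros A_Ob)+, simp add: ssimps cong: conj_cong)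
  then show "obs xs \<Longrightarrow> ?thesis" using braided_alg by (auto simp: braided_algebra_def braided_object_def)
qed

lemma cs_ms_left: "obs xs \<Longrightarrow> cs xs \<odot>\<odot> ms (A # xs) = lw A (ms xs) \<odot>\<odot> cs (A # xs) \<odot>\<odot> lw A (cs xs)"
proof -
  have "c \<cdot> (m \<boxtimes> \<langle>A\<rangle>) = (\<langle>A\<rangle> \<boxtimes> m) \<cdot> \<a> A A A \<cdot> (c \<boxtimes> \<langle>A\<rangle>) \<cdot> \<a>\<inverse> A A A \<cdot> (\<langle>A\<rangle> \<boxtimes> c) \<cdot> \<a> A A A \<longleftrightarrow> (\<forall>xs. obs xs \<longrightarrow> cs xs \<odot>\<odot> ms (A # xs) = lw A (ms xs) \<odot>\<odot> cs (A # xs) \<odot>\<odot> lw A (cs xs))"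
    by (rule trans[OF srep_eq], (rule sreps srep_intros packs_intros A_Ob)+, simp add: ssimps cong: conj_cong)
  then show "obs xs \<Longrightarrow> ?thesis" using braided_alg by (auto simp: braided_algebra_def)
qed

lemma cs_ms_right: "obs xs \<Longrightarrow> cs xs \<odot>\<odot> lw A (ms xs) = ms (A # xs) \<odot>\<odot> lw A (cs xs) \<odot>\<odot> cs (A # xs)"
proof -
  have "c \<cdot> (\<langle>A\<rangle> \<boxtimes> m) = (m \<boxtimes> \<langle>A\<rangle>) \<cdot> \<a>\<inverse> A A A \<cdot> (\<langle>A\<rangle> \<boxtimes> c) \<cdot> \<a> A A A \<cdot> (c \<boxtimes> \<langle>A\<rangle>) \<cdot> \<a>\<inverse> A A A \<longleftrightarrow> (\<forall>xs. obs xs \<longrightarrow> cs xs \<odot>\<odot> lw A (ms xs) = ms (A # xs) \<odot>\<odot> lw A (cs xs) \<odot>\<odot> cs (A # xs))"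
    by (rule trans[OF srep_eq], (rule sreps srep_intros packs_intros A_Ob)+, simp add: ssimps cong: conj_cong)
  then show "obs xs \<Longrightarrow> ?thesis" using braided_alg by (auto simp: braided_algebra_def)
qed

lemma cs_us_left: "obs xs \<Longrightarrow> cs xs \<odot>\<odot> us (A # xs) = lw A (us xs)"
proof -
  have "c \<cdot> (u \<boxtimes> \<langle>A\<rangle>) \<cdot> \<l>\<inverse> A = (\<langle>A\<rangle> \<boxtimes> u) \<cdot> \<r>\<inverse> A \<longleftrightarrow> (\<forall>xs. obs xs \<longrightarrow> cs xs \<odot>\<odot> us (A # xs) = lw A (us xs))"
    by (rule trans[OF srep_eq], (rule sreps srep_intros packs_intros A_Ob)+, simp add: ssimps cong: conj_cong)
  then show "obs xs \<Longrightarrow> ?thesis" using braided_alg by (auto simp: braided_algebra_def)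
qed

lemma cs_us_right: "obs xs \<Longrightarrow> cs xs \<odot>\<odot> lw A (us xs) = us (A # xs)"
proof -
  have "c \<cdot> (\<langle>A\<rangle> \<boxtimes> u) \<cdot> \<r>\<inverse> A = (u \<boxtimes> \<langle>A\<rangle>) \<cdot> \<l>\<inverse> A \<longleftrightarrow> (\<forall>xs. obs xs \<longrightarrow> cs xs \<odot>\<odot> lw A (us xs) = us (A # xs))"
    by (rule trans[OF srep_eq], (rule sreps srep_intros packs_intros A_Ob)+, simp add: ssimps cong: conj_cong)
  then show "obs xs \<Longrightarrow> ?thesis" using braided_alg by (auto simp: braided_algebra_def)
qed

lemma lw_ms: "\<lbrakk>sarr t; sdom t = xs\<rbrakk> \<Longrightarrow> lw A t \<odot>\<odot> ms xs = ms (scod t) \<odot>\<odot> lw A (lw A t)"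
  using naturalD'[OF natural_ms, of t] by simp

lemma lw_us: "\<lbrakk>sarr t; sdom t = xs\<rbrakk> \<Longrightarrow> lw A t \<odot>\<odot> us xs = us (scod t) \<odot>\<odot> t"
  using naturalD'[OF natural_us, of t] by simp

text \<open>With \<open>cs_lw\<close>, one interchange law in both directions. As a rewrite rule it
  may be used in only one direction for a given kind of \<open>t\<close>, and this is decided where
  the rule sets are assembled.\<close>

lemma lw_cs: "\<lbrakk>sarr t; sdom t = xs\<rbrakk> \<Longrightarrow> lw A (lw A t) \<odot>\<odot> cs xs = cs (scod t) \<odot>\<odot> lw A (lw A t)"
  using naturalD'[OF natural_cs, of t] by simp

lemma cs_lw: "\<lbrakk>sarr t; scod t = ys\<rbrakk> \<Longrightarrow> cs ys \<odot>\<odot> lw A (lw A t) = lw A (lw A t) \<odot>\<odot> cs (sdom t)"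
  using naturalD'[OF natural_cs, of t] by simp

text \<open>A terminating rewrite system for diagrams: multiplications move to the left of crossings, units
  cancel, and crossings or multiplications far apart are sorted. The rules are closed under left
  whiskering and under composition with a tail.\<close>

lemmas diagram0 = ms_assoc ms_us_left ms_us_right cs_ms_left cs_ms_right cs_us_left cs_us_right
  lw_ms lw_us
  lw_cs[where t = "cs xs" for xs] lw_cs[where t = "lw A (cs xs)" for xs] lw_cs[where t = "lw A (lw A (cs xs))" for xs]
  cs_lw[where t = "ms xs" for xs] cs_lw[where t = "lw A (ms xs)" for xs] cs_lw[where t = "lw A (lw A (ms xs))" for xs]

lemmas diagram1 = diagram0 diagram0[THEN lw_cong_scomp]
lemmas diagram2 = diagram1 diagram1[THEN lw_cong_scomp, THEN lw_cong_scomp]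
lemmas diagram = diagram2 diagram2[THEN scomp_ext]

section \<open>The algebra on the tensor square\<close>

definition "ms2 xs = ms (A # xs) \<odot>\<odot> lw A (lw A (ms xs)) \<odot>\<odot> lw A (cs (A # xs))"
definition "us2 xs = us (A # xs) \<odot>\<odot> us xs"

abbreviation "m2 \<equiv> (m \<boxtimes> m) \<cdot> mid_braiding M A c"
abbreviation "u2 \<equiv> (u \<boxtimes> u) \<cdot> Unit_comult M"

lemma srep_m2: "srep m2 ((A \<odot> A) \<odot> (A \<odot> A)) (prodp (A \<odot> A) pAA (A \<odot> A) pAA) (A \<odot> A) pAA ms2"
  unfolding mid_braiding_def
  by (rule srep_cong, (rule sreps srep_intros packs_intros A_Ob)+, simp add: ssimps ms2_def cong: conj_cong)

lemma srep_u2: "srep u2 \<I> unitp (A \<odot> A) pAA us2"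
  unfolding Unit_comult_def
  by (rule srep_cong, (rule sreps srep_intros packs_intros A_Ob)+, simp add: ssimps us2_def cong: conj_cong)

text \<open>For associativity, the braided algebra axioms pull the crossings in front of all
  multiplications. Of the six strands, 2-3, 4-5 and then 3-4 cross on either side; only the order of
  the first two crossings differs, and these are far apart.\<close>

lemma tensor_square_algebra: "algebra M (A \<odot> A) m2 u2"
proof -
  note sreps2 = srep_m2 srep_u2
  have 1: "m2 \<cdot> (m2 \<boxtimes> \<langle>A \<odot> A\<rangle>) = m2 \<cdot> (\<langle>A \<odot> A\<rangle> \<boxtimes> m2) \<cdot> \<a> (A \<odot> A) (A \<odot> A) (A \<odot> A)"
    by (subst srep_eq, (rule sreps2 srep_intros packs_intros A_Ob)+, simp add: ssimps ms2_def diagram cong: conj_cong)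
  have 2: "m2 \<cdot> (u2 \<boxtimes> \<langle>A \<odot> A\<rangle>) = \<l> (A \<odot> A)"
    by (subst srep_eq, (rule sreps2 srep_intros packs_intros A_Ob)+, simp add: ssimps ms2_def us2_def diagram cong: conj_cong)
  have 3: "m2 \<cdot> (\<langle>A \<odot> A\<rangle> \<boxtimes> u2) = \<r> (A \<odot> A)"
    by (subst srep_eq, (rule sreps2 srep_intros packs_intros A_Ob)+, simp add: ssimps ms2_def us2_def diagram cong: conj_cong)
  show ?thesis
    unfolding algebra_def using 1 2 3 srep_Hom[OF srep_m2] srep_Hom[OF srep_u2] by simp
qed

end

subsection \<open>Sums, zeros and joint epimorphisms\<close>

locale additive_tensor = preadditive_monoidal_category M
  for M :: "('o, 'm, 'z) premoncat_scheme" (structure) +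
  assumes tensor_functors: "\<forall>X\<in>Ob M. \<forall>F\<in>{left_tensor_functor M X, right_tensor_functor M X}.
    additive_functor M M F \<and> preserves_denumerable_coproducts M M F"
begin

lemma TArr_Add:
  assumes "X \<in> Ob M" "Y \<in> Ob M" "Z \<in> Ob M" "f \<in> Hom M Y Z" "g \<in> Hom M Y Z"
  shows "\<langle>X\<rangle> \<boxtimes> (f \<^bold>+ g) = \<langle>X\<rangle> \<boxtimes> f \<^bold>+ \<langle>X\<rangle> \<boxtimes> g" "(f \<^bold>+ g) \<boxtimes> \<langle>X\<rangle> = f \<boxtimes> \<langle>X\<rangle> \<^bold>+ g \<boxtimes> \<langle>X\<rangle>"
proof -
  have "additive_functor M M (left_tensor_functor M X)" "additive_functor M M (right_tensor_functor M X)"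
    using tensor_functors assms by auto
  then have "\<forall>Y\<in>Ob M. \<forall>Z\<in>Ob M. \<forall>f\<in>Hom M Y Z. \<forall>g\<in>Hom M Y Z. \<langle>X\<rangle> \<boxtimes> (f \<^bold>+ g) = \<langle>X\<rangle> \<boxtimes> f \<^bold>+ \<langle>X\<rangle> \<boxtimes> g"
    "\<forall>Y\<in>Ob M. \<forall>Z\<in>Ob M. \<forall>f\<in>Hom M Y Z. \<forall>g\<in>Hom M Y Z. (f \<^bold>+ g) \<boxtimes> \<langle>X\<rangle> = f \<boxtimes> \<langle>X\<rangle> \<^bold>+ g \<boxtimes> \<langle>X\<rangle>"
    by (simp_all add: additive_functor_def left_tensor_functor_def right_tensor_functor_def)
  then show "\<langle>X\<rangle> \<boxtimes> (f \<^bold>+ g) = \<langle>X\<rangle> \<boxtimes> f \<^bold>+ \<langle>X\<rangle> \<boxtimes> g" "(f \<^bold>+ g) \<boxtimes> \<langle>X\<rangle> = f \<boxtimes> \<langle>X\<rangle> \<^bold>+ g \<boxtimes> \<langle>X\<rangle>"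
    using assms by simp_all
qed

lemma Zero_Hom: "X \<in> Ob M \<Longrightarrow> Y \<in> Ob M \<Longrightarrow> \<^bold>0 X Y \<in> Hom M X Y"
  and Add_Hom: "\<lbrakk>X \<in> Ob M; Y \<in> Ob M; f \<in> Hom M X Y; g \<in> Hom M X Y\<rbrakk> \<Longrightarrow> f \<^bold>+ g \<in> Hom M X Y"
  and Zero_Add: "\<lbrakk>X \<in> Ob M; Y \<in> Ob M; f \<in> Hom M X Y\<rbrakk> \<Longrightarrow> \<^bold>0 X Y \<^bold>+ f = f"
  and Add_Zero: "\<lbrakk>X \<in> Ob M; Y \<in> Ob M; f \<in> Hom M X Y\<rbrakk> \<Longrightarrow> f \<^bold>+ \<^bold>0 X Y = f"
  and Add_assoc: "\<lbrakk>X \<in> Ob M; Y \<in> Ob M; f \<in> Hom M X Y; g \<in> Hom M X Y; h \<in> Hom M X Y\<rbrakk>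
      \<Longrightarrow> (f \<^bold>+ g) \<^bold>+ h = f \<^bold>+ (g \<^bold>+ h)"
proof -
  fix X Y assume O: "X \<in> Ob M" "Y \<in> Ob M"
  interpret comm_group "\<lparr>carrier = Hom M X Y, monoid.mult = (\<^bold>+), one = \<^bold>0 X Y\<rparr>"
    using O by (rule Hom_comm_group)
  show "\<^bold>0 X Y \<in> Hom M X Y" using one_closed by simp
  show "f \<in> Hom M X Y \<Longrightarrow> g \<in> Hom M X Y \<Longrightarrow> f \<^bold>+ g \<in> Hom M X Y" for f g using m_closed by simp
  show "f \<in> Hom M X Y \<Longrightarrow> \<^bold>0 X Y \<^bold>+ f = f" for f using l_one by simp
  show "f \<in> Hom M X Y \<Longrightarrow> f \<^bold>+ \<^bold>0 X Y = f" for f using r_one by simp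
  show "\<lbrakk>f \<in> Hom M X Y; g \<in> Hom M X Y; h \<in> Hom M X Y\<rbrakk> \<Longrightarrow> (f \<^bold>+ g) \<^bold>+ h = f \<^bold>+ (g \<^bold>+ h)" for f g h
    using m_assoc by simp
qed

text \<open>Cancellation in the group of arrows. Preservation of zero by composition and by the
  tensor functors is deduced from additivity in this way.\<close>

lemma idem_Zero:
  assumes "X \<in> Ob M" "Y \<in> Ob M" "f \<in> Hom M X Y" "f \<^bold>+ f = f" shows "f = \<^bold>0 X Y"
proof -
  interpret comm_group "\<lparr>carrier = Hom M X Y, monoid.mult = (\<^bold>+), one = \<^bold>0 X Y\<rparr>"
    using assms by (intro Hom_comm_group)
  show ?thesis using l_cancel_one[of f f] assms by simp
qed

lemma Comp_Zero:
  assumes "X \<in> Ob M" "Y \<in> Ob M" "Z \<in> Ob M" "f \<in> Hom M Y Z"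
  shows "f \<cdot> \<^bold>0 X Y = \<^bold>0 X Z"
proof (rule idem_Zero)
  show "f \<cdot> \<^bold>0 X Y \<^bold>+ f \<cdot> \<^bold>0 X Y = f \<cdot> \<^bold>0 X Y"
    using assms Comp_Add[of X Y Z "\<^bold>0 X Y" "\<^bold>0 X Y" f] by (simp add: Zero_Add Zero_Hom)
qed (use assms Comp_in_Hom Zero_Hom in blast)+

lemma Zero_Comp:
  assumes "X \<in> Ob M" "Y \<in> Ob M" "Z \<in> Ob M" "f \<in> Hom M X Y"
  shows "\<^bold>0 Y Z \<cdot> f = \<^bold>0 X Z"
proof (rule idem_Zero)
  show "\<^bold>0 Y Z \<cdot> f \<^bold>+ \<^bold>0 Y Z \<cdot> f = \<^bold>0 Y Z \<cdot> f"
    using assms Add_Comp[of X Y Z f "\<^bold>0 Y Z" "\<^bold>0 Y Z"] by (simp add: Zero_Add Zero_Hom)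
qed (use assms Comp_in_Hom Zero_Hom in blast)+

lemma TArr_Zero:
  assumes "X \<in> Ob M" "Y \<in> Ob M" "Z \<in> Ob M"
  shows "\<langle>X\<rangle> \<boxtimes> \<^bold>0 Y Z = \<^bold>0 (X \<odot> Y) (X \<odot> Z)" "\<^bold>0 Y Z \<boxtimes> \<langle>X\<rangle> = \<^bold>0 (Y \<odot> X) (Z \<odot> X)"
proof -
  note h = Zero_Hom[OF assms(2,3)]
  show "\<langle>X\<rangle> \<boxtimes> \<^bold>0 Y Z = \<^bold>0 (X \<odot> Y) (X \<odot> Z)"
    using assms TArr_Add(1)[OF assms h h] h
    by (intro idem_Zero) (auto simp: Zero_Add Ide_in_Hom intro!: TArr_in_Hom)
  show "\<^bold>0 Y Z \<boxtimes> \<langle>X\<rangle> = \<^bold>0 (Y \<odot> X) (Z \<odot> X)"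
    using assms TArr_Add(2)[OF assms h h] h
    by (intro idem_Zero) (auto simp: Zero_Add Ide_in_Hom intro!: TArr_in_Hom)
qed

text \<open>A sum of arrows with different types is \<open>Null\<close>, so that composition and
  whiskering distribute over sums without typing hypotheses.\<close>

definition sadd :: "('o, 'm) sarr \<Rightarrow> ('o, 'm) sarr \<Rightarrow> ('o, 'm) sarr"  (infixl "\<oplus>\<oplus>" 54) where
  "t \<oplus>\<oplus> s = (if sarr t \<and> sarr s \<and> sdom s = sdom t \<and> scod s = scod t
     then Arr (sdom t) (sval t \<^bold>+ sval s) (scod t) else Null)"

definition szero :: "'o list \<Rightarrow> 'o list \<Rightarrow> ('o, 'm) sarr" where
  "szero xs ys = Arr xs (\<^bold>0 (ev xs) (ev ys)) ys"

lemma sarr_sadd: "sarr (t \<oplus>\<oplus> s) \<longleftrightarrow> sarr t \<and> sarr s \<and> sdom s = sdom t \<and> scod s = scod t"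
  by (auto simp: sadd_def dest!: sarrD intro: Add_Hom[OF ev_Ob ev_Ob])

lemma sadd_dom: "sarr (t \<oplus>\<oplus> s) \<Longrightarrow> sdom (t \<oplus>\<oplus> s) = sdom t \<and> scod (t \<oplus>\<oplus> s) = scod t"
  by (auto simp: sadd_def split: if_splits)

lemma scomp_dom: "sarr (t \<odot>\<odot> s) \<Longrightarrow> sdom (t \<odot>\<odot> s) = sdom s \<and> scod (t \<odot>\<odot> s) = scod t"
  by (auto simp: scomp_def split: if_splits)

lemma sarr_szero: "obs xs \<Longrightarrow> obs ys \<Longrightarrow> sarr (szero xs ys)" "sdom (szero xs ys) = xs" "scod (szero xs ys) = ys"
  by (auto simp: szero_def Zero_Hom)

lemma scomp_sadd: "r \<odot>\<odot> (t \<oplus>\<oplus> s) = r \<odot>\<odot> t \<oplus>\<oplus> r \<odot>\<odot> s"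
proof (cases "sarr r \<and> sarr (t \<oplus>\<oplus> s) \<and> scod (t \<oplus>\<oplus> s) = sdom r")
  case True
  then have *: "sarr t" "sarr s" "sdom s = sdom t" "scod s = scod t" "scod t = sdom r" "sarr (r \<odot>\<odot> t)" "sarr (r \<odot>\<odot> s)"
    using sadd_dom[of t s] by (auto simp: sarr_sadd sarr_scomp)
  have "sval r \<cdot> (sval t \<^bold>+ sval s) = sval r \<cdot> sval t \<^bold>+ sval r \<cdot> sval s"
    using sarrD[of r] sarrD[of t] sarrD[of s] * True
    by (intro Comp_Add[of "ev (sdom t)" "ev (sdom r)" "ev (scod r)"]) auto
  with * True show ?thesis
    using sadd_dom[of t s] scomp_dom[of r t] scomp_dom[of r s] sval_scomp[of r "sdom r" "scod r"]
    by (auto simp: scomp_def[of r "t \<oplus>\<oplus> s"] sadd_def[of "r \<odot>\<odot> t"] hom_def) (simp add: sadd_def)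
next
  case False
  have "\<not> (sarr (r \<odot>\<odot> t) \<and> sarr (r \<odot>\<odot> s) \<and> sdom (r \<odot>\<odot> s) = sdom (r \<odot>\<odot> t))"
    using False sadd_dom[of t s] scomp_dom[of r t] scomp_dom[of r s]
    by (auto simp: sarr_scomp sarr_sadd)
  with False show ?thesis by (auto simp: scomp_def[of r "t \<oplus>\<oplus> s"] sadd_def[of "r \<odot>\<odot> t"])
qed

lemma sadd_scomp: "(t \<oplus>\<oplus> s) \<odot>\<odot> r = t \<odot>\<odot> r \<oplus>\<oplus> s \<odot>\<odot> r"
proof (cases "sarr r \<and> sarr (t \<oplus>\<oplus> s) \<and> scod r = sdom (t \<oplus>\<oplus> s)")
  case True
  then have *: "sarr t" "sarr s" "sdom s = sdom t" "scod s = scod t" "scod r = sdom t" "sarr (t \<odot>\<odot> r)" "sarr (s \<odot>\<odot> r)"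
    using sadd_dom[of t s] by (auto simp: sarr_sadd sarr_scomp)
  have "(sval t \<^bold>+ sval s) \<cdot> sval r = sval t \<cdot> sval r \<^bold>+ sval s \<cdot> sval r"
    using sarrD[of r] sarrD[of t] sarrD[of s] * True
    by (intro Add_Comp[of "ev (sdom r)" "ev (sdom t)" "ev (scod t)"]) auto
  with * True show ?thesis
    using sadd_dom[of t s] scomp_dom[of t r] scomp_dom[of s r] sval_scomp[of _ "sdom t" _ r]
    by (auto simp: scomp_def[of "t \<oplus>\<oplus> s" r] sadd_def[of "t \<odot>\<odot> r"] hom_def) (simp add: sadd_def)
next
  case False
  have "\<not> (sarr (t \<odot>\<odot> r) \<and> sarr (s \<odot>\<odot> r) \<and> scod (s \<odot>\<odot> r) = scod (t \<odot>\<odot> r))"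
    using False sadd_dom[of t s] scomp_dom[of t r] scomp_dom[of s r]
    by (auto simp: sarr_scomp sarr_sadd)
  with False show ?thesis by (auto simp: scomp_def[of "t \<oplus>\<oplus> s" r] sadd_def[of "t \<odot>\<odot> r"])
qed

lemma lw_sadd: "lw X (t \<oplus>\<oplus> s) = lw X t \<oplus>\<oplus> lw X s"
proof (cases "X \<in> Ob M \<and> sarr (t \<oplus>\<oplus> s)")
  case True
  then have *: "sarr t" "sarr s" "sdom s = sdom t" "scod s = scod t" by (auto simp: sarr_sadd)
  have "\<langle>X\<rangle> \<boxtimes> (sval t \<^bold>+ sval s) = \<langle>X\<rangle> \<boxtimes> sval t \<^bold>+ \<langle>X\<rangle> \<boxtimes> sval s"
    using sarrD[of t] sarrD[of s] * True by (intro TArr_Add[of X "ev (sdom t)" "ev (scod t)"]) auto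
  moreover have "sval t \<in> Hom M (ev (sdom t)) (ev (scod t))" "sval s \<in> Hom M (ev (sdom t)) (ev (scod t))"
    "obs (sdom t)" "obs (scod t)"
    using sarrD[of t] sarrD[of s] * by auto
  ultimately show ?thesis
    using * True by (subst (2) sadd_def) (auto simp: lw_def sadd_def intro!: TArr_in_Hom Ide_in_Hom Add_Hom)
next
  case False
  then show ?thesis
    by (subst (2) sadd_def) (auto simp: sarr_sadd sarr_lw lw_def)
qed

lemma scomp_szero: "sarr t \<Longrightarrow> sdom t = ys \<Longrightarrow> obs xs \<Longrightarrow> t \<odot>\<odot> szero xs ys = szero xs (scod t)"
  using sarrD[of t] by (auto simp: scomp_def sarr_szero) (auto simp: szero_def Comp_Zero)

lemma szero_scomp: "sarr t \<Longrightarrow> scod t = ys \<Longrightarrow> obs zs \<Longrightarrow> szero ys zs \<odot>\<odot> t = szero (sdom t) zs"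
  using sarrD[of t] by (auto simp: scomp_def sarr_szero) (auto simp: szero_def Zero_Comp)

lemma lw_szero: "X \<in> Ob M \<Longrightarrow> obs xs \<Longrightarrow> obs ys \<Longrightarrow> lw X (szero xs ys) = szero (X # xs) (X # ys)"
  by (simp add: lw_def sarr_szero) (simp add: szero_def TArr_Zero)

lemma sadd_szero: "sarr t \<Longrightarrow> sdom t = xs \<Longrightarrow> scod t = ys \<Longrightarrow> t \<oplus>\<oplus> szero xs ys = t"
  and szero_sadd: "sarr t \<Longrightarrow> sdom t = xs \<Longrightarrow> scod t = ys \<Longrightarrow> szero xs ys \<oplus>\<oplus> t = t"
  using sarrD[of t] by (auto simp: sadd_def sarr_szero) (auto simp: szero_def Add_Zero Zero_Add)

lemma sadd_assoc: "(t \<oplus>\<oplus> s) \<oplus>\<oplus> r = t \<oplus>\<oplus> (s \<oplus>\<oplus> r)"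
proof (cases "sarr t \<and> sarr s \<and> sarr r \<and> sdom s = sdom t \<and> sdom r = sdom t \<and> scod s = scod t \<and> scod r = scod t")
  case True
  then have "sval t \<^bold>+ sval s \<^bold>+ sval r = sval t \<^bold>+ (sval s \<^bold>+ sval r)"
    using sarrD[of t] sarrD[of s] sarrD[of r] by (intro Add_assoc[of "ev (sdom t)" "ev (scod t)"]) auto
  moreover have "sarr (t \<oplus>\<oplus> s)" "sarr (s \<oplus>\<oplus> r)" using True by (auto simp: sarr_sadd)
  ultimately show ?thesis using True by (auto simp: sadd_def)
next
  case False
  then have "\<not> (sarr (t \<oplus>\<oplus> s) \<and> sarr r \<and> sdom r = sdom (t \<oplus>\<oplus> s) \<and> scod r = scod (t \<oplus>\<oplus> s))"
    "\<not> (sarr t \<and> sarr (s \<oplus>\<oplus> r) \<and> sdom (s \<oplus>\<oplus> r) = sdom t \<and> scod (s \<oplus>\<oplus> r) = scod t)"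
    using sadd_dom[of t s] sadd_dom[of s r] by (auto simp: sarr_sadd)
  then show ?thesis by (subst (1 3) sadd_def) auto
qed

lemma emb_Add:
  assumes "X \<in> Ob M" "Y \<in> Ob M" "f \<in> Hom M X Y" "g \<in> Hom M X Y" "obs xs"
  shows "emb X (f \<^bold>+ g) Y xs = emb X f Y xs \<oplus>\<oplus> emb X g Y xs"
  using assms hom_intros(4)[OF assms(1,2,3,5)] hom_intros(4)[OF assms(1,2,4,5)]
  by (auto simp: hom_def sadd_def) (simp add: emb_def TArr_Add(2) Add_Hom)

lemma emb_Zero:
  assumes "X \<in> Ob M" "Y \<in> Ob M" "obs xs"
  shows "emb X (\<^bold>0 X Y) Y xs = szero (X # xs) (Y # xs)"
  using assms by (simp add: emb_def szero_def TArr_Zero Zero_Hom)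

lemma srep_Add:
  assumes "srep f X p Y q F" "srep g X p Y q G"
  shows "srep (f \<^bold>+ g) X p Y q (\<lambda>xs. F xs \<oplus>\<oplus> G xs)"
  using assms Add_Hom[of X Y f g]
  by (auto simp: srep_def strict_def packs_def emb_Add scomp_sadd sadd_scomp)

lemma srep_Zero:
  assumes "packs X p" "packs Y q"
  shows "srep (\<^bold>0 X Y) X p Y q (\<lambda>xs. szero (fst p @ xs) (fst q @ xs))"
proof -
  obtain us U V us' U' V' where pq: "p = (us, U, V)" "q = (us', U', V')" by (metis prod_cases3)
  have *: "X \<in> Ob M" "Y \<in> Ob M" "natural U us [X]" "natural V' [Y] us'" using assms by (auto simp: packs_def pq)
  have "strict X p (\<^bold>0 X Y) Y q xs = szero (us @ xs) (us' @ xs)" if "obs xs" for xs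
    using that natural_simps[OF *(3) that] natural_simps[OF *(4) that] * natural_obs[OF *(3)] natural_obs[OF *(4)]
    by (simp add: strict_def pq emb_Zero szero_scomp scomp_szero)
  then show ?thesis using assms * by (simp add: srep_def pq Zero_Hom)
qed

text \<open>What is used in the end is that the \<open>e n\<close> are jointly epic, but the
  coproduct is recorded because this is what the tensor functors preserve.\<close>

definition epis :: "(nat \<Rightarrow> ('o, 'm) sarr) \<Rightarrow> (nat \<Rightarrow> 'o list) \<Rightarrow> 'o list \<Rightarrow> bool" where
  "epis e ds ys \<longleftrightarrow> obs ys \<and> (\<forall>n. hom (e n) (ds n) ys) \<and>
    is_coproduct M (\<lambda>n. ev (ds n)) (ev ys) (\<lambda>n. sval (e n))"

lemma epis_emb:
  assumes "\<And>n. P n \<in> Ob M" "is_coproduct M P S i" "obs xs"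
  shows "epis (\<lambda>n. emb (P n) (i n) S xs) (\<lambda>n. P n # xs) (S # xs)"
proof -
  have S: "S \<in> Ob M" "\<And>n. i n \<in> Hom M (P n) S" using assms(2) by (auto simp: is_coproduct_def)
  have "preserves_denumerable_coproducts M M (right_tensor_functor M (ev xs))"
    using tensor_functors assms by auto
  then have "is_coproduct M (\<lambda>n. P n \<odot> ev xs) (S \<odot> ev xs) (\<lambda>n. i n \<boxtimes> \<langle>ev xs\<rangle>)"
    using assms by (simp add: preserves_denumerable_coproducts_def right_tensor_functor_def)
  then show ?thesis using assms S unfolding epis_def
    by (auto intro!: hom_intros) (simp add: emb_def)
qed

lemma epis_lw:
  assumes "X \<in> Ob M" "epis e ds ys"
  shows "epis (\<lambda>n. lw X (e n)) (\<lambda>n. X # ds n) (X # ys)"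
proof -
  have h: "\<And>n. hom (e n) (ds n) ys" "obs ys" "is_coproduct M (\<lambda>n. ev (ds n)) (ev ys) (\<lambda>n. sval (e n))"
    using assms by (auto simp: epis_def)
  have "preserves_denumerable_coproducts M M (left_tensor_functor M X)"
    using tensor_functors assms by auto
  then have "is_coproduct M (\<lambda>n. X \<odot> ev (ds n)) (X \<odot> ev ys) (\<lambda>n. \<langle>X\<rangle> \<boxtimes> sval (e n))"
    using h(3) homD(4)[OF h(1)] by (simp add: preserves_denumerable_coproducts_def left_tensor_functor_def)
  then show ?thesis using assms h unfolding epis_def
    by (auto intro!: hom_intros simp: sval_lw[OF assms(1) h(1)])
qed

lemma epis_lws: "obs ws \<Longrightarrow> epis e ds ys \<Longrightarrow> epis (\<lambda>n. lws ws (e n)) (\<lambda>n. ws @ ds n) (ws @ ys)"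
  by (induction ws) (auto intro: epis_lw)

lemma episD:
  assumes "epis e ds ys" "hom f ys zs" "hom g ys zs" "\<And>n. f \<odot>\<odot> e n = g \<odot>\<odot> e n"
  shows "f = g"
proof (rule sarr_eqI[OF assms(2,3)])
  have e: "\<And>n. hom (e n) (ds n) ys" using assms(1) by (auto simp: epis_def)
  have fg: "sval f \<in> Hom M (ev ys) (ev zs)" "sval g \<in> Hom M (ev ys) (ev zs)" "obs ys" "obs zs"
    using assms(2,3) by (auto simp: hom_def dest: sarrD)
  have eq: "sval f \<cdot> sval (e n) = sval g \<cdot> sval (e n)" for n
    using sval_scomp[OF assms(2) e] sval_scomp[OF assms(3) e] assms(4) by metis
  have "sval f \<cdot> sval (e n) \<in> Hom M (ev (ds n)) (ev zs)" for n
    using e[of n] fg by (intro Comp_in_Hom[of _ "ev ys"]) (auto simp: hom_def dest: sarrD)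
  \<comment> \<open>Both \<open>f\<close> and \<open>g\<close> are mediating arrows for the cocone
    of the composites with \<open>e n\<close>.\<close>
  then have "\<exists>!h. h \<in> Hom M (ev ys) (ev zs) \<and> (\<forall>n. h \<cdot> sval (e n) = sval f \<cdot> sval (e n))"
    using assms(1) fg ev_Ob[OF fg(4)] unfolding epis_def is_coproduct_def
    by (elim conjE) (drule bspec[of _ _ "ev zs"], simp, drule spec[of _ "\<lambda>n. sval f \<cdot> sval (e n)"], simp)
  then show "sval f = sval g" using fg eq by metis
qed

end

subsection \<open>The tensor algebra\<close>

text \<open>The injections are recorded by their recursion. It starts at \<open>Suc (Suc n)\<close>
  because the first tensor power is \<open>V\<close> itself, not the unit object tensored with
  \<open>V\<close>.\<close>

locale tensor_alg = additive_tensor M + braided_alg M A m u c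
  for M :: "('o, 'm, 'z) premoncat_scheme" (structure) and A :: 'o and m u c :: 'm +
  fixes V :: 'o and e :: "nat \<Rightarrow> 'm"
  assumes V_Ob [simp]: "V \<in> Ob M"
    and e_coproduct: "is_coproduct M (tpow M V) A e"
    and e_0: "e 0 = u"
    and e_Suc: "e (Suc (Suc n)) = m \<cdot> (e (Suc n) \<boxtimes> e 1)"
begin

lemma tpow_Ob [simp]: "tpow M V n \<in> Ob M"
  by (induction n rule: induct_nat_012) auto

definition "es n = emb (tpow M V n) (e n) A"
abbreviation "e1 \<equiv> es (Suc 0)"

lemma e_Hom: "e n \<in> Hom M (tpow M V n) A"
  using e_coproduct by (auto simp: is_coproduct_def)

lemma natural_es: "natural (es n) [tpow M V n] [A]"
  unfolding es_def by (intro natural_emb e_Hom) auto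

lemma natural_e1: "natural e1 [V] [A]"
  using natural_es[of "Suc 0"] by simp

lemma srep_e: "srep (e n) (tpow M V n) (tip (tpow M V n)) A pA (es n)"
  unfolding srep_def using e_Hom[of n] natural_simps[OF natural_es[of n]] packs_tip[of A] packs_tip[of "tpow M V n"]
  by (auto simp: strict_def tip_def str_simps es_def)

lemma srep_e1: "srep (e 1) V (tip V) A pA e1"
  using srep_e[of 1] by simp

text \<open>The source of \<open>e 0\<close> is the unit object as a letter of the word; this letter
  is deleted before the unit of the algebra is inserted.\<close>

lemma es_0: "obs xs \<Longrightarrow> es 0 xs = us xs \<odot>\<odot> del xs"
proof -
  assume xs: "obs xs"
  have "hom (emb \<I> u A xs) (\<I> # xs) (A # xs)" using xs by (auto intro!: hom_intros u_Hom)
  then show ?thesis using xs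
    by (simp add: us_def strict_def unitp_def tip_def es_def e_0 scomp_assoc ins_del sid_right sid_scomp_ext)
qed

lemma es_Suc: "obs xs \<Longrightarrow> es (Suc (Suc n)) xs =
    ms xs \<odot>\<odot> es (Suc n) (A # xs) \<odot>\<odot> lw (tpow M V (Suc n)) (e1 xs) \<odot>\<odot> split (tpow M V (Suc n)) V xs"
proof -
  assume xs: "obs xs"
  let ?P = "tpow M V (Suc n)"
  have h: "e (Suc n) \<in> Hom M ?P A" "e 1 \<in> Hom M V A" using e_Hom[of "Suc n"] e_Hom[of 1] by simp_all
  have h2: "e (Suc n) \<boxtimes> e 1 \<in> Hom M (?P \<odot> V) (A \<odot> A)" using h by (intro TArr_in_Hom) auto
  have hm: "hom (emb (A \<odot> A) m A xs) ((A \<odot> A) # xs) (A # xs)"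
    and he: "hom (emb ?P (e (Suc n)) A (A # xs)) (?P # A # xs) (A # A # xs)"
    using xs h by (auto intro!: hom_intros m_Hom)
  show ?thesis using xs h h2 m_Hom
    by (simp add: ms_def strict_def prodp_def tip_def es_def e_Suc scomp_assoc sid_scomp_ext[OF hm]
        sid_scomp_ext[OF he] emb_scomp[of _ "A \<odot> A"] emb_tensor lw_sid)
qed

lemma epis_es: "obs ws \<Longrightarrow> obs xs \<Longrightarrow> epis (\<lambda>n. lws ws (es n xs)) (\<lambda>n. ws @ tpow M V n # xs) (ws @ A # xs)"
  unfolding es_def by (intro epis_lws epis_emb e_coproduct) auto

text \<open>With \<open>X = [A]\<close> and \<open>f\<close> built from the braiding, the hypothesis on \<open>f\<close> is multiplicativity twisted
  by moving the strand \<open>X\<close> across; with \<open>X = []\<close> it is plain multiplicativity.\<close>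

lemma extend_right:
  assumes "obs X" "natural f (X @ [A]) (W @ X)" "natural g (X @ [A]) (W @ X)"
    and f: "\<And>xs. obs xs \<Longrightarrow> f xs \<odot>\<odot> lws X (ms xs) = mu (X @ xs) \<odot>\<odot> lws W (f xs) \<odot>\<odot> f (A # xs)"
    and g: "\<And>xs. obs xs \<Longrightarrow> g xs \<odot>\<odot> lws X (ms xs) = mu (X @ xs) \<odot>\<odot> lws W (g xs) \<odot>\<odot> g (A # xs)"
    and u: "\<And>xs. obs xs \<Longrightarrow> f xs \<odot>\<odot> lws X (us xs) = g xs \<odot>\<odot> lws X (us xs)"
    and e1: "\<And>xs. obs xs \<Longrightarrow> f xs \<odot>\<odot> lws X (e1 xs) = g xs \<odot>\<odot> lws X (e1 xs)"
    and xs: "obs xs"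
  shows "f xs = g xs"
proof -
  \<comment> \<open>The word \<open>xs\<close> stays arbitrary because the last factor
    \<open>V\<close> is one more letter for the induction hypothesis. The powers 0 and 1 are both
    base cases: the unit and \<open>V\<close>.\<close>
  have gen: "f xs \<odot>\<odot> lws X (es n xs) = g xs \<odot>\<odot> lws X (es n xs)" if "obs xs" for n xs
    using that
  proof (induction n arbitrary: xs rule: induct_nat_012)
    case 0
    then show ?case by (simp add: es_0 lws_scomp u scomp_ext[OF u, unfolded scomp_assoc])
  next
    case 1
    then show ?case by (simp add: e1)
  next
    case (ge2 n)
    let ?P = "tpow M V (Suc n)"
    have P: "?P \<in> Ob M" by (rule tpow_Ob)
    have h1: "hom (e1 xs) (V # xs) (A # xs)" using natural_hom[OF natural_e1] ge2.prems by simp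
    have n: "natural (es (Suc n)) [?P] [A]" by (rule natural_es)
    have shift: "es (Suc n) (A # xs) \<odot>\<odot> lw ?P (e1 xs) = lw A (e1 xs) \<odot>\<odot> es (Suc n) (V # xs)"
      using naturalD[OF n h1] by simp
    \<comment> \<open>By interchange the first \<open>Suc n\<close> factors are evaluated before the
      last one. This is the order in which twisted multiplicativity takes them: \<open>k\<close>
      first meets the left factor, then the right one.\<close>
    have E: "es (Suc (Suc n)) xs = ms xs \<odot>\<odot> lw A (e1 xs) \<odot>\<odot> es (Suc n) (V # xs) \<odot>\<odot> split ?P V xs"
      by (simp only: es_Suc[OF ge2.prems] scomp_ext[OF shift] scomp_assoc)
    have step: "k xs \<odot>\<odot> lws X (es (Suc (Suc n)) xs) =
        mu (X @ xs) \<odot>\<odot> lws W (k xs \<odot>\<odot> lws X (e1 xs)) \<odot>\<odot> k (V # xs) \<odot>\<odot> lws X (es (Suc n) (V # xs)) \<odot>\<odot>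
          lws X (split ?P V xs)"
      if k: "natural k (X @ [A]) (W @ X)"
        "\<And>xs. obs xs \<Longrightarrow> k xs \<odot>\<odot> lws X (ms xs) = mu (X @ xs) \<odot>\<odot> lws W (k xs) \<odot>\<odot> k (A # xs)" for k
    proof -
      have "k xs \<odot>\<odot> lws X (es (Suc (Suc n)) xs) =
        k xs \<odot>\<odot> lws X (ms xs) \<odot>\<odot> lws X (lw A (e1 xs)) \<odot>\<odot> lws X (es (Suc n) (V # xs)) \<odot>\<odot> lws X (split ?P V xs)"
        by (simp only: E lws_scomp scomp_assoc)
      also have "\<dots> = mu (X @ xs) \<odot>\<odot> lws W (k xs) \<odot>\<odot> k (A # xs) \<odot>\<odot> lws X (lw A (e1 xs)) \<odot>\<odot>
          lws X (es (Suc n) (V # xs)) \<odot>\<odot> lws X (split ?P V xs)"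
        using scomp_ext[OF k(2)[OF ge2.prems]] by (simp only: scomp_assoc)
      also have "k (A # xs) \<odot>\<odot> lws X (lw A (e1 xs)) = lws W (lws X (e1 xs)) \<odot>\<odot> k (V # xs)"
        using naturalD[OF k(1) h1] by simp
      from scomp_ext[OF this] have "mu (X @ xs) \<odot>\<odot> lws W (k xs) \<odot>\<odot> k (A # xs) \<odot>\<odot> lws X (lw A (e1 xs)) \<odot>\<odot>
          lws X (es (Suc n) (V # xs)) \<odot>\<odot> lws X (split ?P V xs) =
        mu (X @ xs) \<odot>\<odot> lws W (k xs) \<odot>\<odot> lws W (lws X (e1 xs)) \<odot>\<odot> k (V # xs) \<odot>\<odot>
          lws X (es (Suc n) (V # xs)) \<odot>\<odot> lws X (split ?P V xs)" by (simp only: scomp_assoc)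
      finally show ?thesis by (simp only: lws_scomp scomp_assoc)
    qed
    have IH: "f (V # xs) \<odot>\<odot> lws X (es (Suc n) (V # xs)) = g (V # xs) \<odot>\<odot> lws X (es (Suc n) (V # xs))"
      using ge2.IH ge2.prems by simp
    show ?case
      by (simp only: step[OF assms(2) f] step[OF assms(3) g] e1[OF ge2.prems] scomp_ext[OF IH] scomp_assoc)
  qed
  show ?thesis
    by (rule episD[OF epis_es[OF assms(1) xs] _ _ gen[OF xs]])
      (use natural_hom[OF assms(2) xs] natural_hom[OF assms(3) xs] in simp_all)
qed

text \<open>The mirror image: the strand \<open>X\<close> starts to the right of \<open>A\<close>,
  so the last factor \<open>V\<close> passes it first and leaves its output \<open>W\<close> behind.
  The induction hypothesis is therefore applied with \<open>W\<close> in front of the remaining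
  word.\<close>

lemma extend_left:
  assumes "obs X" "natural f ([A] @ X) (X @ W)" "natural g ([A] @ X) (X @ W)"
    and f: "\<And>xs. obs xs \<Longrightarrow> f xs \<odot>\<odot> ms (X @ xs) = lws X (mu xs) \<odot>\<odot> f (W @ xs) \<odot>\<odot> lw A (f xs)"
    and g: "\<And>xs. obs xs \<Longrightarrow> g xs \<odot>\<odot> ms (X @ xs) = lws X (mu xs) \<odot>\<odot> g (W @ xs) \<odot>\<odot> lw A (g xs)"
    and u: "\<And>xs. obs xs \<Longrightarrow> f xs \<odot>\<odot> us (X @ xs) = g xs \<odot>\<odot> us (X @ xs)"
    and e1: "\<And>xs. obs xs \<Longrightarrow> f xs \<odot>\<odot> e1 (X @ xs) = g xs \<odot>\<odot> e1 (X @ xs)"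
    and xs: "obs xs"
  shows "f xs = g xs"
proof -
  have W: "obs W" using natural_obs[OF assms(2)] by simp
  have gen: "f xs \<odot>\<odot> es n (X @ xs) = g xs \<odot>\<odot> es n (X @ xs)" if "obs xs" for n xs
    using that
  proof (induction n arbitrary: xs rule: induct_nat_012)
    case 0
    then show ?case using assms(1) by (simp add: es_0 scomp_ext[OF u, unfolded scomp_assoc])
  next
    case 1
    then show ?case by (simp add: e1)
  next
    case (ge2 n)
    let ?P = "tpow M V (Suc n)" and ?Y = "X @ xs"
    have P: "?P \<in> Ob M" by (rule tpow_Ob)
    have n: "natural (es (Suc n)) [?P] [A]" by (rule natural_es)
    have step: "k xs \<odot>\<odot> es (Suc (Suc n)) ?Y =
        lws X (mu xs) \<odot>\<odot> k (W @ xs) \<odot>\<odot> es (Suc n) (X @ W @ xs) \<odot>\<odot> lw ?P (k xs \<odot>\<odot> e1 ?Y) \<odot>\<odot> split ?P V ?Y"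
      if k: "natural k ([A] @ X) (X @ W)"
        "\<And>xs. obs xs \<Longrightarrow> k xs \<odot>\<odot> ms (X @ xs) = lws X (mu xs) \<odot>\<odot> k (W @ xs) \<odot>\<odot> lw A (k xs)" for k
    proof -
      have "hom (k xs) (A # ?Y) (X @ W @ xs)" using natural_hom[OF k(1) ge2.prems] by simp
      from naturalD[OF n this]
      have shift: "es (Suc n) (X @ W @ xs) \<odot>\<odot> lw ?P (k xs) = lw A (k xs) \<odot>\<odot> es (Suc n) (A # ?Y)" by simp
      have "k xs \<odot>\<odot> es (Suc (Suc n)) ?Y =
        (k xs \<odot>\<odot> ms ?Y) \<odot>\<odot> es (Suc n) (A # ?Y) \<odot>\<odot> lw ?P (e1 ?Y) \<odot>\<odot> split ?P V ?Y"
        using ge2.prems assms(1) by (simp add: es_Suc scomp_assoc)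
      also have "\<dots> = lws X (mu xs) \<odot>\<odot> k (W @ xs) \<odot>\<odot> (lw A (k xs) \<odot>\<odot> es (Suc n) (A # ?Y)) \<odot>\<odot> lw ?P (e1 ?Y) \<odot>\<odot> split ?P V ?Y"
        by (simp only: k(2)[OF ge2.prems] scomp_assoc)
      finally show ?thesis by (simp only: shift[symmetric] lw_scomp scomp_assoc)
    qed
    have IH: "f (W @ xs) \<odot>\<odot> es (Suc n) (X @ W @ xs) = g (W @ xs) \<odot>\<odot> es (Suc n) (X @ W @ xs)"
      using ge2.IH ge2.prems W by simp
    show ?case
      by (simp only: step[OF assms(2) f] step[OF assms(3) g] e1[OF ge2.prems] scomp_ext[OF IH] scomp_assoc)
  qed
  have "epis (\<lambda>n. lws [] (es n (X @ xs))) (\<lambda>n. [] @ tpow M V n # X @ xs) ([] @ A # X @ xs)"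
    by (rule epis_es) (use assms(1) xs in auto)
  then show ?thesis
    by (rule episD) (use natural_hom[OF assms(2) xs] natural_hom[OF assms(3) xs] gen[OF xs] in simp_all)
qed

end

subsection \<open>Comultiplication and counit\<close>

text \<open>Delta and epsilon are any arrows with the two defining properties, so the results apply
  to whichever pair a definite description picks out. Together with the types of \<open>cT\<close>,
  \<open>c_e\<close> says that the braiding of \<open>A\<close> exchanges homogeneous
  components.\<close>

locale tensor_bialg = tensor_alg M A m u c V e
  for M :: "('o, 'm, 'z) premoncat_scheme" (structure) and A :: 'o and m u c :: 'm and V :: 'o and e :: "nat \<Rightarrow> 'm" +
  fixes cT :: "nat \<Rightarrow> nat \<Rightarrow> 'm" and \<Delta> \<epsilon> :: 'm
  assumes cT_Hom: "cT k n \<in> Hom M (tpow M V k \<odot> tpow M V n) (tpow M V n \<odot> tpow M V k)"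
    and c_e: "c \<cdot> (e k \<boxtimes> e n) = (e n \<boxtimes> e k) \<cdot> cT k n"
    and \<Delta>_mor: "algebra_mor M A m u (A \<odot> A) m2 u2 \<Delta>"
    and \<Delta>_e1: "\<Delta> \<cdot> e 1 = delta_l M V u (e 1) \<^bold>+ delta_r M V u (e 1)"
    and \<epsilon>_mor: "algebra_mor M A m u \<I> (Unit_mult M) \<langle>\<I>\<rangle> \<epsilon>"
    and \<epsilon>_e1: "\<epsilon> \<cdot> e 1 = \<^bold>0 V \<I>"
begin

section \<open>The defining properties of Delta and epsilon as equations of diagrams\<close>

definition "Ds = strict A pA \<Delta> (A \<odot> A) pAA"
definition "Es = strict A pA \<epsilon> \<I> unitp"

lemma srep_\<Delta>: "srep \<Delta> A pA (A \<odot> A) pAA Ds"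
  and srep_\<epsilon>: "srep \<epsilon> A pA \<I> unitp Es"
  unfolding Ds_def Es_def using \<Delta>_mor \<epsilon>_mor by (auto intro!: srep_strict packs_intros simp: algebra_mor_def)

lemma natural_Ds: "natural Ds [A] [A, A]" and natural_Es: "natural Es [A] []"
  using srep_natural[OF srep_\<Delta>] srep_natural[OF srep_\<epsilon>] by simp_all

lemmas bisimps = ssimps natural_simps[OF natural_Ds, simplified] natural_simps[OF natural_Es, simplified]
  natural_simps[OF natural_e1, simplified] sarr_szero sarr_sadd scomp_sadd sadd_scomp lw_sadd lw_szero
  scomp_szero szero_scomp

lemmas bisreps = srep_m2 srep_u2 srep_e1[unfolded One_nat_def] srep_\<Delta> srep_\<epsilon> sreps

lemma Ds_ms: "obs xs \<Longrightarrow> Ds xs \<odot>\<odot> ms xs = ms2 xs \<odot>\<odot> Ds (A # A # xs) \<odot>\<odot> lw A (Ds xs)"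
proof -
  have "\<Delta> \<cdot> m = m2 \<cdot> (\<Delta> \<boxtimes> \<Delta>) \<longleftrightarrow> (\<forall>xs. obs xs \<longrightarrow> Ds xs \<odot>\<odot> ms xs = ms2 xs \<odot>\<odot> Ds (A # A # xs) \<odot>\<odot> lw A (Ds xs))"
    by (rule trans[OF srep_eq], (rule bisreps srep_intros packs_intros A_Ob V_Ob)+, simp add: bisimps cong: conj_cong)
  then show "obs xs \<Longrightarrow> ?thesis" using \<Delta>_mor by (auto simp: algebra_mor_def)
qed

lemma Ds_us: "obs xs \<Longrightarrow> Ds xs \<odot>\<odot> us xs = us (A # xs) \<odot>\<odot> us xs"
proof -
  have "\<Delta> \<cdot> u = u2 \<longleftrightarrow> (\<forall>xs. obs xs \<longrightarrow> Ds xs \<odot>\<odot> us xs = us (A # xs) \<odot>\<odot> us xs)"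
    by (rule trans[OF srep_eq], (rule bisreps srep_intros packs_intros A_Ob V_Ob)+, simp add: bisimps us2_def cong: conj_cong)
  then show "obs xs \<Longrightarrow> ?thesis" using \<Delta>_mor by (auto simp: algebra_mor_def)
qed

lemma Ds_e1: "obs xs \<Longrightarrow> Ds xs \<odot>\<odot> e1 xs = us (A # xs) \<odot>\<odot> e1 xs \<oplus>\<oplus> e1 (A # xs) \<odot>\<odot> lw V (us xs)"
proof -
  have "\<Delta> \<cdot> e 1 = (u \<boxtimes> e 1) \<cdot> \<l>\<inverse> V \<^bold>+ (e 1 \<boxtimes> u) \<cdot> \<r>\<inverse> V \<longleftrightarrow>
    (\<forall>xs. obs xs \<longrightarrow> Ds xs \<odot>\<odot> e1 xs = us (A # xs) \<odot>\<odot> e1 xs \<oplus>\<oplus> e1 (A # xs) \<odot>\<odot> lw V (us xs))"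
    unfolding One_nat_def
    by (rule trans[OF srep_eq], (rule bisreps srep_Add srep_intros packs_intros A_Ob V_Ob)+, simp add: bisimps cong: conj_cong)
  then show "obs xs \<Longrightarrow> ?thesis" using \<Delta>_e1 by (auto simp: delta_l_def delta_r_def)
qed

lemma Es_ms: "obs xs \<Longrightarrow> Es xs \<odot>\<odot> ms xs = Es xs \<odot>\<odot> Es (A # xs)"
proof -
  have "\<epsilon> \<cdot> m = Unit_mult M \<cdot> (\<epsilon> \<boxtimes> \<epsilon>) \<longleftrightarrow> (\<forall>xs. obs xs \<longrightarrow> Es xs \<odot>\<odot> ms xs = Es xs \<odot>\<odot> lw A (Es xs))"
    unfolding Unit_mult_def
    by (rule trans[OF srep_eq], (rule bisreps srep_intros packs_intros A_Ob V_Ob)+, simp add: bisimps cong: conj_cong)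
  moreover have "obs xs \<Longrightarrow> Es xs \<odot>\<odot> lw A (Es xs) = Es xs \<odot>\<odot> Es (A # xs)"
    using naturalD'[OF natural_Es, of "Es xs" xs] by (simp add: bisimps)
  ultimately show "obs xs \<Longrightarrow> ?thesis" using \<epsilon>_mor by (auto simp: algebra_mor_def)
qed

lemma Es_us: "obs xs \<Longrightarrow> Es xs \<odot>\<odot> us xs = sid xs"
proof -
  have "\<epsilon> \<cdot> u = \<langle>\<I>\<rangle> \<longleftrightarrow> (\<forall>xs. obs xs \<longrightarrow> Es xs \<odot>\<odot> us xs = sid xs)"
    by (rule trans[OF srep_eq], (rule bisreps srep_intros packs_intros A_Ob V_Ob)+, simp add: bisimps cong: conj_cong)
  then show "obs xs \<Longrightarrow> ?thesis" using \<epsilon>_mor by (auto simp: algebra_mor_def)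
qed

lemma Es_e1: "obs xs \<Longrightarrow> Es xs \<odot>\<odot> e1 xs = szero (V # xs) xs"
proof -
  have "\<epsilon> \<cdot> e 1 = \<^bold>0 V \<I> \<longleftrightarrow> (\<forall>xs. obs xs \<longrightarrow> Es xs \<odot>\<odot> e1 xs = szero (V # xs) xs)"
    unfolding One_nat_def
    by (rule trans[OF srep_eq], (rule bisreps srep_Zero srep_intros packs_intros A_Ob V_Ob)+, simp add: bisimps cong: conj_cong)
  then show "obs xs \<Longrightarrow> ?thesis" using \<epsilon>_e1 by auto
qed

lemma Ds_lw: "\<lbrakk>sarr t; scod t = ys\<rbrakk> \<Longrightarrow> Ds ys \<odot>\<odot> lw A t = lw A (lw A t) \<odot>\<odot> Ds (sdom t)"
  using naturalD'[OF natural_Ds, of t] by simp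

lemma Es_lw: "\<lbrakk>sarr t; scod t = ys\<rbrakk> \<Longrightarrow> Es ys \<odot>\<odot> lw A t = t \<odot>\<odot> Es (sdom t)"
  using naturalD'[OF natural_Es, of t] by simp

lemma lw_e1: "\<lbrakk>sarr t; sdom t = xs\<rbrakk> \<Longrightarrow> lw A t \<odot>\<odot> e1 xs = e1 (scod t) \<odot>\<odot> lw V t"
  using naturalD'[OF natural_e1, of t] by simp

text \<open>The braiding of \<open>A\<close> restricts to \<open>A \<otimes> V \<rightarrow> V \<otimes> A\<close> and \<open>V \<otimes> A \<rightarrow> A \<otimes> V\<close>,
  glued from the components \<open>c\<^sub>T n 1\<close> and \<open>c\<^sub>T 1 n\<close>.\<close>

lemma restrict_right:
  obtains sg where "natural sg [A, V] [V, A]"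
    "\<And>xs. obs xs \<Longrightarrow> cs xs \<odot>\<odot> lw A (e1 xs) = e1 (A # xs) \<odot>\<odot> sg xs"
proof -
  have "preserves_denumerable_coproducts M M (right_tensor_functor M V)" using tensor_functors by simp
  then have cop: "is_coproduct M (\<lambda>n. tpow M V n \<odot> V) (A \<odot> V) (\<lambda>n. e n \<boxtimes> \<langle>V\<rangle>)"
    using e_coproduct by (simp add: preserves_denumerable_coproducts_def right_tensor_functor_def)
  \<comment> \<open>The components of the restricted braiding: \<open>cT n 1\<close> ends in
    \<open>V\<close> tensored with a power of \<open>V\<close>, and only the power still has to be
    injected into \<open>A\<close>.\<close>
  have gH: "(\<langle>V\<rangle> \<boxtimes> e n) \<cdot> cT n 1 \<in> Hom M (tpow M V n \<odot> V) (V \<odot> A)" for n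
    using cT_Hom[of n 1] e_Hom[of n] by (intro Comp_in_Hom[of _ "V \<odot> tpow M V n"] TArr_in_Hom Ide_in_Hom) auto
  then obtain h where h: "h \<in> Hom M (A \<odot> V) (V \<odot> A)" "\<And>n. h \<cdot> (e n \<boxtimes> \<langle>V\<rangle>) = (\<langle>V\<rangle> \<boxtimes> e n) \<cdot> cT n 1"
    using coproduct_factor[OF cop _ gH] by (metis TOb_in_Ob A_Ob V_Ob)
  define sg where "sg = strict (A \<odot> V) (prodp A pA V (tip V)) h (V \<odot> A) (prodp V (tip V) A pA)"
  have srep_h: "srep h (A \<odot> V) (prodp A pA V (tip V)) (V \<odot> A) (prodp V (tip V) A pA) sg"
    unfolding sg_def by (intro srep_strict packs_intros A_Ob V_Ob h)
  have n: "natural sg [A, V] [V, A]" using srep_natural[OF srep_h] by simp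
  have "cs xs \<odot>\<odot> lw A (e1 xs) = e1 (A # xs) \<odot>\<odot> sg xs" if xs: "obs xs" for xs
  \<comment> \<open>It suffices to compare on each component of the first strand. There the
    restricted braiding is \<open>cT k 1\<close> by construction, and the claim is the relation
    between \<open>c\<close> and \<open>cT k 1\<close>.\<close>
  proof (rule episD)
    show "epis (\<lambda>n. lws [] (es n (V # xs))) (\<lambda>n. [] @ tpow M V n # V # xs) ([] @ A # V # xs)"
      using xs by (intro epis_es) auto
    show "hom (cs xs \<odot>\<odot> lw A (e1 xs)) ([] @ A # V # xs) (A # A # xs)"
      using natural_hom[OF natural_cs xs] natural_hom[OF natural_e1 xs] by (auto intro!: hom_intros)
    show "hom (e1 (A # xs) \<odot>\<odot> sg xs) ([] @ A # V # xs) (A # A # xs)"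
      using natural_hom[OF n xs] natural_hom[OF natural_e1, of "A # xs"] xs by (auto intro!: hom_intros)
    fix k
    let ?P = "tpow M V k"
    define d where "d = strict (?P \<odot> V) (prodp ?P (tip ?P) V (tip V)) (cT k 1) (V \<odot> ?P) (prodp V (tip V) ?P (tip ?P))"
    have srep_d: "srep (cT k 1) (?P \<odot> V) (prodp ?P (tip ?P) V (tip V)) (V \<odot> ?P) (prodp V (tip V) ?P (tip ?P)) d"
      unfolding d_def using cT_Hom[of k 1] by (intro srep_strict packs_intros A_Ob V_Ob tpow_Ob) simp
    note r = srep_h srep_d srep_e[of k] srep_e1
    note s = bisimps natural_simps[OF natural_es[of k], simplified] natural_simps[OF srep_natural[OF srep_d], simplified]
      natural_simps[OF n, simplified]
    have "h \<cdot> (e k \<boxtimes> \<langle>V\<rangle>) = (\<langle>V\<rangle> \<boxtimes> e k) \<cdot> cT k 1 \<longleftrightarrow>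
      (\<forall>xs. obs xs \<longrightarrow> sg xs \<odot>\<odot> es k (V # xs) = lw V (es k xs) \<odot>\<odot> d xs)"
      by (rule trans[OF srep_eq], (rule r bisreps srep_intros packs_intros A_Ob V_Ob tpow_Ob)+, simp add: s cong: conj_cong)
    then have 1: "sg xs \<odot>\<odot> es k (V # xs) = lw V (es k xs) \<odot>\<odot> d xs" using h(2) xs by simp
    have "c \<cdot> (e k \<boxtimes> e 1) = (e 1 \<boxtimes> e k) \<cdot> cT k 1 \<longleftrightarrow>
      (\<forall>xs. obs xs \<longrightarrow> cs xs \<odot>\<odot> es k (A # xs) \<odot>\<odot> lw ?P (e1 xs) = e1 (A # xs) \<odot>\<odot> lw V (es k xs) \<odot>\<odot> d xs)"
      by (rule trans[OF srep_eq], (rule r bisreps srep_intros packs_intros A_Ob V_Ob tpow_Ob)+, simp add: s cong: conj_cong)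
    then have 2: "cs xs \<odot>\<odot> es k (A # xs) \<odot>\<odot> lw ?P (e1 xs) = e1 (A # xs) \<odot>\<odot> lw V (es k xs) \<odot>\<odot> d xs"
      using c_e[of k 1] xs by simp
    have 3: "es k (A # xs) \<odot>\<odot> lw ?P (e1 xs) = lw A (e1 xs) \<odot>\<odot> es k (V # xs)"
      using naturalD'[OF natural_es, of "e1 xs" "A # xs" k] xs by (simp add: bisimps)
    show "(cs xs \<odot>\<odot> lw A (e1 xs)) \<odot>\<odot> lws [] (es k (V # xs)) = (e1 (A # xs) \<odot>\<odot> sg xs) \<odot>\<odot> lws [] (es k (V # xs))"
      using 1 2 3 by (simp add: scomp_assoc)
  qed
  with n show thesis by (rule that)
qed

lemma restrict_left:
  obtains sg where "natural sg [V, A] [A, V]"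
    "\<And>xs. obs xs \<Longrightarrow> cs xs \<odot>\<odot> e1 (A # xs) = lw A (e1 xs) \<odot>\<odot> sg xs"
proof -
  have "preserves_denumerable_coproducts M M (left_tensor_functor M V)" using tensor_functors by simp
  then have cop: "is_coproduct M (\<lambda>n. V \<odot> tpow M V n) (V \<odot> A) (\<lambda>n. \<langle>V\<rangle> \<boxtimes> e n)"
    using e_coproduct by (simp add: preserves_denumerable_coproducts_def left_tensor_functor_def)
  have gH: "(e n \<boxtimes> \<langle>V\<rangle>) \<cdot> cT 1 n \<in> Hom M (V \<odot> tpow M V n) (A \<odot> V)" for n
    using cT_Hom[of 1 n] e_Hom[of n] by (intro Comp_in_Hom[of _ "tpow M V n \<odot> V"] TArr_in_Hom Ide_in_Hom) auto
  then obtain h where h: "h \<in> Hom M (V \<odot> A) (A \<odot> V)" "\<And>n. h \<cdot> (\<langle>V\<rangle> \<boxtimes> e n) = (e n \<boxtimes> \<langle>V\<rangle>) \<cdot> cT 1 n"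
    using coproduct_factor[OF cop _ gH] by (metis TOb_in_Ob A_Ob V_Ob)
  define sg where "sg = strict (V \<odot> A) (prodp V (tip V) A pA) h (A \<odot> V) (prodp A pA V (tip V))"
  have srep_h: "srep h (V \<odot> A) (prodp V (tip V) A pA) (A \<odot> V) (prodp A pA V (tip V)) sg"
    unfolding sg_def by (intro srep_strict packs_intros A_Ob V_Ob h)
  have n: "natural sg [V, A] [A, V]" using srep_natural[OF srep_h] by simp
  have "cs xs \<odot>\<odot> e1 (A # xs) = lw A (e1 xs) \<odot>\<odot> sg xs" if xs: "obs xs" for xs
  proof (rule episD)
    show "epis (\<lambda>n. lws [V] (es n xs)) (\<lambda>n. [V] @ tpow M V n # xs) ([V] @ A # xs)"
      using xs by (intro epis_es) auto
    show "hom (cs xs \<odot>\<odot> e1 (A # xs)) ([V] @ A # xs) (A # A # xs)"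
      using natural_hom[OF natural_cs xs] natural_hom[OF natural_e1, of "A # xs"] xs by (auto intro!: hom_intros)
    show "hom (lw A (e1 xs) \<odot>\<odot> sg xs) ([V] @ A # xs) (A # A # xs)"
      using natural_hom[OF n xs] natural_hom[OF natural_e1 xs] by (auto intro!: hom_intros)
    fix k
    let ?P = "tpow M V k"
    define d where "d = strict (V \<odot> ?P) (prodp V (tip V) ?P (tip ?P)) (cT 1 k) (?P \<odot> V) (prodp ?P (tip ?P) V (tip V))"
    have srep_d: "srep (cT 1 k) (V \<odot> ?P) (prodp V (tip V) ?P (tip ?P)) (?P \<odot> V) (prodp ?P (tip ?P) V (tip V)) d"
      unfolding d_def using cT_Hom[of 1 k] by (intro srep_strict packs_intros A_Ob V_Ob tpow_Ob) simp
    note r = srep_h srep_d srep_e[of k] srep_e1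
    note s = bisimps natural_simps[OF natural_es[of k], simplified] natural_simps[OF srep_natural[OF srep_d], simplified]
      natural_simps[OF n, simplified]
    have "h \<cdot> (\<langle>V\<rangle> \<boxtimes> e k) = (e k \<boxtimes> \<langle>V\<rangle>) \<cdot> cT 1 k \<longleftrightarrow>
      (\<forall>xs. obs xs \<longrightarrow> sg xs \<odot>\<odot> lw V (es k xs) = es k (V # xs) \<odot>\<odot> d xs)"
      by (rule trans[OF srep_eq], (rule r bisreps srep_intros packs_intros A_Ob V_Ob tpow_Ob)+, simp add: s cong: conj_cong)
    then have 1: "sg xs \<odot>\<odot> lw V (es k xs) = es k (V # xs) \<odot>\<odot> d xs" using h(2) xs by simp
    have "c \<cdot> (e 1 \<boxtimes> e k) = (e k \<boxtimes> e 1) \<cdot> cT 1 k \<longleftrightarrow>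
      (\<forall>xs. obs xs \<longrightarrow> cs xs \<odot>\<odot> e1 (A # xs) \<odot>\<odot> lw V (es k xs) = es k (A # xs) \<odot>\<odot> lw ?P (e1 xs) \<odot>\<odot> d xs)"
      by (rule trans[OF srep_eq], (rule r bisreps srep_intros packs_intros A_Ob V_Ob tpow_Ob)+, simp add: s cong: conj_cong)
    then have 2: "cs xs \<odot>\<odot> e1 (A # xs) \<odot>\<odot> lw V (es k xs) = es k (A # xs) \<odot>\<odot> lw ?P (e1 xs) \<odot>\<odot> d xs"
      using c_e[of 1 k] xs by simp
    have 3: "es k (A # xs) \<odot>\<odot> lw ?P (e1 xs) = lw A (e1 xs) \<odot>\<odot> es k (V # xs)"
      using naturalD'[OF natural_es, of "e1 xs" "A # xs" k] xs by (simp add: bisimps)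
    show "(cs xs \<odot>\<odot> e1 (A # xs)) \<odot>\<odot> lws [V] (es k xs) = (lw A (e1 xs) \<odot>\<odot> sg xs) \<odot>\<odot> lws [V] (es k xs)"
      using 1 2 scomp_ext[OF 3] by (simp add: scomp_assoc)
  qed
  with n show thesis by (rule that)
qed

text \<open>Oriented so that Delta and epsilon act early: they pass multiplications, are evaluated
  on units and on \<open>e1\<close>, and precede whatever happens on strands to their right. A
  crossing on strands to the left of a counit, however, acts before it.\<close>

lemmas bialg0 = Ds_ms Ds_us Ds_lw Es_ms Es_us Es_lw lw_e1 Es_e1 Ds_e1
  cs_lw[where t = "Es xs" for xs] cs_lw[where t = "lw A (Es xs)" for xs]
lemmas bialg1 = bialg0 bialg0[THEN lw_cong_scomp]
lemmas bialg2 = bialg1 bialg1[THEN lw_cong_scomp, THEN lw_cong_scomp]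
lemmas bialg = bialg2 bialg2[THEN scomp_ext]

text \<open>Interchange of Delta with a crossing on strands to its left. Which of the two should act
  first for both sides to meet depends on the equation, so both directions are kept as separate rule
  sets.\<close>

lemmas Ds_over0 = lw_cs[where t = "Ds xs" for xs] lw_cs[where t = "lw A (Ds xs)" for xs]
  lw_cs[where t = "lw A (lw A (Ds xs))" for xs]
lemmas Ds_over1 = Ds_over0 Ds_over0[THEN lw_cong_scomp]
lemmas Ds_over2 = Ds_over1 Ds_over1[THEN lw_cong_scomp, THEN lw_cong_scomp]
lemmas Ds_over = Ds_over2 Ds_over2[THEN scomp_ext]
lemmas Ds_under0 = cs_lw[where t = "Ds xs" for xs] cs_lw[where t = "lw A (Ds xs)" for xs]
lemmas Ds_under = Ds_under0 Ds_under0[THEN scomp_ext]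

section \<open>Compatibility of epsilon and Delta with the braiding\<close>

lemmas natural_Es1 = natural_Cons[OF A_Ob natural_Es, simplified]
lemmas natural_Ds1 = natural_Cons[OF A_Ob natural_Ds, simplified]
lemmas natural_cs1 = natural_Cons[OF A_Ob natural_cs, simplified]

text \<open>Twisted induction on the right strand with trivial target algebra, hence
  \<open>W = []\<close> and \<open>mu = sid\<close>. On \<open>V\<close> both sides are zero: the
  restricted braiding keeps the strand \<open>V\<close> after the crossing, and epsilon kills it
  there.\<close>

lemma Es_cs_right:
  assumes "obs xs" shows "lw A (Es xs) = Es (A # xs) \<odot>\<odot> cs xs"
proof -
  obtain sg where sg: "natural sg [A, V] [V, A]"
    "\<And>xs. obs xs \<Longrightarrow> cs xs \<odot>\<odot> lw A (e1 xs) = e1 (A # xs) \<odot>\<odot> sg xs" by (rule restrict_right) (rule that)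
  show ?thesis
    by (rule extend_right[where X = "[A]" and W = "[]" and mu = sid, OF _ _ _ _ _ _ _ assms])
       (use natural_lw[OF A_Ob natural_Es] natural_scomp[OF natural_cs natural_Es1] in
        \<open>simp_all add: bisimps natural_simps[OF sg(1), simplified] diagram bialg sg(2)\<close>)
qed

lemma Es_cs_left:
  assumes "obs xs" shows "Es (A # xs) = lw A (Es xs) \<odot>\<odot> cs xs"
proof -
  obtain sg where sg: "natural sg [V, A] [A, V]"
    "\<And>xs. obs xs \<Longrightarrow> cs xs \<odot>\<odot> e1 (A # xs) = lw A (e1 xs) \<odot>\<odot> sg xs" by (rule restrict_left) (rule that)
  \<comment> \<open>On this side the restricted braiding \<open>sg\<close> remains in front of
    epsilon, so the vanishing on \<open>V\<close> is prepared with \<open>sg\<close> as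
    tail.\<close>
  have E: "lw A (Es xs) \<odot>\<odot> lw A (e1 xs) \<odot>\<odot> sg xs = szero (V # A # xs) (A # xs)" if "obs xs" for xs
    using that lw_cong_scomp[OF Es_e1, THEN scomp_ext, OF that, of A "sg xs"]
    by (simp add: bisimps natural_simps[OF sg(1), simplified])
  show ?thesis
    by (rule extend_left[where X = "[A]" and W = "[]" and mu = sid, OF _ _ _ _ _ _ _ assms])
       (use natural_scomp[OF natural_cs natural_lw[OF A_Ob natural_Es]] natural_Es1 in
        \<open>simp_all add: bisimps natural_simps[OF sg(1), simplified] diagram bialg sg(2) E\<close>)
qed

text \<open>When the extra strand starts on the left, the Yang-Baxter equation and the far commutations of
  crossings must be oriented the other way for both sides to reach the same normal form.\<close>

lemmas diagram_right0 = ms_assoc ms_us_left ms_us_right cs_ms_left cs_ms_right cs_us_left cs_us_right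
  lw_ms lw_us cs_lw[where t = "cs xs" for xs] cs_lw[where t = "lw A (cs xs)" for xs]
  cs_lw[where t = "lw A (lw A (cs xs))" for xs]
  cs_lw[where t = "ms xs" for xs] cs_lw[where t = "lw A (ms xs)" for xs] cs_lw[where t = "lw A (lw A (ms xs))" for xs]
  cs_YB[symmetric]
lemmas diagram_right1 = diagram_right0 diagram_right0[THEN lw_cong_scomp]
lemmas diagram_right2 = diagram_right1 diagram_right1[THEN lw_cong_scomp, THEN lw_cong_scomp]
lemmas diagram_right = diagram_right2[unfolded lw_scomp] diagram_right2[THEN scomp_ext, unfolded lw_scomp scomp_assoc]

lemmas YB1 = cs_YB cs_YB[THEN lw_cong_scomp]
lemmas YB = YB1[unfolded lw_scomp] YB1[THEN scomp_ext, unfolded lw_scomp scomp_assoc]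

text \<open>Both sides are multiplicative in the second strand, twisted by the first, with target
  algebra \<open>A\<close> tensor \<open>A\<close>. Where Delta acts first, the passive strand
  crosses both of its outputs, and the Yang-Baxter equation moves these crossings past the one
  inside \<open>ms2\<close>. On \<open>V\<close>, Delta inserts a unit on either side, and units
  pass crossings freely.\<close>

lemma Ds_cs_right:
  assumes "obs xs" shows "lw A (cs xs) \<odot>\<odot> cs (A # xs) \<odot>\<odot> lw A (Ds xs) = Ds (A # xs) \<odot>\<odot> cs xs"
proof -
  obtain sg where sg: "natural sg [A, V] [V, A]"
    "\<And>xs. obs xs \<Longrightarrow> cs xs \<odot>\<odot> lw A (e1 xs) = e1 (A # xs) \<odot>\<odot> sg xs" by (rule restrict_right) (rule that)
  note nsg = natural_simps[OF sg(1), simplified]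
  have sg1: "sg (A # xs) \<odot>\<odot> lw A (lw V (us xs)) = lw V (lw A (us xs)) \<odot>\<odot> sg xs" if "obs xs" for xs
    using naturalD'[OF sg(1), of "us xs" "A # xs"] that by (simp add: bisimps)
  \<comment> \<open>After the crossing a letter \<open>V\<close> can stand on the left. Hence
    naturality of \<open>sg\<close> against inserted units is needed, and the braided algebra rules
    are whiskered by \<open>V\<close> as well.\<close>
  note L1 = sg(2) sg1 sg(2)[THEN lw_cong_scomp] diagram0[THEN lw_cong_scomp[where X = V]]
  show ?thesis
  proof (rule extend_right[where X = "[A]" and W = "[A, A]" and mu = ms2, OF _ _ _ _ _ _ _ assms])
    fix xs assume "obs xs"
    then show "(lw A (cs xs) \<odot>\<odot> cs (A # xs) \<odot>\<odot> lw A (Ds xs)) \<odot>\<odot> lws [A] (ms xs) =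
      ms2 ([A] @ xs) \<odot>\<odot> lws [A, A] (lw A (cs xs) \<odot>\<odot> cs (A # xs) \<odot>\<odot> lw A (Ds xs)) \<odot>\<odot>
      lw A (cs (A # xs)) \<odot>\<odot> cs (A # A # xs) \<odot>\<odot> lw A (Ds (A # xs))"
      by (simp add: bisimps ms2_def diagram_right bialg Ds_over)
    from \<open>obs xs\<close> show "(Ds (A # xs) \<odot>\<odot> cs xs) \<odot>\<odot> lws [A] (ms xs) =
       ms2 ([A] @ xs) \<odot>\<odot> lws [A, A] (Ds (A # xs) \<odot>\<odot> cs xs) \<odot>\<odot> Ds (A # A # xs) \<odot>\<odot> cs (A # xs)"
      by (simp add: bisimps ms2_def diagram bialg)
    from \<open>obs xs\<close> show "(lw A (cs xs) \<odot>\<odot> cs (A # xs) \<odot>\<odot> lw A (Ds xs)) \<odot>\<odot> lws [A] (us xs) =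
          (Ds (A # xs) \<odot>\<odot> cs xs) \<odot>\<odot> lws [A] (us xs)"
      by (simp add: bisimps us2_def diagram bialg)
    from \<open>obs xs\<close> show "(lw A (cs xs) \<odot>\<odot> cs (A # xs) \<odot>\<odot> lw A (Ds xs)) \<odot>\<odot> lws [A] (e1 xs) =
          (Ds (A # xs) \<odot>\<odot> cs xs) \<odot>\<odot> lws [A] (e1 xs)"
      by (simp add: bisimps us2_def diagram bialg L1 L1[THEN scomp_ext] nsg)
  qed (use natural_scomp[OF natural_cs natural_Ds1]
      natural_scomp[OF natural_scomp[OF natural_lw[OF A_Ob natural_Ds] natural_cs1] natural_lw[OF A_Ob natural_cs]] in
     \<open>simp_all add: scomp_assoc\<close>)
qed

lemma Ds_cs_left:
  assumes "obs xs" shows "cs (A # xs) \<odot>\<odot> lw A (cs xs) \<odot>\<odot> Ds (A # xs) = lw A (Ds xs) \<odot>\<odot> cs xs"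
proof -
  obtain sg where sg: "natural sg [V, A] [A, V]"
    "\<And>xs. obs xs \<Longrightarrow> cs xs \<odot>\<odot> e1 (A # xs) = lw A (e1 xs) \<odot>\<odot> sg xs" by (rule restrict_left) (rule that)
  note nsg = natural_simps[OF sg(1), simplified]
  have sg1: "sg (A # xs) \<odot>\<odot> lw V (lw A (us xs)) = lw A (lw V (us xs)) \<odot>\<odot> sg xs" if "obs xs" for xs
    using naturalD'[OF sg(1), of "us xs" "A # xs"] that by (simp add: bisimps)
  note L1 = sg(2) sg1 sg(2)[THEN lw_cong_scomp] diagram0[THEN lw_cong_scomp[where X = V]]
  show ?thesis
  proof (rule extend_left[where X = "[A]" and W = "[A, A]" and mu = ms2, OF _ _ _ _ _ _ _ assms])
    fix xs assume "obs xs"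
    then show "(cs (A # xs) \<odot>\<odot> lw A (cs xs) \<odot>\<odot> Ds (A # xs)) \<odot>\<odot> ms ([A] @ xs) =
      lws [A] (ms2 xs) \<odot>\<odot> (cs (A # [A, A] @ xs) \<odot>\<odot> lw A (cs ([A, A] @ xs)) \<odot>\<odot> Ds (A # [A, A] @ xs)) \<odot>\<odot>
        lw A (cs (A # xs) \<odot>\<odot> lw A (cs xs) \<odot>\<odot> Ds (A # xs))"
      by (simp add: bisimps ms2_def diagram YB bialg Ds_over)
    from \<open>obs xs\<close> show "(lw A (Ds xs) \<odot>\<odot> cs xs) \<odot>\<odot> ms ([A] @ xs) =
       lws [A] (ms2 xs) \<odot>\<odot> (lw A (Ds ([A, A] @ xs)) \<odot>\<odot> cs ([A, A] @ xs)) \<odot>\<odot> lw A (lw A (Ds xs) \<odot>\<odot> cs xs)"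
      by (simp add: bisimps ms2_def diagram_right bialg Ds_under)
    from \<open>obs xs\<close> show "(cs (A # xs) \<odot>\<odot> lw A (cs xs) \<odot>\<odot> Ds (A # xs)) \<odot>\<odot> us ([A] @ xs) =
       (lw A (Ds xs) \<odot>\<odot> cs xs) \<odot>\<odot> us ([A] @ xs)"
      by (simp add: bisimps us2_def diagram bialg)
    from \<open>obs xs\<close> show "(cs (A # xs) \<odot>\<odot> lw A (cs xs) \<odot>\<odot> Ds (A # xs)) \<odot>\<odot> e1 ([A] @ xs) =
       (lw A (Ds xs) \<odot>\<odot> cs xs) \<odot>\<odot> e1 ([A] @ xs)"
      by (simp add: bisimps us2_def diagram bialg L1 L1[THEN scomp_ext] nsg)
  qed (use natural_scomp[OF natural_cs natural_lw[OF A_Ob natural_Ds]]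
      natural_scomp[OF natural_scomp[OF natural_Ds1 natural_lw[OF A_Ob natural_cs]] natural_cs1] in
     \<open>simp_all add: scomp_assoc\<close>)
qed

text \<open>The multiplication of \<open>A \<otimes> A \<otimes> A\<close>, bracketed as \<open>(A \<otimes> A) \<otimes> A\<close>.\<close>

definition "ms3 xs = ms2 (A # xs) \<odot>\<odot> lws [A, A, A, A] (ms xs) \<odot>\<odot>
  lws [A, A] (lw A (cs (A # xs)) \<odot>\<odot> cs (A # A # xs))"

section \<open>Coassociativity and the counit axioms\<close>

lemmas Ds_cs0 = Ds_cs_right[symmetric] Ds_cs_left[symmetric]
lemmas Ds_cs1 = Ds_cs0 Ds_cs0[THEN lw_cong_scomp]
lemmas Ds_cs2 = Ds_cs1 Ds_cs1[THEN lw_cong_scomp, THEN lw_cong_scomp]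
lemmas Ds_cs = Ds_cs2[unfolded lw_scomp] Ds_cs2[THEN scomp_ext, unfolded lw_scomp scomp_assoc]

lemmas Es_cs0 = Es_cs_right[symmetric] Es_cs_left[symmetric]
lemmas Es_cs1 = Es_cs0 Es_cs0[THEN lw_cong_scomp]
lemmas Es_cs = Es_cs1 Es_cs1[THEN scomp_ext]

text \<open>Both sides are algebra morphisms into the threefold tensor power; \<open>Ds_cs\<close>
  carries the outer Delta across the crossing in \<open>ms2\<close>. On \<open>V\<close> each side
  is the sum of the three ways to place \<open>e1\<close> beside two units, and only the bracketing
  of the sum differs.\<close>

lemma coassoc:
  assumes "obs xs" shows "Ds (A # xs) \<odot>\<odot> Ds xs = lw A (Ds xs) \<odot>\<odot> Ds xs"
proof (rule extend_left[where X = "[]" and W = "[A, A, A]" and mu = ms3, OF _ _ _ _ _ _ _ assms])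
  fix xs assume xs: "obs xs"
  show "(Ds (A # xs) \<odot>\<odot> Ds xs) \<odot>\<odot> ms ([] @ xs) = lws [] (ms3 xs) \<odot>\<odot>
     (Ds (A # [A, A, A] @ xs) \<odot>\<odot> Ds ([A, A, A] @ xs)) \<odot>\<odot> lw A (Ds (A # xs) \<odot>\<odot> Ds xs)"
    using xs by (simp add: bisimps ms2_def ms3_def diagram bialg Ds_over Ds_cs)
  show "(lw A (Ds xs) \<odot>\<odot> Ds xs) \<odot>\<odot> ms ([] @ xs) = lws [] (ms3 xs) \<odot>\<odot>
     (lw A (Ds ([A, A, A] @ xs)) \<odot>\<odot> Ds ([A, A, A] @ xs)) \<odot>\<odot> lw A (lw A (Ds xs) \<odot>\<odot> Ds xs)"
    using xs by (simp add: bisimps ms2_def ms3_def diagram bialg Ds_over Ds_cs)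
  show "(Ds (A # xs) \<odot>\<odot> Ds xs) \<odot>\<odot> us ([] @ xs) = (lw A (Ds xs) \<odot>\<odot> Ds xs) \<odot>\<odot> us ([] @ xs)"
    using xs by (simp add: bisimps us2_def diagram bialg)
  show "(Ds (A # xs) \<odot>\<odot> Ds xs) \<odot>\<odot> e1 ([] @ xs) = (lw A (Ds xs) \<odot>\<odot> Ds xs) \<odot>\<odot> e1 ([] @ xs)"
    using xs by (simp add: bisimps us2_def diagram bialg sadd_assoc)
qed (use natural_scomp[OF natural_Ds natural_Ds1] natural_scomp[OF natural_Ds natural_lw[OF A_Ob natural_Ds]] in \<open>simp_all\<close>)

text \<open>An endomorphism of the algebra \<open>A\<close> is compared with the identity. On
  \<open>V\<close>, epsilon kills the summand with \<open>e1\<close> in the left factor and removes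
  the unit from the other.\<close>

lemma counit_left:
  assumes "obs xs" shows "Es (A # xs) \<odot>\<odot> Ds xs = sid (A # xs)"
proof (rule extend_left[where X = "[]" and W = "[A]" and mu = ms, OF _ _ _ _ _ _ _ assms])
  fix xs assume xs: "obs xs"
  show "(Es (A # xs) \<odot>\<odot> Ds xs) \<odot>\<odot> ms ([] @ xs) = lws [] (ms xs) \<odot>\<odot>
     (Es (A # [A] @ xs) \<odot>\<odot> Ds ([A] @ xs)) \<odot>\<odot> lw A (Es (A # xs) \<odot>\<odot> Ds xs)"
    using xs by (simp add: bisimps ms2_def diagram bialg Es_cs)
  show "(Es (A # xs) \<odot>\<odot> Ds xs) \<odot>\<odot> us ([] @ xs) = sid (A # xs) \<odot>\<odot> us ([] @ xs)"
    using xs by (simp add: bisimps us2_def diagram bialg)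
  show "(Es (A # xs) \<odot>\<odot> Ds xs) \<odot>\<odot> e1 ([] @ xs) = sid (A # xs) \<odot>\<odot> e1 ([] @ xs)"
    using xs by (simp add: bisimps us2_def diagram bialg sadd_szero)
qed (use natural_scomp[OF natural_Ds natural_Es1] natural_sid[of "[A]"] in \<open>simp_all add: bisimps\<close>)

lemma counit_right:
  assumes "obs xs" shows "lw A (Es xs) \<odot>\<odot> Ds xs = sid (A # xs)"
proof (rule extend_left[where X = "[]" and W = "[A]" and mu = ms, OF _ _ _ _ _ _ _ assms])
  fix xs assume xs: "obs xs"
  show "(lw A (Es xs) \<odot>\<odot> Ds xs) \<odot>\<odot> ms ([] @ xs) = lws [] (ms xs) \<odot>\<odot>
     (lw A (Es ([A] @ xs)) \<odot>\<odot> Ds ([A] @ xs)) \<odot>\<odot> lw A (lw A (Es xs) \<odot>\<odot> Ds xs)"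
    using xs by (simp add: bisimps ms2_def diagram bialg Es_cs)
  show "(lw A (Es xs) \<odot>\<odot> Ds xs) \<odot>\<odot> us ([] @ xs) = sid (A # xs) \<odot>\<odot> us ([] @ xs)"
    using xs by (simp add: bisimps us2_def diagram bialg)
  show "(lw A (Es xs) \<odot>\<odot> Ds xs) \<odot>\<odot> e1 ([] @ xs) = sid (A # xs) \<odot>\<odot> e1 ([] @ xs)"
    using xs by (simp add: bisimps us2_def diagram bialg szero_sadd)
qed (use natural_scomp[OF natural_Ds natural_lw[OF A_Ob natural_Es]] natural_sid[of "[A]"] in \<open>simp_all add: bisimps\<close>)

text \<open>In a power of at least two, multiplicativity of epsilon splits off the last factor
  \<open>V\<close>, where epsilon is zero.\<close>

lemma \<epsilon>_e: "\<epsilon> \<cdot> e n = (if n = 0 then \<langle>\<I>\<rangle> else \<^bold>0 (tpow M V n) \<I>)"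
proof (induction n rule: induct_nat_012)
  case 0
  then show ?case using \<epsilon>_mor by (simp add: e_0 algebra_mor_def)
next
  case 1
  then show ?case using \<epsilon>_e1 by simp
next
  case (ge2 k)
  have "\<epsilon> \<cdot> e (Suc (Suc k)) = \<^bold>0 (tpow M V (Suc (Suc k))) \<I>"
    apply (subst srep_eq)
    apply (rule srep_Comp srep_e srep_\<epsilon> srep_Zero packs_intros tpow_Ob)+
  proof (intro allI impI)
    fix xs assume xs: "obs xs"
    let ?P = "tpow M V (Suc k)"
    have n: "lw A (e1 xs) \<odot>\<odot> es (Suc k) (V # xs) = es (Suc k) (A # xs) \<odot>\<odot> lw ?P (e1 xs)"
      using naturalD'[OF natural_es, of "e1 xs" "A # xs" "Suc k"] xs by (simp add: bisimps)
    have "Es xs \<odot>\<odot> es (Suc (Suc k)) xs =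
       Es xs \<odot>\<odot> ms xs \<odot>\<odot> lw A (e1 xs) \<odot>\<odot> es (Suc k) (V # xs) \<odot>\<odot> split ?P V xs"
      using xs by (simp add: es_Suc scomp_ext[OF n] scomp_assoc)
    also have "\<dots> = szero (V # xs) xs \<odot>\<odot> Es (V # xs) \<odot>\<odot> es (Suc k) (V # xs) \<odot>\<odot> split ?P V xs"
      using xs by (simp add: bisimps bialg)
    also have "\<dots> = szero (tpow M V (Suc (Suc k)) # xs) xs"
    proof -
      have "hom (Es (V # xs) \<odot>\<odot> es (Suc k) (V # xs) \<odot>\<odot> split ?P V xs) (tpow M V (Suc (Suc k)) # xs) (V # xs)"
        using natural_hom[OF natural_Es, of "V # xs"] natural_hom[OF natural_es[of "Suc k"], of "V # xs"] xs
          hom_intros(5)[of ?P V xs] tpow_Ob[of "Suc k"]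
        by (auto intro!: hom_intros(2) simp del: tpow_Ob)
      then show ?thesis using xs by (simp add: szero_scomp homD)
    qed
    finally show "Es xs \<odot>\<odot> es (Suc (Suc k)) xs =
      szero (fst (tip (tpow M V (Suc (Suc k)))) @ xs) (fst unitp @ xs)" by simp
  qed
  then show ?case by simp
qed

section \<open>The coalgebra and bialgebra axioms, translated back into \<open>M\<close>\<close>

lemma coalgebra: "coalgebra M A \<Delta> \<epsilon>"
proof -
  have 1: "\<a> A A A \<cdot> (\<Delta> \<boxtimes> \<langle>A\<rangle>) \<cdot> \<Delta> = (\<langle>A\<rangle> \<boxtimes> \<Delta>) \<cdot> \<Delta>"
    by (subst srep_eq, (rule bisreps srep_intros packs_intros A_Ob)+, simp add: bisimps coassoc cong: conj_cong)
  have 2: "\<l> A \<cdot> (\<epsilon> \<boxtimes> \<langle>A\<rangle>) \<cdot> \<Delta> = \<langle>A\<rangle>"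
    by (subst srep_eq, (rule bisreps srep_intros packs_intros A_Ob)+, simp add: bisimps counit_left cong: conj_cong)
  have 3: "\<r> A \<cdot> (\<langle>A\<rangle> \<boxtimes> \<epsilon>) \<cdot> \<Delta> = \<langle>A\<rangle>"
    by (subst srep_eq, (rule bisreps srep_intros packs_intros A_Ob)+, simp add: bisimps counit_right cong: conj_cong)
  show ?thesis
    unfolding coalgebra_def using 1 2 3 srep_Hom[OF srep_\<Delta>] srep_Hom[OF srep_\<epsilon>] by simp
qed

lemma braided_coalgebra: "braided_coalgebra M A \<Delta> \<epsilon> c"
proof -
  have 1: "(\<Delta> \<boxtimes> \<langle>A\<rangle>) \<cdot> c =
       \<a>\<inverse> A A A \<cdot> (\<langle>A\<rangle> \<boxtimes> c) \<cdot> \<a> A A A \<cdot> (c \<boxtimes> \<langle>A\<rangle>) \<cdot> \<a>\<inverse> A A A \<cdot> (\<langle>A\<rangle> \<boxtimes> \<Delta>)"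
    by (subst srep_eq, (rule bisreps srep_intros packs_intros A_Ob)+, simp add: bisimps Ds_cs_right cong: conj_cong)
  have 2: "(\<langle>A\<rangle> \<boxtimes> \<Delta>) \<cdot> c =
       \<a> A A A \<cdot> (c \<boxtimes> \<langle>A\<rangle>) \<cdot> \<a>\<inverse> A A A \<cdot> (\<langle>A\<rangle> \<boxtimes> c) \<cdot> \<a> A A A \<cdot> (\<Delta> \<boxtimes> \<langle>A\<rangle>)"
    by (subst srep_eq, (rule bisreps srep_intros packs_intros A_Ob)+, simp add: bisimps Ds_cs_left cong: conj_cong)
  have 3: "\<l> A \<cdot> (\<epsilon> \<boxtimes> \<langle>A\<rangle>) \<cdot> c = \<r> A \<cdot> (\<langle>A\<rangle> \<boxtimes> \<epsilon>)"
    by (subst srep_eq, (rule bisreps srep_intros packs_intros A_Ob)+, simp add: bisimps Es_cs_right[symmetric] cong: conj_cong)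
  have 4: "\<r> A \<cdot> (\<langle>A\<rangle> \<boxtimes> \<epsilon>) \<cdot> c = \<l> A \<cdot> (\<epsilon> \<boxtimes> \<langle>A\<rangle>)"
    by (subst srep_eq, (rule bisreps srep_intros packs_intros A_Ob)+, simp add: bisimps Es_cs_left[symmetric] cong: conj_cong)
  show ?thesis
    unfolding braided_coalgebra_def using 1 2 3 4 coalgebra braided_alg by (simp add: braided_algebra_def)
qed

lemma braided_bialgebra: "braided_bialgebra M A m u \<Delta> \<epsilon> c"
proof -
  \<comment> \<open>This differs from multiplicativity of Delta into \<open>A\<close> tensor
    \<open>A\<close> only in the bracketing of the composite.\<close>
  have 1: "\<Delta> \<cdot> m = (m \<boxtimes> m) \<cdot> mid_braiding M A c \<cdot> (\<Delta> \<boxtimes> \<Delta>)"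
    unfolding mid_braiding_def
    by (subst srep_eq, (rule bisreps srep_intros packs_intros A_Ob)+, simp add: bisimps Ds_ms ms2_def cong: conj_cong)
  show ?thesis
    unfolding braided_bialgebra_def using 1 braided_coalgebra braided_alg \<Delta>_mor \<epsilon>_mor
    by (simp add: algebra_mor_def)
qed

end

subsection \<open>Functoriality\<close>

locale tensor_bialg_mor = additive_tensor M + X: tensor_bialg M A m u c V e cT \<Delta> \<epsilon> +
    Y: tensor_bialg M A' m' u' c' V' e' cT' \<Delta>' \<epsilon>'
  for M :: "('o, 'm, 'z) premoncat_scheme" (structure) and A m u c V e cT \<Delta> \<epsilon> A' m' u' c' V' e' cT' \<Delta>' \<epsilon>' +
  fixes f f0 :: 'm
  assumes f_mor: "algebra_mor M A m u A' m' u' f"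
    and f_br: "braided_mor M A c A' c' f"
    and f0_Hom: "f0 \<in> Hom M V V'"
    and f_e1: "f \<cdot> e 1 = e' 1 \<cdot> f0"
begin

definition "fs = strict A X.pA f A' Y.pA"
definition "f0s = strict V (tip V) f0 V' (tip V')"

lemma srep_f: "srep f A X.pA A' Y.pA fs"
  and srep_f0: "srep f0 V (tip V) V' (tip V') f0s"
  unfolding fs_def f0s_def using f_mor f0_Hom
  by (auto intro!: srep_strict packs_intros simp: algebra_mor_def)

lemma natural_fs: "natural fs [A] [A']" and natural_f0s: "natural f0s [V] [V']"
  using srep_natural[OF srep_f] srep_natural[OF srep_f0] by simp_all

lemmas morsimps = X.bisimps Y.bisimps natural_simps[OF natural_fs, simplified] natural_simps[OF natural_f0s, simplified]
lemmas morreps = X.bisreps Y.bisreps srep_f srep_f0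

lemma fs_lw: "\<lbrakk>sarr t; scod t = ys\<rbrakk> \<Longrightarrow> fs ys \<odot>\<odot> lw A t = lw A' t \<odot>\<odot> fs (sdom t)"
  using naturalD'[OF natural_fs, of t] by simp

lemma f0s_lw: "\<lbrakk>sarr t; scod t = ys\<rbrakk> \<Longrightarrow> f0s ys \<odot>\<odot> lw V t = lw V' t \<odot>\<odot> f0s (sdom t)"
  using naturalD'[OF natural_f0s, of t] by simp

lemma fs_ms: "obs xs \<Longrightarrow> fs xs \<odot>\<odot> X.ms xs = Y.ms xs \<odot>\<odot> lw A' (fs xs) \<odot>\<odot> fs (A # xs)"
proof -
  have "f \<cdot> m = m' \<cdot> (f \<boxtimes> f) \<longleftrightarrow> (\<forall>xs. obs xs \<longrightarrow> fs xs \<odot>\<odot> X.ms xs = Y.ms xs \<odot>\<odot> lw A' (fs xs) \<odot>\<odot> fs (A # xs))"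
    by (rule trans[OF srep_eq], (rule morreps srep_intros packs_intros X.A_Ob Y.A_Ob)+, simp add: morsimps fs_lw cong: conj_cong)
  then show "obs xs \<Longrightarrow> ?thesis" using f_mor by (auto simp: algebra_mor_def)
qed

lemma fs_us: "obs xs \<Longrightarrow> fs xs \<odot>\<odot> X.us xs = Y.us xs"
proof -
  have "f \<cdot> u = u' \<longleftrightarrow> (\<forall>xs. obs xs \<longrightarrow> fs xs \<odot>\<odot> X.us xs = Y.us xs)"
    by (rule trans[OF srep_eq], (rule morreps srep_intros packs_intros X.A_Ob Y.A_Ob)+, simp add: morsimps fs_lw cong: conj_cong)
  then show "obs xs \<Longrightarrow> ?thesis" using f_mor by (auto simp: algebra_mor_def)
qed

lemma fs_e1: "obs xs \<Longrightarrow> fs xs \<odot>\<odot> X.e1 xs = Y.e1 xs \<odot>\<odot> f0s xs"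
proof -
  have "f \<cdot> e 1 = e' 1 \<cdot> f0 \<longleftrightarrow> (\<forall>xs. obs xs \<longrightarrow> fs xs \<odot>\<odot> X.e1 xs = Y.e1 xs \<odot>\<odot> f0s xs)"
    unfolding One_nat_def
    by (rule trans[OF srep_eq], (rule morreps srep_intros packs_intros X.A_Ob Y.A_Ob)+, simp add: morsimps fs_lw cong: conj_cong)
  then show "obs xs \<Longrightarrow> ?thesis" using f_e1 by auto
qed

lemma fs_cs: "obs xs \<Longrightarrow> lw A' (fs xs) \<odot>\<odot> fs (A # xs) \<odot>\<odot> X.cs xs = Y.cs xs \<odot>\<odot> lw A' (fs xs) \<odot>\<odot> fs (A # xs)"
proof -
  have "c' \<cdot> (f \<boxtimes> f) = (f \<boxtimes> f) \<cdot> c \<longleftrightarrow> (\<forall>xs. obs xs \<longrightarrow>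
      Y.cs xs \<odot>\<odot> lw A' (fs xs) \<odot>\<odot> fs (A # xs) = lw A' (fs xs) \<odot>\<odot> fs (A # xs) \<odot>\<odot> X.cs xs)"
    by (rule trans[OF srep_eq], (rule morreps srep_intros packs_intros X.A_Ob Y.A_Ob)+, simp add: morsimps fs_lw scomp_ext[OF fs_lw] cong: conj_cong)
  then show "obs xs \<Longrightarrow> ?thesis" using f_br by (auto simp: braided_mor_def)
qed

lemmas mor0 = fs_ms fs_us fs_e1 fs_cs fs_lw f0s_lw Y.lw_cs[where t = "fs xs" for xs] Y.lw_ms Y.lw_us
   Y.lw_e1 Y.Ds_ms Y.Ds_us Y.Ds_e1 Y.Es_ms Y.Es_us Y.Es_e1 Y.Es_lw
   X.Ds_ms X.Ds_us X.Ds_e1 X.Es_ms X.Es_us X.Es_e1 X.Ds_lw X.Es_lw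
lemmas mor1 = mor0 mor0[THEN lw_cong_scomp, unfolded lw_scomp]
lemmas mor2 = mor1 mor1[THEN lw_cong_scomp, unfolded lw_scomp]
lemmas mor = mor2 mor2[THEN scomp_ext, unfolded scomp_assoc]

text \<open>Two algebra morphisms from \<open>A\<close> to the tensor square of \<open>A'\<close>;
  that f tensor f is multiplicative uses that \<open>f\<close> commutes with the braidings. On
  \<open>V\<close> both give the sum of unit insertions beside the image of
  \<open>f0\<close>.\<close>

lemma Ds_fs:
  assumes "obs xs" shows "Y.Ds xs \<odot>\<odot> fs xs = lw A' (fs xs) \<odot>\<odot> fs (A # xs) \<odot>\<odot> X.Ds xs"
proof (rule X.extend_left[where X = "[]" and W = "[A', A']" and mu = Y.ms2, OF _ _ _ _ _ _ _ assms])
  fix xs assume xs: "obs xs"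
  show "(Y.Ds xs \<odot>\<odot> fs xs) \<odot>\<odot> X.ms ([] @ xs) = lws [] (Y.ms2 xs) \<odot>\<odot>
     (Y.Ds ([A', A'] @ xs) \<odot>\<odot> fs ([A', A'] @ xs)) \<odot>\<odot> lw A (Y.Ds xs \<odot>\<odot> fs xs)"
    using xs by (simp add: morsimps Y.ms2_def X.ms2_def mor)
  show "(lw A' (fs xs) \<odot>\<odot> fs (A # xs) \<odot>\<odot> X.Ds xs) \<odot>\<odot> X.ms ([] @ xs) = lws [] (Y.ms2 xs) \<odot>\<odot>
     (lw A' (fs ([A', A'] @ xs)) \<odot>\<odot> fs (A # [A', A'] @ xs) \<odot>\<odot> X.Ds ([A', A'] @ xs)) \<odot>\<odot>
        lw A (lw A' (fs xs) \<odot>\<odot> fs (A # xs) \<odot>\<odot> X.Ds xs)"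
    using xs by (simp add: morsimps Y.ms2_def X.ms2_def mor)
  show "(Y.Ds xs \<odot>\<odot> fs xs) \<odot>\<odot> X.us ([] @ xs) = (lw A' (fs xs) \<odot>\<odot> fs (A # xs) \<odot>\<odot> X.Ds xs) \<odot>\<odot> X.us ([] @ xs)"
    using xs by (simp add: morsimps mor)
  show "(Y.Ds xs \<odot>\<odot> fs xs) \<odot>\<odot> X.e1 ([] @ xs) = (lw A' (fs xs) \<odot>\<odot> fs (A # xs) \<odot>\<odot> X.Ds xs) \<odot>\<odot> X.e1 ([] @ xs)"
    using xs by (simp add: morsimps mor)
next
  show "natural (\<lambda>xs. Y.Ds xs \<odot>\<odot> fs xs) ([A] @ []) ([] @ [A', A'])"
    using natural_scomp[OF natural_fs Y.natural_Ds] by simp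
  show "natural (\<lambda>xs. lw A' (fs xs) \<odot>\<odot> fs (A # xs) \<odot>\<odot> X.Ds xs) ([A] @ []) ([] @ [A', A'])"
    using natural_scomp[OF natural_scomp[OF X.natural_Ds natural_Cons[OF X.A_Ob natural_fs, simplified]] natural_lw[OF Y.A_Ob natural_fs]]
    by simp
qed simp

text \<open>Two algebra morphisms to the unit object that both vanish on \<open>V\<close>.\<close>

lemma Es_fs:
  assumes "obs xs" shows "Y.Es xs \<odot>\<odot> fs xs = X.Es xs"
proof (rule X.extend_left[where X = "[]" and W = "[]" and mu = sid, OF _ _ _ _ _ _ _ assms])
  show "natural (\<lambda>xs. Y.Es xs \<odot>\<odot> fs xs) ([A] @ []) ([] @ [])" "natural X.Es ([A] @ []) ([] @ [])"
    using natural_scomp[OF natural_fs Y.natural_Es] X.natural_Es by simp_all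
qed (simp_all add: morsimps mor)

lemma coalgebra_mor: "coalgebra_mor M A \<Delta> \<epsilon> A' \<Delta>' \<epsilon>' f"
proof -
  have 1: "\<Delta>' \<cdot> f = (f \<boxtimes> f) \<cdot> \<Delta>"
    by (subst srep_eq, (rule morreps srep_intros packs_intros X.A_Ob Y.A_Ob)+, simp add: morsimps Ds_fs fs_lw scomp_ext[OF fs_lw] cong: conj_cong)
  have 2: "\<epsilon>' \<cdot> f = \<epsilon>"
    by (subst srep_eq, (rule morreps srep_intros packs_intros X.A_Ob Y.A_Ob)+, simp add: morsimps Es_fs cong: conj_cong)
  show ?thesis using 1 2 srep_Hom[OF srep_f] by (simp add: coalgebra_mor_def)
qed

end

subsection \<open>The braided bialgebra functor\<close>

locale braided_tensor = additive_tensor M for M :: "('o, 'm, 'z) premoncat_scheme" (structure) +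
  fixes T :: "('o, 'm, 'o \<times> 'm \<times> 'm, 'm) functr"
    and T\<^sub>B\<^sub>r :: "('o \<times> 'm, 'm, 'o \<times> 'm \<times> 'm \<times> 'm, 'm) functr"
    and \<alpha> :: "nat \<Rightarrow> 'o \<Rightarrow> 'm"
  assumes T: "tensor_algebra_functor M T \<alpha>"
    and TBr: "braided_tensor_algebra_functor M T \<alpha> T\<^sub>B\<^sub>r"
begin

context
  fixes V :: 'o and c :: 'm and A :: 'o and m u cA :: 'm
  assumes Vc: "(V, c) \<in> Ob (Br M)" and FOb_TBr: "FOb T\<^sub>B\<^sub>r (V, c) = (A, m, u, cA)"
begin

lemma V_Ob: "V \<in> Ob M"
  using Vc by (simp add: Br_def braided_object_def)

lemma FOb_T: "FOb T V = (A, m, u)"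
  and c_family: "\<exists>cT. braiding_family M V c cT \<and>
    (\<forall>k n. cA \<cdot> (\<alpha> k V \<boxtimes> \<alpha> n V) = (\<alpha> n V \<boxtimes> \<alpha> k V) \<cdot> cT k n)"
proof -
  have "\<exists>A mA uA cA cT. FOb T V = (A, mA, uA) \<and> FOb T\<^sub>B\<^sub>r (V, c) = (A, mA, uA, cA) \<and> braiding_family M V c cT \<and>
        (\<forall>m n. cA \<cdot> (\<alpha> m V \<boxtimes> \<alpha> n V) = (\<alpha> n V \<boxtimes> \<alpha> m V) \<cdot> cT m n)"
    using TBr Vc unfolding braided_tensor_algebra_functor_def by blast
  then show "FOb T V = (A, m, u)" "\<exists>cT. braiding_family M V c cT \<and>
    (\<forall>k n. cA \<cdot> (\<alpha> k V \<boxtimes> \<alpha> n V) = (\<alpha> n V \<boxtimes> \<alpha> k V) \<cdot> cT k n)"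
    using FOb_TBr by auto
qed

lemma braided_algebra_A: "braided_algebra M A m u cA"
proof -
  have "is_functor (Br M) (BrAlg M) T\<^sub>B\<^sub>r"
    using TBr by (simp add: braided_tensor_algebra_functor_def adjunction_def)
  then have "FOb T\<^sub>B\<^sub>r (V, c) \<in> Ob (BrAlg M)" using Vc by (simp add: is_functor_def)
  then show ?thesis by (simp add: FOb_TBr BrAlg_def)
qed

lemma tensor_alg: "tensor_alg M A m u cA V (\<lambda>n. \<alpha> n V)"
proof -
  have cop: "is_coproduct M (tpow M V) A (\<lambda>n. \<alpha> n V)"
    using T V_Ob FOb_T by (auto simp: tensor_algebra_functor_def Omega_def)
  have mult: "\<And>k n. m \<cdot> (\<alpha> k V \<boxtimes> \<alpha> n V) = \<alpha> (k + n) V \<cdot> tpow_add M V k n" and unit: "u = \<alpha> 0 V"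
    using T V_Ob FOb_T by (auto simp: tensor_algebra_functor_def)
  interpret braided_alg M A m u cA
    by unfold_locales (rule braided_algebra_A)
  have P: "tpow M V n \<in> Ob M" for n
    by (induction n rule: induct_nat_012) (auto simp: V_Ob)
  have aH: "\<alpha> n V \<in> Hom M (tpow M V n) A" for n using cop by (auto simp: is_coproduct_def)
  have "m \<cdot> (\<alpha> (Suc n) V \<boxtimes> \<alpha> 1 V) = \<alpha> (Suc (Suc n)) V" for n
    using mult[of "Suc n" 1] Comp_Ide[OF P A_Ob aH[of "Suc (Suc n)"]] by simp
  then show ?thesis
    by unfold_locales (use V_Ob cop unit in simp_all)
qed

text \<open>The universal property of the free algebra: the unit of the adjunction between
  \<open>T\<close> and \<open>Omega\<close> is \<open>\<alpha> 1\<close>.\<close>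

lemma extend_unique:
  assumes "algebra M B mB uB" "g \<in> Hom M V B"
  shows "\<exists>!h. algebra_mor M A m u B mB uB h \<and> h \<cdot> \<alpha> 1 V = g"
proof -
  have "adjunction M (Alg M) T Omega (\<alpha> 1)" using T by (simp add: tensor_algebra_functor_def)
  then have "\<forall>Y\<in>Ob (Alg M). \<forall>f\<in>Hom M V (FOb Omega Y).
        \<exists>!g. g \<in> Hom (Alg M) (FOb T V) Y \<and> FArr Omega (FOb T V) Y g \<cdot> \<alpha> 1 V = f"
    using V_Ob by (simp add: adjunction_def)
  from bspec[OF this, of "(B, mB, uB)"] show ?thesis
    using assms by (simp add: Alg_def Omega_def FOb_T)
qed

lemma tensor_square_Alg: "tensor_square_algebra M (A, m, u, cA) \<in> Ob (Alg M)"
  and ex1_comult: "\<exists>!\<Delta>. is_comult M \<alpha> V (A, m, u, cA) \<Delta>"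
  and ex1_counit: "\<exists>!\<epsilon>. is_counit M \<alpha> V (A, m, u, cA) \<epsilon>"
proof -
  interpret tensor_alg M A m u cA V "\<lambda>n. \<alpha> n V" by (rule tensor_alg)
  show "tensor_square_algebra M (A, m, u, cA) \<in> Ob (Alg M)"
    using tensor_square_algebra by (simp add: tensor_square_algebra_def Alg_def)
  have a1: "\<alpha> 1 V \<in> Hom M V A" using e_Hom[of 1] by simp
  have "delta_l M V u (\<alpha> 1 V) \<in> Hom M V (A \<odot> A)"
    unfolding delta_l_def using V_Ob u_Hom a1 by (auto intro!: Comp_in_Hom[of V "\<I> \<odot> V"] TArr_in_Hom struct_Hom)
  moreover have "delta_r M V u (\<alpha> 1 V) \<in> Hom M V (A \<odot> A)"
    unfolding delta_r_def using V_Ob u_Hom a1 by (auto intro!: Comp_in_Hom[of V "V \<odot> \<I>"] TArr_in_Hom struct_Hom)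
  ultimately have "delta_l M V u (\<alpha> 1 V) \<^bold>+ delta_r M V u (\<alpha> 1 V) \<in> Hom M V (A \<odot> A)"
    using V_Ob by (intro Add_Hom) auto
  from extend_unique[OF tensor_square_algebra this] show "\<exists>!\<Delta>. is_comult M \<alpha> V (A, m, u, cA) \<Delta>"
    by (simp add: is_comult_def tensor_square_algebra_def Alg_def)
  show "\<exists>!\<epsilon>. is_counit M \<alpha> V (A, m, u, cA) \<epsilon>"
    using extend_unique[OF unit_algebra Zero_Hom[OF V_Ob Unit_in_Ob]]
    by (simp add: is_counit_def unit_algebra_def Alg_def)
qed

lemma tensor_bialg:
  assumes "is_comult M \<alpha> V (A, m, u, cA) \<Delta>" "is_counit M \<alpha> V (A, m, u, cA) \<epsilon>"
  obtains cT where "tensor_bialg M A m u cA V (\<lambda>n. \<alpha> n V) cT \<Delta> \<epsilon>"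
proof -
  interpret tensor_alg M A m u cA V "\<lambda>n. \<alpha> n V" by (rule tensor_alg)
  obtain cT where "braiding_family M V c cT"
    "\<forall>k n. cA \<cdot> (\<alpha> k V \<boxtimes> \<alpha> n V) = (\<alpha> n V \<boxtimes> \<alpha> k V) \<cdot> cT k n" using c_family by blast
  then have "tensor_bialg M A m u cA V (\<lambda>n. \<alpha> n V) cT \<Delta> \<epsilon>"
    using assms by unfold_locales
      (auto simp: braiding_family_def Let_def is_comult_def is_counit_def tensor_square_algebra_def unit_algebra_def Alg_def)
  then show thesis by (rule that)
qed

text \<open>By uniqueness, the definite descriptions in \<open>Tbar_Br\<close> denote any pair with
  the defining properties.\<close>

lemma FOb_Tbar_Br:
  assumes "is_comult M \<alpha> V (A, m, u, cA) \<Delta>" "is_counit M \<alpha> V (A, m, u, cA) \<epsilon>"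
  shows "FOb (Tbar_Br M \<alpha> T\<^sub>B\<^sub>r) (V, c) = (A, m, u, \<Delta>, \<epsilon>, cA)"
  using the1_equality[OF ex1_comult assms(1)] the1_equality[OF ex1_counit assms(2)]
  by (simp add: Tbar_Br_def FOb_TBr)

end

lemma FOb_cases:
  assumes "(V, c) \<in> Ob (Br M)"
  obtains A m u cA \<Delta> \<epsilon> cT where "FOb T\<^sub>B\<^sub>r (V, c) = (A, m, u, cA)"
    "FOb (Tbar_Br M \<alpha> T\<^sub>B\<^sub>r) (V, c) = (A, m, u, \<Delta>, \<epsilon>, cA)"
    "tensor_bialg M A m u cA V (\<lambda>n. \<alpha> n V) cT \<Delta> \<epsilon>"
proof -
  obtain A m u cA where F: "FOb T\<^sub>B\<^sub>r (V, c) = (A, m, u, cA)" by (metis prod_cases4)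
  obtain \<Delta> \<epsilon> where d: "is_comult M \<alpha> V (A, m, u, cA) \<Delta>" "is_counit M \<alpha> V (A, m, u, cA) \<epsilon>"
    using ex1_comult[OF assms F] ex1_counit[OF assms F] by blast
  from tensor_bialg[OF assms F d] obtain cT where "tensor_bialg M A m u cA V (\<lambda>n. \<alpha> n V) cT \<Delta> \<epsilon>" by blast
  with F FOb_Tbar_Br[OF assms F d] show thesis by (rule that)
qed

lemma FArr_Tbar_Br:
  assumes "(V, c) \<in> Ob (Br M)" "(W, d) \<in> Ob (Br M)" "f \<in> Hom (Br M) (V, c) (W, d)"
  shows "FArr T\<^sub>B\<^sub>r (V, c) (W, d) f \<in>
    Hom (BrBialg M) (FOb (Tbar_Br M \<alpha> T\<^sub>B\<^sub>r) (V, c)) (FOb (Tbar_Br M \<alpha> T\<^sub>B\<^sub>r) (W, d))"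
proof -
  obtain A m u cA \<Delta> \<epsilon> cT where X: "FOb T\<^sub>B\<^sub>r (V, c) = (A, m, u, cA)"
    "FOb (Tbar_Br M \<alpha> T\<^sub>B\<^sub>r) (V, c) = (A, m, u, \<Delta>, \<epsilon>, cA)"
    "tensor_bialg M A m u cA V (\<lambda>n. \<alpha> n V) cT \<Delta> \<epsilon>" by (rule FOb_cases[OF assms(1)])
  obtain A' m' u' cA' \<Delta>' \<epsilon>' cT' where Y: "FOb T\<^sub>B\<^sub>r (W, d) = (A', m', u', cA')"
    "FOb (Tbar_Br M \<alpha> T\<^sub>B\<^sub>r) (W, d) = (A', m', u', \<Delta>', \<epsilon>', cA')"
    "tensor_bialg M A' m' u' cA' W (\<lambda>n. \<alpha> n W) cT' \<Delta>' \<epsilon>'" by (rule FOb_cases[OF assms(2)])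
  let ?f = "FArr T\<^sub>B\<^sub>r (V, c) (W, d) f"
  have adj: "adjunction (Br M) (BrAlg M) T\<^sub>B\<^sub>r Omega_Br (\<lambda>(V, c). \<alpha> 1 V)"
    using TBr by (simp add: braided_tensor_algebra_functor_def)
  have fH: "f \<in> Hom M V W" using assms(3) by (simp add: Br_def braided_mor_def)
  have "?f \<in> Hom (BrAlg M) (FOb T\<^sub>B\<^sub>r (V, c)) (FOb T\<^sub>B\<^sub>r (W, d))"
    using adj assms by (simp add: adjunction_def is_functor_def)
  then have f: "algebra_mor M A m u A' m' u' ?f" "braided_mor M A cA A' cA' ?f"
    by (simp_all add: X Y BrAlg_def)
  \<comment> \<open>Naturality of the unit of the braided adjunction, whose underlying arrow is
    \<open>\<alpha> 1\<close>, determines the image of \<open>f\<close> on the generators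
    \<open>V\<close>.\<close>
  have "\<forall>X\<in>Ob (Br M). \<forall>Y\<in>Ob (Br M). \<forall>f\<in>Hom (Br M) X Y.
      FArr Omega_Br (FOb T\<^sub>B\<^sub>r X) (FOb T\<^sub>B\<^sub>r Y) (FArr T\<^sub>B\<^sub>r X Y f) \<cdot>\<^bsub>Br M\<^esub> (case X of (V, c) \<Rightarrow> \<alpha> 1 V) =
        (case Y of (V, c) \<Rightarrow> \<alpha> 1 V) \<cdot>\<^bsub>Br M\<^esub> f"
    using adj unfolding adjunction_def by blast
  from this[rule_format, OF assms] have "?f \<cdot> \<alpha> 1 V = \<alpha> 1 W \<cdot> f"
    by (simp add: Omega_Br_def Br_def)
  then have "tensor_bialg_mor M A m u cA V (\<lambda>n. \<alpha> n V) cT \<Delta> \<epsilon> A' m' u' cA' W (\<lambda>n. \<alpha> n W) cT' \<Delta>' \<epsilon>' ?f f"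
    by (intro tensor_bialg_mor.intro additive_tensor_axioms X(3) Y(3)) (rule tensor_bialg_mor_axioms.intro[OF f fH])
  from tensor_bialg_mor.coalgebra_mor[OF this] f show ?thesis by (simp add: X Y BrBialg_def)
qed

text \<open>Identities and composition are those of the underlying arrows in both target categories,
  so the functor laws are inherited from those of the braided tensor algebra. What is new is that
  objects and arrows land in \<open>BrBialg M\<close>.\<close>

lemma functor_Tbar_Br: "is_functor (Br M) (BrBialg M) (Tbar_Br M \<alpha> T\<^sub>B\<^sub>r)"
proof -
  have F: "is_functor (Br M) (BrAlg M) T\<^sub>B\<^sub>r"
    using TBr by (simp add: braided_tensor_algebra_functor_def adjunction_def)
  have arr: "FArr (Tbar_Br M \<alpha> T\<^sub>B\<^sub>r) = FArr T\<^sub>B\<^sub>r" by (simp add: Tbar_Br_def)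
  have ob: "FOb (Tbar_Br M \<alpha> T\<^sub>B\<^sub>r) X \<in> Ob (BrBialg M) \<and>
      \<langle>FOb (Tbar_Br M \<alpha> T\<^sub>B\<^sub>r) X\<rangle>\<^bsub>BrBialg M\<^esub> = \<langle>FOb T\<^sub>B\<^sub>r X\<rangle>\<^bsub>BrAlg M\<^esub>" if "X \<in> Ob (Br M)" for X
  proof -
    obtain V c where X: "X = (V, c)" by force
    from that have "(V, c) \<in> Ob (Br M)" by (simp add: X)
    then obtain A m u cA \<Delta> \<epsilon> cT where F: "FOb T\<^sub>B\<^sub>r (V, c) = (A, m, u, cA)"
      "FOb (Tbar_Br M \<alpha> T\<^sub>B\<^sub>r) (V, c) = (A, m, u, \<Delta>, \<epsilon>, cA)"
      "tensor_bialg M A m u cA V (\<lambda>n. \<alpha> n V) cT \<Delta> \<epsilon>" by (rule FOb_cases)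
    show ?thesis
      using tensor_bialg.braided_bialgebra[OF F(3)] by (simp add: X F BrBialg_def BrAlg_def)
  qed
  have comp: "Comp (BrBialg M) = Comp (BrAlg M)" by (simp add: BrBialg_def BrAlg_def)
  have hom: "FArr T\<^sub>B\<^sub>r X Y f \<in> Hom (BrBialg M) (FOb (Tbar_Br M \<alpha> T\<^sub>B\<^sub>r) X) (FOb (Tbar_Br M \<alpha> T\<^sub>B\<^sub>r) Y)"
    if "X \<in> Ob (Br M)" "Y \<in> Ob (Br M)" "f \<in> Hom (Br M) X Y" for X Y f
    using FArr_Tbar_Br[of "fst X" "snd X" "fst Y" "snd Y" f] that by simp
  show ?thesis
    unfolding is_functor_def arr comp by (intro conjI ballI hom) (use F ob in \<open>simp_all add: is_functor_def\<close>)
qed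

end

theorem lemma3p4:
  fixes M :: "('o, 'm, 'z) premoncat_scheme" (structure)
    and T :: "('o, 'm, 'o \<times> 'm \<times> 'm, 'm) functr"
    and T\<^sub>B\<^sub>r :: "('o \<times> 'm, 'm, 'o \<times> 'm \<times> 'm \<times> 'm, 'm) functr"
    and \<alpha> :: "nat \<Rightarrow> 'o \<Rightarrow> 'm"
  assumes "preadditive_monoidal_category M"
    and "has_equalizers M"
    and "has_denumerable_coproducts M"
    and "\<forall>X\<in>Ob M. \<forall>F\<in>{left_tensor_functor M X, right_tensor_functor M X}.
           additive_functor M M F \<and> preserves_equalizers M M F \<and>
           preserves_denumerable_coproducts M M F"
    and "tensor_algebra_functor M T \<alpha>"
    and "braided_tensor_algebra_functor M T \<alpha> T\<^sub>B\<^sub>r"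
  shows "(\<forall>V c A m\<^sub>A u\<^sub>A c\<^sub>A.
            (V, c) \<in> Ob (Br M) \<and> FOb T\<^sub>B\<^sub>r (V, c) = (A, m\<^sub>A, u\<^sub>A, c\<^sub>A) \<longrightarrow>
            tensor_square_algebra M (A, m\<^sub>A, u\<^sub>A, c\<^sub>A) \<in> Ob (Alg M) \<and>
            (\<exists>!\<Delta>\<^sub>A. is_comult M \<alpha> V (A, m\<^sub>A, u\<^sub>A, c\<^sub>A) \<Delta>\<^sub>A) \<and>
            (\<exists>!\<epsilon>\<^sub>A. is_counit M \<alpha> V (A, m\<^sub>A, u\<^sub>A, c\<^sub>A) \<epsilon>\<^sub>A) \<and>
            (\<forall>\<Delta>\<^sub>A \<epsilon>\<^sub>A. is_comult M \<alpha> V (A, m\<^sub>A, u\<^sub>A, c\<^sub>A) \<Delta>\<^sub>A \<and> is_counit M \<alpha> V (A, m\<^sub>A, u\<^sub>A, c\<^sub>A) \<epsilon>\<^sub>A \<longrightarrow>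
               (\<forall>n. \<epsilon>\<^sub>A \<cdot> \<alpha> n V = (if n = 0 then \<langle>\<I>\<rangle> else \<^bold>0 (tpow M V n) \<I>)) \<and>
               braided_bialgebra M A m\<^sub>A u\<^sub>A \<Delta>\<^sub>A \<epsilon>\<^sub>A c\<^sub>A \<and>
               FOb (Tbar_Br M \<alpha> T\<^sub>B\<^sub>r) (V, c) = (A, m\<^sub>A, u\<^sub>A, \<Delta>\<^sub>A, \<epsilon>\<^sub>A, c\<^sub>A))) \<and>
         is_functor (Br M) (BrBialg M) (Tbar_Br M \<alpha> T\<^sub>B\<^sub>r) \<and>
         functor_eq (Br M) (functor_comp Mho_Br (Tbar_Br M \<alpha> T\<^sub>B\<^sub>r)) T\<^sub>B\<^sub>r"
proof -
  interpret preadditive_monoidal_category M by (rule assms(1))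
  interpret braided_tensor M T T\<^sub>B\<^sub>r \<alpha>
    by unfold_locales (use assms(4-6) in auto)
  have fe: "functor_eq (Br M) (functor_comp Mho_Br (Tbar_Br M \<alpha> T\<^sub>B\<^sub>r)) T\<^sub>B\<^sub>r"
    by (auto simp: functor_eq_def functor_comp_def Mho_Br_def Tbar_Br_def split: prod.splits)
  have bi: "(\<forall>n. \<epsilon> \<cdot> \<alpha> n V = (if n = 0 then \<langle>\<I>\<rangle> else \<^bold>0 (tpow M V n) \<I>)) \<and>
      braided_bialgebra M A m u \<Delta> \<epsilon> cA"
    if "(V, c) \<in> Ob (Br M)" "FOb T\<^sub>B\<^sub>r (V, c) = (A, m, u, cA)"
      "is_comult M \<alpha> V (A, m, u, cA) \<Delta>" "is_counit M \<alpha> V (A, m, u, cA) \<epsilon>" for V c A m u cA \<Delta> \<epsilon>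
  proof -
    note h = that
    obtain cT where X: "tensor_bialg M A m u cA V (\<lambda>n. \<alpha> n V) cT \<Delta> \<epsilon>" by (rule tensor_bialg[OF h]) (rule that)
    show ?thesis using tensor_bialg.\<epsilon>_e[OF X] tensor_bialg.braided_bialgebra[OF X] by simp
  qed
  show ?thesis
    by (intro conjI allI impI functor_Tbar_Br fe; elim conjE)
      (rule tensor_square_Alg ex1_comult ex1_counit FOb_Tbar_Br bi[THEN conjunct1, rule_format] bi[THEN conjunct2];
        assumption)+
qed

end
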